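(* Let $X$ be a complex affine irreducible variety and let $G$ be a finite group of automorphisms of $X$. If $X/G$ is birationally equivalent to an irreducible affine variety $Y$ (over $\mathbb C$), then $\mathrm{Frac}(D(X)^G)\cong \mathrm{Frac}(D(Y))$.
   Context: For an affine variety $X$ with coordinate ring $\mathcal O(X)$ over a field $\mathsf k$ (here $\mathsf k=\mathbb C$), the ring of differential operators is $D(X)=\bigcup_{n\ge 0}D(X)_n$, where $D(X)_0=\mathcal O(X)$ and $D(X)_n=\{d\in \mathrm{End}_{\mathsf k}(\mathcal O(X)) : db-bd\in D(X)_{n-1}\text{ for all } b\in\mathcal O(X)\}$. For irreducible affine $X$ it is an Ore domain. $G$ acts on $\mathcal O(X)$ by algebra automorphisms and on $D(X)$ by $g*d=g\circ d\circ g^{-1}$; $D(X)^G$ is the subring of invariants, which is again an Ore domain. $\mathrm{Frac}$ denotes the skew field of fractions of an Ore domain. $X/G$ is the quotient variety, with coordinate ring $\mathcal O(X)^G$. *)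

theory Defs
  imports "HOL-Analysis.Analysis" "HOL-Algebra.Algebra"
begin

section \<open>Affine varieties over the complex numbers\<close>

inductive_set poly_funs :: "(complex ^ 'n \<Rightarrow> complex) set" where
  const: "(\<lambda>x. c) \<in> poly_funs"
| coord: "(\<lambda>x. x $ i) \<in> poly_funs"
| add: "p \<in> poly_funs \<Longrightarrow> q \<in> poly_funs \<Longrightarrow> (\<lambda>x. p x + q x) \<in> poly_funs"
| mult: "p \<in> poly_funs \<Longrightarrow> q \<in> poly_funs \<Longrightarrow> (\<lambda>x. p x * q x) \<in> poly_funs"

definition algebraic_set :: "(complex ^ 'n) set \<Rightarrow> bool" where
  "algebraic_set V \<longleftrightarrow> (\<exists>S \<subseteq> poly_funs. V = {x. \<forall>p\<in>S. p x = 0})"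

definition irreducible_affine_variety :: "(complex ^ 'n) set \<Rightarrow> bool" where
  "irreducible_affine_variety V \<longleftrightarrow> algebraic_set V \<and> V \<noteq> {} \<and>
     (\<forall>V1 V2. algebraic_set V1 \<longrightarrow> algebraic_set V2 \<longrightarrow> V = V1 \<union> V2 \<longrightarrow> V = V1 \<or> V = V2)"

text \<open>Elements of the coordinate ring are functions on \<open>V\<close>, encoded as extensional functions.\<close>

definition coord_funs :: "(complex ^ 'n) set \<Rightarrow> (complex ^ 'n \<Rightarrow> complex) set" where
  "coord_funs V = {restrict p V | p. p \<in> poly_funs}"

definition polynomial_map_on ::
    "(complex ^ 'n) set \<Rightarrow> (complex ^ 'n \<Rightarrow> complex ^ 'm) \<Rightarrow> bool" where
  "polynomial_map_on V g \<longleftrightarrow> (\<exists>p. (\<forall>i. p i \<in> poly_funs) \<and> (\<forall>x\<in>V. g x = (\<chi> i. p i x)))"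

definition variety_auts :: "(complex ^ 'n) set \<Rightarrow> (complex ^ 'n \<Rightarrow> complex ^ 'n) set" where
  "variety_auts V = {g \<in> Bij V. polynomial_map_on V g \<and>
                                polynomial_map_on V (inv\<^bsub>BijGroup V\<^esub> g)}"

section \<open>Spaces with functions, quotients and birational equivalence\<close>

text \<open>
  An affine variety is regarded as its set of points together with its coordinate ring, an algebra
  of extensional complex-valued functions on the points. This makes the quotient \<open>V/G\<close> available
  intrinsically, as the orbit space with the coordinate ring \<open>\<O>(V)\<^sup>G\<close>, without choosing a
  closed embedding. The Zariski topology and the regular functions on open subsets are
  determined by these data.
\<close>

record 'p fun_space =
  Points :: "'p set"
  Funs :: "('p \<Rightarrow> complex) set"

definition variety_space :: "(complex ^ 'n) set \<Rightarrow> (complex ^ 'n) fun_space" where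
  "variety_space V = \<lparr>Points = V, Funs = coord_funs V\<rparr>"

definition fun_act ::
    "(complex ^ 'n) set \<Rightarrow> (complex ^ 'n \<Rightarrow> complex ^ 'n)
       \<Rightarrow> (complex ^ 'n \<Rightarrow> complex) \<Rightarrow> (complex ^ 'n \<Rightarrow> complex)" where
  "fun_act V g f = compose V f (inv\<^bsub>BijGroup V\<^esub> g)"

definition inv_funs ::
    "(complex ^ 'n) set \<Rightarrow> (complex ^ 'n \<Rightarrow> complex ^ 'n) set \<Rightarrow> (complex ^ 'n \<Rightarrow> complex) set" where
  "inv_funs V G = {f \<in> coord_funs V. \<forall>g\<in>G. fun_act V g f = f}"

definition proj_orbit ::
    "(complex ^ 'n) set \<Rightarrow> (complex ^ 'n \<Rightarrow> complex ^ 'n) set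
       \<Rightarrow> complex ^ 'n \<Rightarrow> (complex ^ 'n) set" where
  "proj_orbit V G x = orbit (BijGroup V\<lparr>carrier := G\<rparr>) (\<lambda>g. g) x"

text \<open>A function on the orbits is regular iff its pullback to \<open>V\<close> lies in \<open>\<O>(V)\<^sup>G\<close>.\<close>

definition quotient_space ::
    "(complex ^ 'n) set \<Rightarrow> (complex ^ 'n \<Rightarrow> complex ^ 'n) set \<Rightarrow> (complex ^ 'n) set fun_space" where
  "quotient_space V G =
     \<lparr>Points = proj_orbit V G ` V,
      Funs = {f \<in> extensional (proj_orbit V G ` V). compose V f (proj_orbit V G) \<in> inv_funs V G}\<rparr>"

lemma quotient_space_funs_bij:
  assumes G: "subgroup G (BijGroup V)"
  shows "bij_betw (\<lambda>f. compose V f (proj_orbit V G)) (Funs (quotient_space V G)) (inv_funs V G)"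
proof -
  let ?p = "proj_orbit V G"
  have p: "?p x = {g x | g. g \<in> G}" for x
    by (simp add: proj_orbit_def orbit_def)
  have GB: "g \<in> Bij V" if "g \<in> G" for g
    using subgroup.mem_carrier[OF G that] by (simp add: BijGroup_def)
  have one: "(\<lambda>x\<in>V. x) \<in> G"
    using subgroup.one_closed[OF G] by (simp add: BijGroup_def)
  have const: "h x = h y" if h: "h \<in> inv_funs V G" and x: "x \<in> V" and y: "y \<in> V"
    and eq: "?p x = ?p y" for h x y
  proof -
    have "(\<lambda>x\<in>V. x) y \<in> ?p y"
      unfolding p using one by blast
    then have "y \<in> ?p x"
      using y eq by simp
    then obtain g where g: "g \<in> G" and yg: "y = g x"
      unfolding p by blast
    have "fun_act V g h y = h y"
      using h g by (simp add: inv_funs_def)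
    moreover have "(inv\<^bsub>BijGroup V\<^esub> g) y = x"
      using GB[OF g] x y yg by (simp add: inv_BijGroup Bij_def bij_betw_def)
    ultimately show ?thesis
      using y by (simp add: fun_act_def compose_def)
  qed
  show ?thesis
  proof (rule bij_betw_imageI)
    show "inj_on (\<lambda>f. compose V f ?p) (Funs (quotient_space V G))"
    proof (rule inj_onI)
      fix f g
      assume f: "f \<in> Funs (quotient_space V G)" and g: "g \<in> Funs (quotient_space V G)"
        and eq: "compose V f ?p = compose V g ?p"
      have "f (?p x) = g (?p x)" if "x \<in> V" for x
        using that fun_cong[OF eq, of x] by (simp add: compose_def)
      then show "f = g"
        using f g by (intro extensionalityI[of f "?p ` V" g]) (auto simp: quotient_space_def)
    qed
    show "(\<lambda>f. compose V f ?p) ` Funs (quotient_space V G) = inv_funs V G"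
    proof (intro subset_antisym subsetI)
      fix h assume h: "h \<in> inv_funs V G"
      define f where "f = (\<lambda>q\<in>?p ` V. h (SOME x. x \<in> V \<and> ?p x = q))"
      have hx: "compose V f ?p = h"
      proof
        fix x
        show "compose V f ?p x = h x"
        proof (cases "x \<in> V")
          case True
          have "(SOME z. z \<in> V \<and> ?p z = ?p x) \<in> V \<and> ?p (SOME z. z \<in> V \<and> ?p z = ?p x) = ?p x"
            by (rule someI[of _ x]) (use True in simp)
          then have "h (SOME z. z \<in> V \<and> ?p z = ?p x) = h x"
              by (intro const[OF h]) (use True in auto)
          then show ?thesis
            using True by (simp add: compose_def f_def)
        next
          case False
          moreover have "h \<in> extensional V"
            using h by (auto simp: inv_funs_def coord_funs_def)
          ultimately show ?thesis
            by (simp add: compose_def extensional_def)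
        qed
      qed
      have "f \<in> Funs (quotient_space V G)"
        using h hx by (simp add: quotient_space_def f_def)
      then show "h \<in> (\<lambda>f. compose V f ?p) ` Funs (quotient_space V G)"
        using hx by blast
    qed (auto simp: quotient_space_def)
  qed
qed

definition zariski_open :: "'p fun_space \<Rightarrow> 'p set \<Rightarrow> bool" where
  "zariski_open S U \<longleftrightarrow> (\<exists>F \<subseteq> Funs S. U = {x \<in> Points S. \<exists>f\<in>F. f x \<noteq> 0})"

definition regular_on :: "'p fun_space \<Rightarrow> 'p set \<Rightarrow> ('p \<Rightarrow> complex) \<Rightarrow> bool" where
  "regular_on S U h \<longleftrightarrow>
     (\<forall>x\<in>U. \<exists>W. zariski_open S W \<and> x \<in> W \<and> W \<subseteq> U \<and>
        (\<exists>a\<in>Funs S. \<exists>b\<in>Funs S. \<forall>y\<in>W. b y \<noteq> 0 \<and> h y = a y / b y))"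

definition open_morphism ::
    "'p fun_space \<Rightarrow> 'p set \<Rightarrow> 'q fun_space \<Rightarrow> 'q set \<Rightarrow> ('p \<Rightarrow> 'q) \<Rightarrow> bool" where
  "open_morphism S U T V \<phi> \<longleftrightarrow> \<phi> ` U \<subseteq> V \<and>
     (\<forall>W \<subseteq> V. zariski_open T W \<longrightarrow>
        zariski_open S {x \<in> U. \<phi> x \<in> W} \<and>
        (\<forall>h. regular_on T W h \<longrightarrow> regular_on S {x \<in> U. \<phi> x \<in> W} (\<lambda>x. h (\<phi> x))))"

text \<open>For irreducible varieties: some nonempty open subsets are isomorphic.\<close>

definition birationally_equivalent :: "'p fun_space \<Rightarrow> 'q fun_space \<Rightarrow> bool" where
  "birationally_equivalent S T \<longleftrightarrow>
     (\<exists>U V \<phi>. zariski_open S U \<and> U \<noteq> {} \<and> zariski_open T V \<and> V \<noteq> {} \<and> bij_betw \<phi> U V \<and>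
        open_morphism S U T V \<phi> \<and> open_morphism T V S U (inv_into U \<phi>))"

section \<open>Differential operators\<close>

text \<open>Algebras over the complex numbers are encoded as \<open>module\<close> records.\<close>

definition coord_alg :: "(complex ^ 'n) set \<Rightarrow> (complex, complex ^ 'n \<Rightarrow> complex) module" where
  "coord_alg V =
     \<lparr>carrier = coord_funs V,
      mult = (\<lambda>f g. \<lambda>x\<in>V. f x * g x),
      one = (\<lambda>x\<in>V. 1),
      ring.zero = (\<lambda>x\<in>V. 0),
      add = (\<lambda>f g. \<lambda>x\<in>V. f x + g x),
      smult = (\<lambda>c f. \<lambda>x\<in>V. c * f x)\<rparr>"

definition lin_endos :: "(complex, 'a, 'm) module_scheme \<Rightarrow> ('a \<Rightarrow> 'a) set" where
  "lin_endos A =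
     {d \<in> carrier A \<rightarrow>\<^sub>E carrier A.
        (\<forall>a\<in>carrier A. \<forall>b\<in>carrier A. d (a \<oplus>\<^bsub>A\<^esub> b) = d a \<oplus>\<^bsub>A\<^esub> d b) \<and>
        (\<forall>c. \<forall>a\<in>carrier A. d (c \<odot>\<^bsub>A\<^esub> a) = c \<odot>\<^bsub>A\<^esub> d a)}"

primrec diff_ops_upto :: "(complex, 'a, 'm) module_scheme \<Rightarrow> nat \<Rightarrow> ('a \<Rightarrow> 'a) set" where
  "diff_ops_upto A 0 = {(\<lambda>f\<in>carrier A. a \<otimes>\<^bsub>A\<^esub> f) | a. a \<in> carrier A}"
| "diff_ops_upto A (Suc n) =
     {d \<in> lin_endos A. \<forall>b\<in>carrier A.
        (\<lambda>f\<in>carrier A. d (b \<otimes>\<^bsub>A\<^esub> f) \<ominus>\<^bsub>A\<^esub> b \<otimes>\<^bsub>A\<^esub> d f) \<in> diff_ops_upto A n}"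

definition diff_op_alg :: "(complex, 'a, 'm) module_scheme \<Rightarrow> (complex, 'a \<Rightarrow> 'a) module" where
  "diff_op_alg A =
     \<lparr>carrier = (\<Union>n. diff_ops_upto A n),
      mult = (\<lambda>d e. compose (carrier A) d e),
      one = (\<lambda>f\<in>carrier A. f),
      ring.zero = (\<lambda>f\<in>carrier A. \<zero>\<^bsub>A\<^esub>),
      add = (\<lambda>d e. \<lambda>f\<in>carrier A. d f \<oplus>\<^bsub>A\<^esub> e f),
      smult = (\<lambda>c d. \<lambda>f\<in>carrier A. c \<odot>\<^bsub>A\<^esub> d f)\<rparr>"

abbreviation D_alg ::
    "(complex ^ 'n) set \<Rightarrow>
       (complex, (complex ^ 'n \<Rightarrow> complex) \<Rightarrow> (complex ^ 'n \<Rightarrow> complex)) module" where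
  "D_alg V \<equiv> diff_op_alg (coord_alg V)"

definition op_act ::
    "(complex ^ 'n) set \<Rightarrow> (complex ^ 'n \<Rightarrow> complex ^ 'n)
       \<Rightarrow> ((complex ^ 'n \<Rightarrow> complex) \<Rightarrow> (complex ^ 'n \<Rightarrow> complex))
       \<Rightarrow> ((complex ^ 'n \<Rightarrow> complex) \<Rightarrow> (complex ^ 'n \<Rightarrow> complex))" where
  "op_act V g d =
     (\<lambda>f\<in>coord_funs V. fun_act V g (d (fun_act V (inv\<^bsub>BijGroup V\<^esub> g) f)))"

definition D_inv_alg ::
    "(complex ^ 'n) set \<Rightarrow> (complex ^ 'n \<Rightarrow> complex ^ 'n) set \<Rightarrow>
       (complex, (complex ^ 'n \<Rightarrow> complex) \<Rightarrow> (complex ^ 'n \<Rightarrow> complex)) module" where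
  "D_inv_alg V G =
     D_alg V\<lparr>carrier := {d \<in> carrier (D_alg V). \<forall>g\<in>G. op_act V g d = d}\<rparr>"

section \<open>The skew field of fractions of an Ore domain\<close>

text \<open>
  The left Ore localisation at the nonzero elements; the pair \<open>(s, a)\<close> stands for the left fraction
  \<open>s\<^sup>-\<^sup>1 a\<close>. The formulas come from \<open>s = u\<^sup>-\<^sup>1 (v t)\<close> when \<open>u s = v t\<close>, and from
  \<open>a t\<^sup>-\<^sup>1 = t'\<^sup>-\<^sup>1 a'\<close> when \<open>t' a = a' t\<close>. Over a left Ore domain
  all choices lead to the same class, so that each union below is a single class. For a two-sided
  Ore domain right fractions give the same skew field.
\<close>

definition nonzeros :: "('a, 'm) ring_scheme \<Rightarrow> 'a set" where
  "nonzeros R = carrier R - {\<zero>\<^bsub>R\<^esub>}"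

definition frac_rel :: "('a, 'm) ring_scheme \<Rightarrow> (('a \<times> 'a) \<times> ('a \<times> 'a)) set" where
  "frac_rel R =
     {((s, a), (t, b)) | s a t b.
        s \<in> nonzeros R \<and> t \<in> nonzeros R \<and> a \<in> carrier R \<and> b \<in> carrier R \<and>
        (\<exists>u\<in>carrier R. \<exists>v\<in>carrier R. u \<otimes>\<^bsub>R\<^esub> s = v \<otimes>\<^bsub>R\<^esub> t \<and> u \<otimes>\<^bsub>R\<^esub> s \<noteq> \<zero>\<^bsub>R\<^esub> \<and>
           u \<otimes>\<^bsub>R\<^esub> a = v \<otimes>\<^bsub>R\<^esub> b)}"

definition frac :: "('a, 'm) ring_scheme \<Rightarrow> 'a \<Rightarrow> 'a \<Rightarrow> ('a \<times> 'a) set" where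
  "frac R s a = frac_rel R `` {(s, a)}"

definition Frac :: "(complex, 'a, 'm) module_scheme \<Rightarrow> (complex, ('a \<times> 'a) set) module" where
  "Frac R =
     \<lparr>carrier = (nonzeros R \<times> carrier R) // frac_rel R,
      mult = (\<lambda>P Q. \<Union>{frac R (t' \<otimes>\<^bsub>R\<^esub> s) (a' \<otimes>\<^bsub>R\<^esub> b) | s a t b t' a'.
                (s, a) \<in> P \<and> (t, b) \<in> Q \<and> t' \<in> nonzeros R \<and> a' \<in> carrier R \<and>
                t' \<otimes>\<^bsub>R\<^esub> a = a' \<otimes>\<^bsub>R\<^esub> t}),
      one = frac R \<one>\<^bsub>R\<^esub> \<one>\<^bsub>R\<^esub>,
      ring.zero = frac R \<one>\<^bsub>R\<^esub> \<zero>\<^bsub>R\<^esub>,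
      add = (\<lambda>P Q. \<Union>{frac R (u \<otimes>\<^bsub>R\<^esub> s) (u \<otimes>\<^bsub>R\<^esub> a \<oplus>\<^bsub>R\<^esub> v \<otimes>\<^bsub>R\<^esub> b) | s a t b u v.
                (s, a) \<in> P \<and> (t, b) \<in> Q \<and> u \<in> carrier R \<and> v \<in> carrier R \<and>
                u \<otimes>\<^bsub>R\<^esub> s = v \<otimes>\<^bsub>R\<^esub> t \<and> u \<otimes>\<^bsub>R\<^esub> s \<noteq> \<zero>\<^bsub>R\<^esub>}),
      smult = (\<lambda>c P. \<Union>{frac R s (c \<odot>\<^bsub>R\<^esub> a) | s a. (s, a) \<in> P})\<rparr>"

definition alg_isomorphic ::
    "(complex, 'a, 'm) module_scheme \<Rightarrow> (complex, 'b, 'k) module_scheme \<Rightarrow> bool" where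
  "alg_isomorphic A B \<longleftrightarrow>
     (\<exists>h \<in> ring_iso A B. \<forall>c. \<forall>a\<in>carrier A. h (c \<odot>\<^bsub>A\<^esub> a) = c \<odot>\<^bsub>B\<^esub> h a)"

end

theory Submission
  imports Defs
begin

text \<open>
  Every differential operator on a domain \<open>B\<close> extends uniquely to its field of fractions \<open>L\<close>, and an
  operator on \<open>L = Frac (\<O>(V)\<^sup>G)\<close> lifts to \<open>\<O>(V)\<close> after multiplication by a nonzero invariant
  function. Hence \<open>D(V)\<^sup>G\<close> embeds in \<open>D(L)\<close> in such a way that any two elements of \<open>D(L)\<close> are
  moved into \<open>D(V)\<^sup>G\<close> by a common unit from the left, which makes the fraction classes of the two rings
  correspond. The same holds for \<open>D(W)\<close> and the function field of \<open>W\<close>, and a birational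
  equivalence identifies the two function fields.

  To have all function fields as subfields of one field, rational functions are evaluated at generic points
  with coordinates in an ultrapower of the complex numbers.
\<close>

section \<open>Ultrapowers of the complex numbers\<close>

text \<open>The hard step is the lift of an operator q from L to A = O(V). For derivations it would
  follow from generic etaleness of A over its invariants, but an operator of higher order comes
  without a presentation by derivations. So all orders are treated alike: q after the trace is
  defined on all of A, yet has bounded order only against invariants. It is a sum of terms d_g g,
  and multiplication by an element \<theta> with free orbit, applied from the right, acts on the
  term of g with the single generalised eigenvalue g \<theta>. A polynomial in this right
  multiplication isolates the term of the identity. The same eigenvalues show that an operator on A
  is determined by its values on the invariants. This makes the lift unique, and it makes an
  operator G-invariant exactly when it maps invariants to invariants, so that the action on
  operators can be forgotten. A lift has values in the fractions of A only; one multiplier clears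
  all of them because O(V) is finitely generated, and a norm makes the multiplier invariant.\<close>

lemma ultrafilter_exists:
  fixes F :: "'a filter"
  assumes "F \<noteq> bot"
  shows "\<exists>U\<le>F. U \<noteq> bot \<and> (\<forall>P. eventually P U \<or> eventually (\<lambda>x. \<not> P x) U)"
proof -
  let ?S = "{H. H \<noteq> bot \<and> H \<le> F}"
  have po: "partial_order_on ?S (relation_of (\<ge>) ?S)"
    by (rule partial_order_on_relation_ofI) auto
  have ub: "\<exists>u\<in>?S. \<forall>H\<in>C. H \<ge> u" if C: "C \<in> Chains (relation_of (\<ge>) ?S)" for C
  proof (cases "C = {}")
    case True
    then show ?thesis
      using assms by auto
  next
    case False
    have sub: "C \<subseteq> ?S" and lin: "\<And>H K. H \<in> C \<Longrightarrow> K \<in> C \<Longrightarrow> H \<le> K \<or> K \<le> H"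
      using C by (auto simp: Chains_def relation_of_def)
    \<comment> \<open>A chain is a filter base: an event of its infimum is already an event of one
      member. So the infimum stays proper.\<close>
    have "eventually (\<lambda>x. False) (Inf C) \<longleftrightarrow> (\<exists>H\<in>C. eventually (\<lambda>x. False) H)"
    proof (rule eventually_Inf_base[OF False])
      show "\<exists>x\<in>C. x \<le> inf H K" if "H \<in> C" "K \<in> C" for H K
        using lin[OF that] that by (metis inf.absorb_iff2 inf.commute order_refl)
    qed
    then have "Inf C \<noteq> bot"
      using sub by (auto simp: trivial_limit_def)
    moreover have "Inf C \<le> F"
      using False sub by (auto intro: Inf_lower2)
    ultimately show ?thesis
      by (auto intro: Inf_lower)
  qed
  obtain U where U: "U \<in> ?S" and max: "\<And>H. H \<in> ?S \<Longrightarrow> U \<ge> H \<Longrightarrow> H = U"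
    using predicate_Zorn[OF po ub] by blast
  have "eventually P U" if "\<not> eventually (\<lambda>x. \<not> P x) U" for P
  proof -
    \<comment> \<open>\<open>P\<close> can be adjoined to \<open>U\<close> without making it
      improper, so by minimality of \<open>U\<close> it was there already.\<close>
    have "inf U (principal {x. P x}) \<noteq> bot"
      using that by (simp add: trivial_limit_def eventually_inf_principal)
    then have "inf U (principal {x. P x}) = U"
      using U by (intro max) (auto intro: le_infI1)
    then show ?thesis
      using eventually_inf_principal[of P U "{x. P x}"] by simp
  qed
  then show ?thesis
    using U by blast
qed

text \<open>The index type consists of sets, so that the ultrafilter can be chosen to contain the finite
  supersets of every finite set; this makes generic points of all varieties available in a single
  ultrapower.\<close>

definition fin_ultra :: "'b set filter" where
  "fin_ultra = (SOME U. U \<le> finite_subsets_at_top UNIV \<and> U \<noteq> bot \<and>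
     (\<forall>P. eventually P U \<or> eventually (\<lambda>x. \<not> P x) U))"

lemma fin_ultra:
  shows fin_ultra_le: "fin_ultra \<le> finite_subsets_at_top UNIV"
    and fin_ultra_proper: "fin_ultra \<noteq> bot"
    and fin_ultra_cases: "eventually P fin_ultra \<or> eventually (\<lambda>x. \<not> P x) fin_ultra"
  using someI_ex[OF ultrafilter_exists[OF finite_subsets_at_top_neq_bot[of UNIV]]]
  unfolding fin_ultra_def[symmetric] by blast+

lemma eventually_fin_ultra_member: "eventually (\<lambda>F. finite F \<and> p \<in> F) fin_ultra"
proof -
  have "eventually (\<lambda>F. finite F \<and> {p} \<subseteq> F) (finite_subsets_at_top UNIV)"
    unfolding eventually_finite_subsets_at_top by blast
  then show ?thesis
    using filter_leD[OF fin_ultra_le] by simp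
qed

quotient_type 'b upow = "'b set \<Rightarrow> complex" / "\<lambda>f g. eventually (\<lambda>F. f F = g F) fin_ultra"
proof (rule equivpI)
  show "reflp (\<lambda>f g. eventually (\<lambda>F. f F = g F) fin_ultra)"
    by (simp add: reflp_def)
  show "symp (\<lambda>f g. eventually (\<lambda>F. f F = g F) fin_ultra)"
    by (simp add: symp_def eq_commute)
  show "transp (\<lambda>f g. eventually (\<lambda>F. f F = g F) fin_ultra)"
    unfolding transp_def by (auto elim: eventually_elim2)
qed

instantiation upow :: (type) field
begin

lift_definition zero_upow :: "'a upow" is "\<lambda>_. 0" .
lift_definition one_upow :: "'a upow" is "\<lambda>_. 1" .
lift_definition plus_upow :: "'a upow \<Rightarrow> 'a upow \<Rightarrow> 'a upow" is "\<lambda>f g F. f F + g F"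
  by (auto elim: eventually_elim2)
lift_definition minus_upow :: "'a upow \<Rightarrow> 'a upow \<Rightarrow> 'a upow" is "\<lambda>f g F. f F - g F"
  by (auto elim: eventually_elim2)
lift_definition times_upow :: "'a upow \<Rightarrow> 'a upow \<Rightarrow> 'a upow" is "\<lambda>f g F. f F * g F"
  by (auto elim: eventually_elim2)
lift_definition divide_upow :: "'a upow \<Rightarrow> 'a upow \<Rightarrow> 'a upow" is "\<lambda>f g F. f F / g F"
  by (auto elim: eventually_elim2)
lift_definition uminus_upow :: "'a upow \<Rightarrow> 'a upow" is "\<lambda>f F. - f F"
  by (auto elim: eventually_mono)
lift_definition inverse_upow :: "'a upow \<Rightarrow> 'a upow" is "\<lambda>f F. inverse (f F)"
  by (auto elim: eventually_mono)

instance
proof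
  fix a b c :: "'a upow"
  show "a + b + c = a + (b + c)" "a * b * c = a * (b * c)"
    "a + b = b + a" "a * b = b * a" "0 + a = a" "- a + a = 0" "a - b = a + - b" "1 * a = a"
    "(a + b) * c = a * c + b * c" "a div b = a * inverse b" "inverse (0::'a upow) = 0"
    by (transfer; simp add: algebra_simps divide_inverse)+
  show "(0::'a upow) \<noteq> 1"
    by transfer (simp add: fin_ultra_proper)
  \<comment> \<open>Here the filter has to be ultra: a function that is not almost everywhere zero
    is almost everywhere nonzero.\<close>
  show "inverse a * a = 1" if "a \<noteq> 0"
    using that
  proof transfer
    fix f :: "'a set \<Rightarrow> complex"
    assume "\<not> eventually (\<lambda>F. f F = 0) fin_ultra"
    then have "eventually (\<lambda>F. f F \<noteq> 0) fin_ultra"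
      using fin_ultra_cases[of "\<lambda>F. f F = 0"] by blast
    then show "eventually (\<lambda>F. inverse (f F) * f F = 1) fin_ultra"
      by (auto elim: eventually_mono)
  qed
qed

end

section \<open>Differential operators on subrings of a field\<close>

text \<open>All rings are sets in one ambient field type, so fraction fields are such sets too, and
  two function fields can be compared by plain equality.\<close>

locale subring_set =
  fixes S :: "'k::field set"
  assumes one_mem: "1 \<in> S"
    and diff_mem: "x \<in> S \<Longrightarrow> y \<in> S \<Longrightarrow> x - y \<in> S"
    and mult_mem: "x \<in> S \<Longrightarrow> y \<in> S \<Longrightarrow> x * y \<in> S"
begin

lemma zero_mem: "0 \<in> S"
  using diff_mem[OF one_mem one_mem] by simp

lemma uminus_mem: "x \<in> S \<Longrightarrow> - x \<in> S"
  using diff_mem[OF zero_mem] by simp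

lemma add_mem: "x \<in> S \<Longrightarrow> y \<in> S \<Longrightarrow> x + y \<in> S"
  using diff_mem[OF _ uminus_mem, of x y] by simp

lemma sum_mem: "(\<And>i. i \<in> I \<Longrightarrow> f i \<in> S) \<Longrightarrow> sum f I \<in> S"
  by (induction I rule: infinite_finite_induct) (auto intro: zero_mem add_mem)

lemma prod_mem: "(\<And>i. i \<in> I \<Longrightarrow> f i \<in> S) \<Longrightarrow> prod f I \<in> S"
  by (induction I rule: infinite_finite_induct) (auto intro: one_mem mult_mem)

lemma power_mem: "x \<in> S \<Longrightarrow> x ^ i \<in> S"
  by (induction i) (auto intro: one_mem mult_mem)

end

definition fracs :: "'k::field set \<Rightarrow> 'k set" where
  "fracs S = {a / b | a b. a \<in> S \<and> b \<in> S \<and> b \<noteq> 0}"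

lemma fracsI: "a \<in> S \<Longrightarrow> b \<in> S \<Longrightarrow> b \<noteq> 0 \<Longrightarrow> a / b \<in> fracs S"
  unfolding fracs_def by blast

lemma fracs_denom:
  assumes "x \<in> fracs S"
  obtains b where "b \<in> S" "b \<noteq> 0" "b * x \<in> S"
proof -
  obtain a b where "x = a / b" "a \<in> S" "b \<in> S" "b \<noteq> 0"
    using assms unfolding fracs_def by blast
  then show thesis
    using that[of b] by simp
qed

lemma fracsI2: "b \<in> S \<Longrightarrow> b \<noteq> 0 \<Longrightarrow> b * x \<in> S \<Longrightarrow> x \<in> fracs S"
  using fracsI[of "b * x" S b] by simp

context subring_set
begin

lemma subset_fracs: "S \<subseteq> fracs S"
  using fracsI2[OF one_mem] by auto

lemma fracs_divide:
  assumes "x \<in> fracs S" "y \<in> fracs S"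
  shows "x / y \<in> fracs S"
proof (cases "y = 0")
  \<comment> \<open>Division by zero gives zero, which lies in \<open>fracs S\<close>.\<close>
  case True
  then show ?thesis
    using subset_fracs zero_mem by auto
next
  case False
  obtain b where b: "b \<in> S" "b \<noteq> 0" "b * x \<in> S"
    using fracs_denom[OF assms(1)] .
  obtain c where c: "c \<in> S" "c \<noteq> 0" "c * y \<in> S"
    using fracs_denom[OF assms(2)] .
  have "b * (c * y) * (x / y) = c * (b * x)"
    using False by simp
  moreover have "b * (c * y) \<in> S" "c * (b * x) \<in> S" "b * (c * y) \<noteq> 0"
    using b c False mult_mem by auto
  ultimately show ?thesis
    using fracsI2 by metis
qed

lemma subring_set_fracs: "subring_set (fracs S)"
proof
  show "1 \<in> fracs S"
    using subset_fracs one_mem by blast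
  fix x y assume x: "x \<in> fracs S" and y: "y \<in> fracs S"
  obtain b where b: "b \<in> S" "b \<noteq> 0" "b * x \<in> S"
    using fracs_denom[OF x] .
  obtain c where c: "c \<in> S" "c \<noteq> 0" "c * y \<in> S"
    using fracs_denom[OF y] .
  have eq: "b * c * (x - y) = c * (b * x) - b * (c * y)" "b * c * (x * y) = (b * x) * (c * y)"
    by (simp_all add: algebra_simps)
  have "b * c * (x - y) \<in> S" "b * c * (x * y) \<in> S" "b * c \<in> S" "b * c \<noteq> 0"
    unfolding eq using b c mult_mem diff_mem by auto
  then show "x - y \<in> fracs S" "x * y \<in> fracs S"
    using fracsI2 by blast+
qed

end

text \<open>The commutator [d, y] of \<open>d\<close> with multiplication by
  \<open>y\<close>.\<close>

definition ad :: "'k \<Rightarrow> ('k \<Rightarrow> 'k) \<Rightarrow> 'k \<Rightarrow> 'k::field" where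
  "ad y d = (\<lambda>x. d (y * x) - y * d x)"

text \<open>Only the values on \<open>S\<close> matter. The index is shifted by one against the usual
  order: \<open>diff_ord S Y 0\<close> means zero, \<open>diff_ord S S 1\<close> means multiplication by a constant.\<close>

primrec diff_ord :: "'k set \<Rightarrow> 'k set \<Rightarrow> nat \<Rightarrow> ('k \<Rightarrow> 'k::field) \<Rightarrow> bool" where
  "diff_ord S Y 0 d \<longleftrightarrow> (\<forall>x\<in>S. d x = 0)"
| "diff_ord S Y (Suc n) d \<longleftrightarrow> (\<forall>y\<in>Y. diff_ord S Y n (ad y d))"

definition additive_on :: "'k set \<Rightarrow> ('k \<Rightarrow> 'k::field) \<Rightarrow> bool" where
  "additive_on S d \<longleftrightarrow> (\<forall>x\<in>S. \<forall>y\<in>S. d (x + y) = d x + d y)"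

section \<open>Commutator rules and operators of bounded order\<close>

lemma ad_scale: "ad y (\<lambda>x. c * d x) = (\<lambda>x. c * ad y d x)"
  by (simp add: ad_def algebra_simps)

lemma ad_shift: "ad y (\<lambda>x. d (z * x)) = (\<lambda>x. ad y d (z * x))"
  by (simp add: ad_def algebra_simps)

lemma ad_plus: "ad y (\<lambda>x. d x + d' x) = (\<lambda>x. ad y d x + ad y d' x)"
  by (simp add: ad_def algebra_simps)

lemma ad_minus: "ad y (\<lambda>x. d x - d' x) = (\<lambda>x. ad y d x - ad y d' x)"
  by (simp add: ad_def algebra_simps)

lemma ad_zero: "ad y (\<lambda>x. 0) = (\<lambda>x. 0)"
  by (simp add: ad_def)

text \<open>The Leibniz rule [d, y z] = [d, y] z + y [d, z]; the bounds on commutators with products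
  and quotients come from it.\<close>

lemma ad_mult: "ad (y * z) d = (\<lambda>x. ad y d (z * x) + y * ad z d x)"
  by (simp add: ad_def fun_eq_iff algebra_simps)

context subring_set
begin

lemma additive_on_ad: "additive_on S d \<Longrightarrow> y \<in> S \<Longrightarrow> additive_on S (ad y d)"
  unfolding additive_on_def ad_def by (simp add: algebra_simps mult_mem)

lemma additive_zero: "additive_on S d \<Longrightarrow> d 0 = 0"
  using zero_mem unfolding additive_on_def by force

lemma additive_diff: "additive_on S d \<Longrightarrow> x \<in> S \<Longrightarrow> y \<in> S \<Longrightarrow> d (x - y) = d x - d y"
  using diff_mem[of x y] unfolding additive_on_def by (metis diff_add_cancel add_diff_cancel_right')

lemma additive_sum:
  assumes "additive_on S d" "\<And>i. i \<in> I \<Longrightarrow> f i \<in> S"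
  shows "d (sum f I) = (\<Sum>i\<in>I. d (f i))"
  using assms(2)
proof (induction I rule: infinite_finite_induct)
  case (insert i I)
  then have "d (f i + sum f I) = d (f i) + d (sum f I)"
    using assms(1) sum_mem[of I f] unfolding additive_on_def by blast
  then show ?case
    using insert by simp
qed (simp_all add: additive_zero[OF assms(1)])

end

text \<open>Operators live on \<open>S\<close>, while commutators are tested only against
  \<open>Y\<close>. Taking \<open>Y\<close> to be the invariants or a single element measures the
  order in one direction at a time.\<close>

locale operator_domain = subring_set S for S :: "'k::field set" +
  fixes Y :: "'k set"
  assumes sub: "Y \<subseteq> S"
begin

lemma stable: "y \<in> Y \<Longrightarrow> x \<in> S \<Longrightarrow> y * x \<in> S"
  using sub mult_mem by blast

lemma diff_ord_cong:
  "(\<And>x. x \<in> S \<Longrightarrow> d x = d' x) \<Longrightarrow> diff_ord S Y n d \<Longrightarrow> diff_ord S Y n d'"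
proof (induction n arbitrary: d d')
  case (Suc n)
  have "ad y d x = ad y d' x" if "y \<in> Y" "x \<in> S" for x y
    using that Suc.prems(1) stable by (simp add: ad_def)
  then show ?case
    using Suc.IH Suc.prems(2) by (metis diff_ord.simps(2))
qed simp

lemma diff_ord_zero: "diff_ord S Y n (\<lambda>x. 0)"
  by (induction n) (auto simp: ad_zero)

lemma diff_ord_vanish: "(\<And>x. x \<in> S \<Longrightarrow> d x = 0) \<Longrightarrow> diff_ord S Y n d"
  using diff_ord_cong[OF _ diff_ord_zero, of d] by simp

lemma diff_ord_Suc: "diff_ord S Y n d \<Longrightarrow> diff_ord S Y (Suc n) d"
proof (induction n arbitrary: d)
  case 0
  then show ?case
    using stable by (simp add: ad_def)
next
  case (Suc n)
  then show ?case
    by (metis diff_ord.simps(2))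
qed

lemma diff_ord_ad: "diff_ord S Y n d \<Longrightarrow> y \<in> Y \<Longrightarrow> diff_ord S Y n (ad y d)"
  using diff_ord_Suc[of n d] by simp

lemma diff_ord_le: "diff_ord S Y n d \<Longrightarrow> n \<le> m \<Longrightarrow> diff_ord S Y m d"
  using lift_Suc_mono_le[of "\<lambda>n. diff_ord S Y n d" n m] diff_ord_Suc
  by (metis (full_types) le_boolE le_boolI)

lemma diff_ord_plus:
  "diff_ord S Y n d \<Longrightarrow> diff_ord S Y n d' \<Longrightarrow> diff_ord S Y n (\<lambda>x. d x + d' x)"
  by (induction n arbitrary: d d') (simp_all add: ad_plus)

lemma diff_ord_minus:
  "diff_ord S Y n d \<Longrightarrow> diff_ord S Y n d' \<Longrightarrow> diff_ord S Y n (\<lambda>x. d x - d' x)"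
  by (induction n arbitrary: d d') (simp_all add: ad_minus)

text \<open>\<open>c\<close> ranges over the ambient field because operators may take values outside
  \<open>S\<close>; later it is the inverse of an element of \<open>S\<close>.\<close>

lemma diff_ord_scale: "diff_ord S Y n d \<Longrightarrow> diff_ord S Y n (\<lambda>x. c * d x)"
  by (induction n arbitrary: d) (simp_all add: ad_scale)

lemma diff_ord_shift: "diff_ord S Y n d \<Longrightarrow> z \<in> S \<Longrightarrow> diff_ord S Y n (\<lambda>x. d (z * x))"
  by (induction n arbitrary: d) (simp_all add: ad_shift mult_mem)

lemma diff_ord_sum:
  "(\<And>i. i \<in> I \<Longrightarrow> diff_ord S Y n (d i)) \<Longrightarrow> diff_ord S Y n (\<lambda>x. \<Sum>i\<in>I. d i x)"
proof (induction I rule: infinite_finite_induct)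
  case (insert i I)
  then show ?case
    using diff_ord_plus[of n "d i" "\<lambda>x. \<Sum>i\<in>I. d i x"] by simp
qed (simp_all add: diff_ord_zero)

lemma diff_ord_ad_mult:
  assumes "diff_ord S Y n (ad y d)" "diff_ord S Y n (ad z d)" "z \<in> S"
  shows "diff_ord S Y n (ad (y * z) d)"
  unfolding ad_mult
  by (rule diff_ord_plus[OF diff_ord_shift[OF assms(1,3)] diff_ord_scale[OF assms(2)]])

lemma diff_ord_ad_add:
  assumes "diff_ord S Y n (ad y d)" "diff_ord S Y n (ad z d)" "y \<in> S" "z \<in> S" "additive_on S d"
  shows "diff_ord S Y n (ad (y + z) d)"
proof (rule diff_ord_cong[OF _ diff_ord_plus[OF assms(1,2)]])
  fix x assume "x \<in> S"
  then have "d (y * x + z * x) = d (y * x) + d (z * x)"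
    using assms mult_mem unfolding additive_on_def by blast
  then show "ad y d x + ad z d x = ad (y + z) d x"
    by (simp add: ad_def algebra_simps)
qed

lemma diff_ord_ad_sum:
  assumes "additive_on S d" "\<And>i. i \<in> I \<Longrightarrow> diff_ord S Y n (ad (f i) d)" "\<And>i. i \<in> I \<Longrightarrow> f i \<in> S"
  shows "diff_ord S Y n (ad (sum f I) d)"
  using assms(2,3)
proof (induction I rule: infinite_finite_induct)
  case (insert i I)
  then show ?case
    using diff_ord_ad_add[OF _ _ _ _ assms(1), of n "f i" "sum f I"] sum_mem[of I f] by simp
qed (use additive_zero[OF assms(1)] in \<open>simp_all add: ad_def diff_ord_zero\<close>)

text \<open>Solve the Leibniz rule for \<open>ad y d\<close>. This division by \<open>c\<close>
  passes from \<open>S\<close> to its fractions, and from the multiples of a fixed element to all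
  elements.\<close>

lemma diff_ord_ad_cancel:
  assumes "diff_ord S Y n (ad (c * y) d)" "diff_ord S Y n (ad c d)" "c \<noteq> 0" "y \<in> S"
  shows "diff_ord S Y n (ad y d)"
proof -
  have "diff_ord S Y n (\<lambda>x. inverse c * (ad (c * y) d x - ad c d (y * x)))"
    by (rule diff_ord_scale[OF diff_ord_minus[OF assms(1) diff_ord_shift[OF assms(2,4)]]])
  moreover have "inverse c * (ad (c * y) d x - ad c d (y * x)) = ad y d x" for x
    using \<open>c \<noteq> 0\<close> by (simp add: ad_mult)
  ultimately show ?thesis
    by simp
qed

end

lemma diff_ord_mono:
  assumes "S' \<subseteq> S" "Y' \<subseteq> Y"
  shows "diff_ord S Y n d \<Longrightarrow> diff_ord S' Y' n d"
proof (induction n arbitrary: d)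
  case 0
  then show ?case
    using assms by auto
next
  case (Suc n)
  then show ?case
    using assms by (metis diff_ord.simps(2) subsetD)
qed

lemma (in subring_set) operator_domain_self: "operator_domain S S"
  by unfold_locales simp

context subring_set
begin

interpretation self: operator_domain S S
  by (rule operator_domain_self)

text \<open>Induction on \<open>i + j\<close> by [d d', y] = [d, y] d' + d [d', y]. In the last term
  the commutator again takes values in \<open>S\<close>, so that additivity of \<open>d\<close>
  applies.\<close>

lemma diff_ord_compose:
  assumes "diff_ord S S i d" "diff_ord S S j d'" "additive_on S d" "\<And>x. x \<in> S \<Longrightarrow> d' x \<in> S"
  shows "diff_ord S S (i + j) (\<lambda>x. d (d' x))"
  using assms
proof (induction "i + j" arbitrary: i j d d' rule: less_induct)
  case less
  show ?case
  proof (cases "i = 0 \<or> j = 0")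
    case True
    then show ?thesis
      using less.prems additive_zero[OF less.prems(3)] by (intro self.diff_ord_vanish) auto
  next
    case False
    then obtain i' j' where i: "i = Suc i'" and j: "j = Suc j'"
      by (meson not0_implies_Suc)
    have "diff_ord S S (i' + j) (ad y (\<lambda>x. d (d' x)))" if y: "y \<in> S" for y
    proof (rule self.diff_ord_cong)
      have d'y: "ad y d' x \<in> S" if "x \<in> S" for x
        using that y less.prems(4) by (simp add: ad_def mult_mem diff_mem)
      have "diff_ord S S (i' + j) (\<lambda>x. (ad y d) (d' x))"
        using less.prems y i by (intro less.hyps) (auto intro: additive_on_ad)
      moreover have "diff_ord S S (i + j') (\<lambda>x. d (ad y d' x))"
        using less.prems y j d'y by (intro less.hyps) auto
      ultimately show "diff_ord S S (i' + j) (\<lambda>x. ad y d (d' x) + d (ad y d' x))"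
        using i j by (intro self.diff_ord_plus) auto
      show "ad y d (d' x) + d (ad y d' x) = ad y (\<lambda>x. d (d' x)) x" if "x \<in> S" for x
        using that y less.prems additive_diff[OF less.prems(3), of "d' (y * x)" "y * d' x"]
        by (simp add: ad_def mult_mem)
    qed
    then show ?thesis
      using i by simp
  qed
qed

end

context subring_set
begin

subsection \<open>Extension to the field of fractions\<close>

interpretation L: subring_set "fracs S"
  by (rule subring_set_fracs)

interpretation L_self: operator_domain "fracs S" "fracs S"
  by (rule L.operator_domain_self)

text \<open>If \<open>b * x\<close> lies in \<open>S\<close>, then b q(x) = q(b x) - [q, b](x). The
  first term vanishes by assumption, the second because [q, b] vanishes on \<open>S\<close> and has
  lower order.\<close>

lemma fracs_operator_unique:
  assumes "additive_on (fracs S) q" "diff_ord (fracs S) (fracs S) n q"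
    and "\<And>x. x \<in> S \<Longrightarrow> q x = 0" and "x \<in> fracs S"
  shows "q x = 0"
  using assms
proof (induction n arbitrary: q x)
  case (Suc n)
  obtain b where b: "b \<in> S" "b \<noteq> 0" "b * x \<in> S"
    using fracs_denom[OF Suc.prems(4)] .
  have bL: "b \<in> fracs S"
    using b subset_fracs by blast
  have "ad b q x = 0"
  proof (rule Suc.IH[of "ad b q"])
    show "ad b q z = 0" if "z \<in> S" for z
      using that b Suc.prems(3) mult_mem by (simp add: ad_def)
  qed (use Suc.prems bL in \<open>auto intro: L.additive_on_ad\<close>)
  then show ?case
    using b Suc.prems(3) by (simp add: ad_def)
qed simp

lemma fracs_operator_eqI:
  assumes "additive_on (fracs S) q" "diff_ord (fracs S) (fracs S) n q"
    and "additive_on (fracs S) q'" "diff_ord (fracs S) (fracs S) m q'"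
    and eq: "\<And>x. x \<in> S \<Longrightarrow> q x = q' x" and x: "x \<in> fracs S"
  shows "q x = q' x"
proof -
  have "additive_on (fracs S) (\<lambda>x. q x - q' x)"
    using assms(1,3) by (simp add: additive_on_def)
  moreover have "diff_ord (fracs S) (fracs S) (max n m) (\<lambda>x. q x - q' x)"
    using assms(2,4) by (auto intro!: L_self.diff_ord_minus elim: L_self.diff_ord_le)
  ultimately have "q x - q' x = 0"
    by (rule fracs_operator_unique) (use eq x in auto)
  then show ?thesis
    by simp
qed

text \<open>By induction on the order: if \<open>\<epsilon> b\<close> extends \<open>[d, b]\<close>, then an extension \<open>q\<close> of \<open>d\<close> must satisfy
  \<open>b q(x) = d (b x) - \<epsilon> b x\<close>.\<close>

lemma fracs_operator_extend:
  assumes "additive_on S d" "diff_ord S S n d" "\<And>x. x \<in> S \<Longrightarrow> d x \<in> fracs S"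
  shows "\<exists>q. additive_on (fracs S) q \<and> diff_ord (fracs S) (fracs S) n q \<and>
    (\<forall>x\<in>fracs S. q x \<in> fracs S) \<and> (\<forall>x\<in>S. q x = d x)"
  using assms
proof (induction n arbitrary: d)
  case 0
  then show ?case
    by (intro exI[of _ "\<lambda>x. 0"]) (auto simp: additive_on_def L.zero_mem)
next
  case (Suc n)
  have "\<exists>q. additive_on (fracs S) q \<and> diff_ord (fracs S) (fracs S) n q \<and>
    (\<forall>x\<in>fracs S. q x \<in> fracs S) \<and> (\<forall>x\<in>S. q x = ad b d x)" if "b \<in> S" for b
  proof (rule Suc.IH)
    show "ad b d x \<in> fracs S" if "x \<in> S" for x
      using that \<open>b \<in> S\<close> Suc.prems(3) mult_mem subset_fracs
      by (auto simp: ad_def intro!: L.mult_mem L.diff_mem)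
  qed (use that Suc.prems in \<open>auto intro: additive_on_ad\<close>)
  then obtain \<epsilon> where \<epsilon>_add: "\<And>b. b \<in> S \<Longrightarrow> additive_on (fracs S) (\<epsilon> b)"
    and \<epsilon>_ord: "\<And>b. b \<in> S \<Longrightarrow> diff_ord (fracs S) (fracs S) n (\<epsilon> b)"
    and \<epsilon>_mem: "\<And>b x. b \<in> S \<Longrightarrow> x \<in> fracs S \<Longrightarrow> \<epsilon> b x \<in> fracs S"
    and \<epsilon>_eq: "\<And>b x. b \<in> S \<Longrightarrow> x \<in> S \<Longrightarrow> \<epsilon> b x = ad b d x"
    by metis
  have L: "x \<in> S \<Longrightarrow> x \<in> fracs S" for x
    using subset_fracs by blast
  \<comment> \<open>On \<open>S\<close> both sides are the double commutator of \<open>d\<close>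
    with \<open>b\<close> and \<open>c\<close>, which is symmetric because multiplications commute;
    uniqueness carries the equation to the fractions.\<close>
  have sym: "ad c (\<epsilon> b) x = ad b (\<epsilon> c) x" if "b \<in> S" "c \<in> S" "x \<in> fracs S" for b c x
  proof (rule fracs_operator_eqI[OF _ _ _ _ _ that(3)])
    show "ad c (\<epsilon> b) z = ad b (\<epsilon> c) z" if "z \<in> S" for z
      using that \<open>b \<in> S\<close> \<open>c \<in> S\<close> by (simp add: ad_def \<epsilon>_eq mult_mem algebra_simps)
  qed (use that in \<open>auto intro!: L.additive_on_ad L_self.diff_ord_ad \<epsilon>_add \<epsilon>_ord L\<close>)
  define \<beta> where "\<beta> x = (SOME b. b \<in> S \<and> b \<noteq> 0 \<and> b * x \<in> S)" for x
  have \<beta>: "\<beta> x \<in> S \<and> \<beta> x \<noteq> 0 \<and> \<beta> x * x \<in> S" if "x \<in> fracs S" for x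
    unfolding \<beta>_def by (rule someI_ex) (use fracs_denom[OF that] in blast)
  define q where "q x = (d (\<beta> x * x) - \<epsilon> (\<beta> x) x) / \<beta> x" for x
  \<comment> \<open>The formula that defines \<open>q\<close> by the chosen denominator
    \<open>\<beta> x\<close> holds for every denominator: \<open>sym\<close> at \<open>x\<close>
    equates the two candidates after cross-multiplication.\<close>
  have q: "b * q x = d (b * x) - \<epsilon> b x" if b: "b \<in> S" "b * x \<in> S" and x: "x \<in> fracs S" for b x
  proof -
    let ?c = "\<beta> x"
    have c: "?c \<in> S" "?c \<noteq> 0" "?c * x \<in> S"
      using \<beta>[OF x] by auto
    have 1: "\<epsilon> b (?c * x) = d (b * (?c * x)) - b * d (?c * x)"
      using \<epsilon>_eq[OF b(1) c(3)] by (simp add: ad_def)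
    have 2: "\<epsilon> ?c (b * x) = d (b * (?c * x)) - ?c * d (b * x)"
      using \<epsilon>_eq[OF c(1) b(2)] by (simp add: ad_def mult.left_commute)
    have "\<epsilon> b (?c * x) - ?c * \<epsilon> b x = \<epsilon> ?c (b * x) - b * \<epsilon> ?c x"
      using sym[OF b(1) c(1) x] by (simp add: ad_def)
    then have 3: "b * (d (?c * x) - \<epsilon> ?c x) = ?c * (d (b * x) - \<epsilon> b x)"
      unfolding 1 2 by (simp add: algebra_simps)
    have "?c * q x = d (?c * x) - \<epsilon> ?c x"
      using c(2) by (simp add: q_def)
    then have "?c * (b * q x) = ?c * (d (b * x) - \<epsilon> b x)"
      unfolding 3[symmetric] by (simp add: mult.left_commute)
    then show ?thesis
      using c(2) by simp
  qed
  have q_mem: "q x \<in> fracs S" if x: "x \<in> fracs S" for x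
    unfolding q_def using \<beta>[OF x] x Suc.prems(3) \<epsilon>_mem L
    by (auto intro!: fracs_divide L.diff_mem)
  have q_add: "additive_on (fracs S) q"
    unfolding additive_on_def
  proof (intro ballI)
    fix x y assume x: "x \<in> fracs S" and y: "y \<in> fracs S"
    \<comment> \<open>A denominator common to \<open>x\<close>, \<open>y\<close> and
      \<open>x + y\<close>.\<close>
    let ?b = "\<beta> x * \<beta> y"
    have b: "?b \<in> S" "?b \<noteq> 0"
      using \<beta>[OF x] \<beta>[OF y] mult_mem by auto
    have "?b * x = \<beta> y * (\<beta> x * x)" "?b * y = \<beta> x * (\<beta> y * y)"
      by (simp_all add: algebra_simps)
    then have bx: "?b * x \<in> S" and yb: "?b * y \<in> S"
      using \<beta>[OF x] \<beta>[OF y] mult_mem by metis+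
    have eq: "?b * (x + y) = ?b * x + ?b * y"
      by (simp add: algebra_simps)
    have "?b * q (x + y) = d (?b * x + ?b * y) - \<epsilon> ?b (x + y)"
      using q[of ?b "x + y"] b bx yb add_mem L.add_mem x y unfolding eq by simp
    also have "\<dots> = (d (?b * x) - \<epsilon> ?b x) + (d (?b * y) - \<epsilon> ?b y)"
      using Suc.prems(1) \<epsilon>_add[OF b(1)] bx yb x y unfolding additive_on_def by simp
    also have "\<dots> = ?b * (q x + q y)"
      using q[OF b(1) bx x] q[OF b(1) yb y] by (simp add: algebra_simps)
    finally show "q (x + y) = q x + q y"
      using b(2) by simp
  qed
  have q_eq: "q x = d x" if x: "x \<in> S" for x
  proof -
    have "\<epsilon> 1 x = 0"
      using \<epsilon>_eq[OF one_mem x] by (simp add: ad_def)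
    then show ?thesis
      using q[OF one_mem, of x] x L by simp
  qed
  \<comment> \<open>So \<open>q\<close> has the prescribed commutators, hence bounded order against
    \<open>S\<close>. The elements \<open>b\<close> and \<open>b * y\<close> of \<open>S\<close>
    then give the bound against a fraction \<open>y\<close>.\<close>
  have ad_q: "ad b q x = \<epsilon> b x" if b: "b \<in> S" and x: "x \<in> fracs S" for b x
  proof -
    let ?c = "\<beta> x"
    have c: "?c \<in> S" "?c \<noteq> 0" "?c * x \<in> S"
      using \<beta>[OF x] by auto
    have eq: "?c * (b * x) = b * (?c * x)"
      by (simp add: algebra_simps)
    have "?c * (b * x) \<in> S"
      unfolding eq using b c mult_mem by blast
    then have 1: "?c * q (b * x) = d (b * (?c * x)) - \<epsilon> ?c (b * x)"
      using q[OF c(1), of "b * x"] b x L L.mult_mem unfolding eq by simp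
    have 2: "?c * q x = d (?c * x) - \<epsilon> ?c x"
      using q c x by blast
    have 3: "\<epsilon> ?c (b * x) = \<epsilon> b (?c * x) - ?c * \<epsilon> b x + b * \<epsilon> ?c x"
      using sym[OF b c(1) x] by (simp add: ad_def algebra_simps)
    have 4: "\<epsilon> b (?c * x) = d (b * (?c * x)) - b * d (?c * x)"
      using \<epsilon>_eq[OF b c(3)] by (simp add: ad_def)
    have "?c * ad b q x = ?c * q (b * x) - b * (?c * q x)"
      by (simp add: ad_def algebra_simps)
    also have "\<dots> = ?c * \<epsilon> b x"
      unfolding 1 2 3 4 by (simp add: algebra_simps)
    finally have "?c * ad b q x = ?c * \<epsilon> b x" .
    then show ?thesis
      using c(2) by simp
  qed
  have ad_q_ord: "diff_ord (fracs S) (fracs S) n (ad b q)" if "b \<in> S" for b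
    using L_self.diff_ord_cong[OF _ \<epsilon>_ord[OF that], of "ad b q"] ad_q[OF that] by simp
  have "diff_ord (fracs S) (fracs S) n (ad y q)" if y: "y \<in> fracs S" for y
  proof -
    obtain b where b: "b \<in> S" "b \<noteq> 0" "b * y \<in> S"
      using fracs_denom[OF y] .
    then show ?thesis
      using L_self.diff_ord_ad_cancel[OF ad_q_ord[OF b(3)] ad_q_ord[OF b(1)] b(2) y] by simp
  qed
  then show ?case
    using q_add q_mem q_eq by auto
qed

end

text \<open>Each value of \<open>d\<close> has a denominator of its own; finite generation makes one
  serve for all. Up to commutators with the generators in \<open>T\<close>, whose denominators are
  bounded by induction on the order, \<open>d\<close> commutes with the generators.\<close>

lemma (in subring_set) bounded_denominator:
  assumes "finite T" "T \<subseteq> S" "K \<subseteq> S"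
    and generated: "\<And>C. K \<subseteq> C \<Longrightarrow> T \<subseteq> C \<Longrightarrow> (\<And>x y. x \<in> C \<Longrightarrow> y \<in> C \<Longrightarrow> x + y \<in> C) \<Longrightarrow>
      (\<And>x y. x \<in> C \<Longrightarrow> y \<in> C \<Longrightarrow> x * y \<in> C) \<Longrightarrow> S \<subseteq> C"
    and "additive_on S d" "\<And>k x. k \<in> K \<Longrightarrow> x \<in> S \<Longrightarrow> d (k * x) = k * d x"
    and "diff_ord S S n d" "\<And>x. x \<in> S \<Longrightarrow> d x \<in> fracs S"
  shows "\<exists>a\<in>S. a \<noteq> 0 \<and> (\<forall>x\<in>S. a * d x \<in> S)"
  using assms(5-8)
proof (induction n arbitrary: d)
  case 0
  then show ?case
    using one_mem zero_mem by (intro bexI[of _ 1]) auto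
next
  case (Suc n)
  interpret L: subring_set "fracs S"
    by (rule subring_set_fracs)
  have "\<exists>a\<in>S. a \<noteq> 0 \<and> (\<forall>x\<in>S. a * ad t d x \<in> S)" if "t \<in> T" for t
  proof (rule Suc.IH)
    have t: "t \<in> S" "t \<in> fracs S"
      using that \<open>T \<subseteq> S\<close> subset_fracs by auto
    then show "additive_on S (ad t d)" "diff_ord S S n (ad t d)"
      using Suc.prems additive_on_ad by auto
    show "ad t d (k * x) = k * ad t d x" if k: "k \<in> K" and x: "x \<in> S" for k x
    proof -
      have "d (k * (t * x)) = k * d (t * x)"
        using Suc.prems(2)[OF k] mult_mem t(1) x by blast
      then show ?thesis
        using Suc.prems(2)[OF k x] by (simp add: ad_def algebra_simps)
    qed
    show "ad t d x \<in> fracs S" if "x \<in> S" for x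
      using t that Suc.prems(4) by (auto simp: ad_def intro!: L.diff_mem L.mult_mem mult_mem)
  qed
  then obtain a where a: "\<And>t. t \<in> T \<Longrightarrow> a t \<in> S \<and> a t \<noteq> 0 \<and> (\<forall>x\<in>S. a t * ad t d x \<in> S)"
    by metis
  obtain b where b: "b \<in> S" "b \<noteq> 0" "b * d 1 \<in> S"
    using fracs_denom[OF Suc.prems(4)[OF one_mem]] .
  \<comment> \<open>\<open>m\<close> clears \<open>d 1\<close> and the commutators with all
    generators.\<close>
  define m where "m = b * prod a T"
  have pT: "prod a T \<in> S"
    using a by (intro prod_mem) auto
  have m: "m \<in> S" "m \<noteq> 0"
    using b a pT \<open>finite T\<close> by (auto simp: m_def mult_mem)
  have mt: "m * ad t d x \<in> S" if "t \<in> T" "x \<in> S" for t x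
  proof -
    have "prod a T = a t * prod a (T - {t})"
      using \<open>finite T\<close> that(1) by (rule prod.remove)
    then have "m * ad t d x = b * prod a (T - {t}) * (a t * ad t d x)"
      by (simp add: m_def algebra_simps)
    moreover have "prod a (T - {t}) \<in> S"
      using a by (intro prod_mem) auto
    ultimately show ?thesis
      using a[OF that(1)] that(2) b mult_mem by metis
  qed
  \<comment> \<open>Multiplication by an element of \<open>C\<close> preserves the set of those
    \<open>x\<close> for which \<open>m\<close> clears \<open>d x\<close>. That set contains 1, so
    it is everything once \<open>C\<close> is.\<close>
  define C where "C = {y\<in>S. \<forall>x\<in>S. m * d x \<in> S \<longrightarrow> m * d (y * x) \<in> S}"
  have "S \<subseteq> C"
  proof (rule generated)
    show "K \<subseteq> C"
    proof
      fix k assume k: "k \<in> K"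
      then have "k \<in> S"
        using \<open>K \<subseteq> S\<close> by blast
      moreover have "m * d (k * x) \<in> S" if "x \<in> S" "m * d x \<in> S" for x
      proof -
        have eq: "m * d (k * x) = k * (m * d x)"
          using Suc.prems(2)[OF k that(1)] by simp
        show ?thesis
          unfolding eq by (rule mult_mem[OF \<open>k \<in> S\<close> that(2)])
      qed
      ultimately show "k \<in> C"
        unfolding C_def by blast
    qed
    show "T \<subseteq> C"
    proof
      fix t assume t: "t \<in> T"
      then have tS: "t \<in> S"
        using \<open>T \<subseteq> S\<close> by blast
      moreover have "m * d (t * x) \<in> S" if "x \<in> S" "m * d x \<in> S" for x
      proof -
        have eq: "m * d (t * x) = t * (m * d x) + m * ad t d x"
          by (simp add: ad_def algebra_simps)
        show ?thesis
          unfolding eq by (rule add_mem[OF mult_mem[OF tS that(2)] mt[OF t that(1)]])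
      qed
      ultimately show "t \<in> C"
        unfolding C_def by blast
    qed
    fix x y assume x: "x \<in> C" and y: "y \<in> C"
    then have xy: "x \<in> S" "y \<in> S"
      unfolding C_def by auto
    have "m * d ((x + y) * z) \<in> S" if z: "z \<in> S" "m * d z \<in> S" for z
    proof -
      have "d (x * z + y * z) = d (x * z) + d (y * z)"
        using Suc.prems(1) mult_mem xy z(1) unfolding additive_on_def by blast
      then have "m * d ((x + y) * z) = m * d (x * z) + m * d (y * z)"
        by (simp add: distrib_left distrib_right)
      moreover have "m * d (x * z) \<in> S" "m * d (y * z) \<in> S"
        using x y z unfolding C_def by auto
      ultimately show ?thesis
        using add_mem by simp
    qed
    then show "x + y \<in> C"
      using add_mem[OF xy] unfolding C_def by blast
    have "m * d (x * y * z) \<in> S" if z: "z \<in> S" "m * d z \<in> S" for z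
    proof -
      have "m * d (y * z) \<in> S" "y * z \<in> S"
        using y z xy mult_mem unfolding C_def by auto
      then show ?thesis
        using x unfolding C_def mult.assoc by blast
    qed
    then show "x * y \<in> C"
      using mult_mem[OF xy] unfolding C_def by blast
  qed
  moreover have "m * d 1 \<in> S"
  proof -
    have eq: "m * d 1 = prod a T * (b * d 1)"
      by (simp add: m_def)
    show ?thesis
      unfolding eq by (rule mult_mem[OF pT b(3)])
  qed
  ultimately have "m * d x \<in> S" if "x \<in> S" for x
    using that one_mem unfolding C_def by force
  then show ?case
    using m by blast
qed

section \<open>Polynomials acting on operators\<close>

text \<open>The field acts on operators from the left by multiplication; the variable acts from the right,
  as precomposition with multiplication by \<open>t\<close>.\<close>

definition pact :: "'k::field \<Rightarrow> 'k poly \<Rightarrow> ('k \<Rightarrow> 'k) \<Rightarrow> 'k \<Rightarrow> 'k" where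
  "pact t p d = (\<lambda>x. \<Sum>i\<le>Polynomial.degree p. Polynomial.coeff p i * d (t ^ i * x))"

lemma pact_bound:
  assumes "Polynomial.degree p \<le> n"
  shows "pact t p d x = (\<Sum>i\<le>n. Polynomial.coeff p i * d (t ^ i * x))"
  unfolding pact_def using assms
  by (intro sum.mono_neutral_left) (auto intro: Polynomial.coeff_eq_0)

lemma pact_add: "pact t (p + q) d x = pact t p d x + pact t q d x"
proof -
  let ?n = "max (Polynomial.degree p) (Polynomial.degree q)"
  show ?thesis
    using pact_bound[of p ?n] pact_bound[of q ?n] pact_bound[of "p + q" ?n] degree_add_le_max[of p q]
    by (simp add: sum.distrib algebra_simps)
qed

lemma pact_smult: "pact t (Polynomial.smult a p) d x = a * pact t p d x"
  using pact_bound[of "Polynomial.smult a p" "Polynomial.degree p" t d x] degree_smult_le[of a p]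
  by (simp add: pact_def sum_distrib_left mult.assoc)

lemma pact_pCons: "pact t (pCons a p) d x = a * d x + pact t p d (t * x)"
proof -
  have "pact t (pCons a p) d x =
      (\<Sum>i\<le>Suc (Polynomial.degree p). Polynomial.coeff (pCons a p) i * d (t ^ i * x))"
    by (rule pact_bound) (rule degree_pCons_le)
  also have "\<dots> = a * d x + (\<Sum>i\<le>Polynomial.degree p. Polynomial.coeff p i * d (t ^ i * (t * x)))"
    by (simp add: sum.atMost_Suc_shift mult_ac del: sum.atMost_Suc)
  finally show ?thesis
    by (simp add: pact_def)
qed

lemma pact_0: "pact t 0 d x = 0"
  by (simp add: pact_def)

text \<open>Coefficients act from the left and the variable from the right, so the two actions
  commute and operators form a module over the polynomials.\<close>

lemma pact_mult: "pact t (p * q) d x = pact t p (pact t q d) x"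
  by (induction p arbitrary: x) (simp_all add: pact_0 pact_add pact_smult pact_pCons)

text \<open>For \<open>a = t\<close> this is \<open>ad t d\<close>. An operator killed by X - a
  turns multiplication by \<open>t\<close> on the right into multiplication by \<open>a\<close> on
  the left.\<close>

lemma pact_linear: "pact t [:- a, 1:] d x = d (t * x) - a * d x"
  by (simp add: pact_pCons pact_0)

lemma ad_pact: "ad y (pact t p d) = pact t p (ad y d)"
  by (simp add: ad_def pact_def fun_eq_iff algebra_simps sum_subtractf sum_distrib_left)

context subring_set
begin

lemma additive_on_pact:
  assumes "additive_on S d" "t \<in> S"
  shows "additive_on S (pact t p d)"
  unfolding additive_on_def
proof (intro ballI)
  fix x y assume "x \<in> S" "y \<in> S"
  then have "d (t ^ i * (x + y)) = d (t ^ i * x) + d (t ^ i * y)" for i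
    using assms mult_mem power_mem unfolding additive_on_def by (simp add: algebra_simps)
  then show "pact t p d (x + y) = pact t p d x + pact t p d y"
    by (simp add: pact_def algebra_simps sum.distrib)
qed

end

lemma (in operator_domain) diff_ord_pact:
  assumes "diff_ord S Y n d" "t \<in> S"
  shows "diff_ord S Y n (pact t p d)"
  unfolding pact_def using assms
  by (intro diff_ord_sum diff_ord_scale diff_ord_shift power_mem)

section \<open>Rings with a finite group of automorphisms\<close>

text \<open>Translation invariance replaces the group law. The element \<open>\<theta>\<close>, which has a free orbit, takes
  the place of a primitive element of the extension of fraction fields.\<close>

locale galois_action = subring_set A for A :: "'k::field set" +
  fixes G :: "'g set" and act :: "'g \<Rightarrow> 'k \<Rightarrow> 'k" and e :: 'g and \<theta> :: 'k
  assumes finite_G: "finite G"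
    and e_mem: "e \<in> G"
    and act_e: "x \<in> A \<Longrightarrow> act e x = x"
    and act_mem: "g \<in> G \<Longrightarrow> x \<in> A \<Longrightarrow> act g x \<in> A"
    and act_add: "g \<in> G \<Longrightarrow> x \<in> A \<Longrightarrow> y \<in> A \<Longrightarrow> act g (x + y) = act g x + act g y"
    and act_mult: "g \<in> G \<Longrightarrow> x \<in> A \<Longrightarrow> y \<in> A \<Longrightarrow> act g (x * y) = act g x * act g y"
    and act_one: "g \<in> G \<Longrightarrow> act g 1 = 1"
    and act_translate: "h \<in> G \<Longrightarrow>
      \<exists>\<pi>. bij_betw \<pi> G G \<and> (\<forall>g\<in>G. \<forall>x\<in>A. act h (act g x) = act (\<pi> g) x)"
    and theta_mem: "\<theta> \<in> A"
    and theta_free: "g \<in> G \<Longrightarrow> g \<noteq> e \<Longrightarrow> act g \<theta> \<noteq> \<theta>"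
begin

definition invariants :: "'k set" where
  "invariants = {x\<in>A. \<forall>g\<in>G. act g x = x}"

definition trace :: "'k \<Rightarrow> 'k" where
  "trace x = (\<Sum>g\<in>G. act g x)"

text \<open>For \<open>H = G\<close> the polynomial over the invariants whose roots are the
  conjugates of \<open>\<theta>\<close>; for \<open>H = G - {e}\<close> its quotient by X -
  \<theta>.\<close>

definition roots_poly :: "'g set \<Rightarrow> 'k poly" where
  "roots_poly H = (\<Prod>h\<in>H. [:- act h \<theta>, 1:])"

section \<open>The action, its trace and its norm\<close>

lemma act_zero: "g \<in> G \<Longrightarrow> act g 0 = 0"
  using act_add[OF _ zero_mem zero_mem, of g] add_left_cancel[of "act g 0" "act g 0" 0] by simp

lemma act_uminus: "g \<in> G \<Longrightarrow> x \<in> A \<Longrightarrow> act g (- x) = - act g x"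
  using act_add[of g x "- x"] uminus_mem[of x] act_zero[of g] by (simp add: eq_neg_iff_add_eq_0 add.commute)

lemma act_diff: "g \<in> G \<Longrightarrow> x \<in> A \<Longrightarrow> y \<in> A \<Longrightarrow> act g (x - y) = act g x - act g y"
  using act_add[of g x "- y"] uminus_mem[of y] act_uminus[of g y] by simp

lemma act_sum:
  assumes "g \<in> G" "\<And>i. i \<in> I \<Longrightarrow> f i \<in> A"
  shows "act g (sum f I) = (\<Sum>i\<in>I. act g (f i))"
  using assms(2)
  by (induction I rule: infinite_finite_induct) (auto simp: act_zero act_add sum_mem assms(1))

lemma act_prod:
  assumes "g \<in> G" "\<And>i. i \<in> I \<Longrightarrow> f i \<in> A"
  shows "act g (prod f I) = (\<Prod>i\<in>I. act g (f i))"
  using assms(2)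
  by (induction I rule: infinite_finite_induct) (auto simp: act_one act_mult prod_mem assms(1))

lemma act_right_inverse:
  assumes "g \<in> G"
  obtains h where "h \<in> G" "\<forall>x\<in>A. act g (act h x) = x"
proof -
  obtain \<pi> where \<pi>: "bij_betw \<pi> G G" "\<And>h x. h \<in> G \<Longrightarrow> x \<in> A \<Longrightarrow> act g (act h x) = act (\<pi> h) x"
    using act_translate[OF assms] by blast
  then obtain h where "h \<in> G" "\<pi> h = e"
    using e_mem unfolding bij_betw_def by (metis imageE)
  show thesis
    by (rule that[OF \<open>h \<in> G\<close>]) (simp add: \<pi>(2)[OF \<open>h \<in> G\<close>] \<open>\<pi> h = e\<close> act_e)
qed

lemma act_eq_0_iff:
  assumes g: "g \<in> G" and x: "x \<in> A"
  shows "act g x = 0 \<longleftrightarrow> x = 0"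
proof
  assume 0: "act g x = 0"
  obtain h where h: "h \<in> G" "\<forall>x\<in>A. act g (act h x) = x"
    by (rule act_right_inverse[OF g])
  obtain k where k: "k \<in> G" "\<forall>x\<in>A. act h (act k x) = x"
    by (rule act_right_inverse[OF h(1)])
  \<comment> \<open>\<open>h\<close> is a right inverse of \<open>g\<close> and \<open>k\<close> one
    of \<open>h\<close>, so \<open>g\<close> and \<open>k\<close> agree, and \<open>h\<close>
    inverts \<open>g\<close> from the left as well.\<close>
  have "act g x = act k x"
    using h(2) act_mem[OF k(1) x] k(2) x by auto
  then show "x = 0"
    using 0 k(2) x act_zero[OF h(1)] by auto
qed (simp add: act_zero g)

lemma invariants_subset: "invariants \<subseteq> A"
  unfolding invariants_def by blast

lemma invariants_fixed: "x \<in> invariants \<Longrightarrow> g \<in> G \<Longrightarrow> act g x = x"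
  unfolding invariants_def by blast

lemma subring_set_invariants: "subring_set invariants"
  by unfold_locales
    (auto simp: invariants_def one_mem act_one diff_mem mult_mem act_diff act_mult)

lemma operator_domain_invariants: "operator_domain A invariants"
  by unfold_locales (rule invariants_subset)

interpretation B: subring_set invariants
  by (rule subring_set_invariants)

interpretation AB: operator_domain A invariants
  by (rule operator_domain_invariants)

interpretation AA: operator_domain A A
  by (rule operator_domain_self)

lemma invariant_if_permuted:
  assumes "f ` G \<subseteq> A" "x \<in> A"
    and "\<And>h \<pi>. h \<in> G \<Longrightarrow> bij_betw \<pi> G G \<Longrightarrow> (\<forall>g\<in>G. \<forall>x\<in>A. act h (act g x) = act (\<pi> g) x) \<Longrightarrow> act h x = x"
  shows "x \<in> invariants"
  using assms act_translate unfolding invariants_def by blast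

lemma trace_invariant: "x \<in> A \<Longrightarrow> trace x \<in> invariants"
proof (rule invariant_if_permuted[of "\<lambda>g. act g x"])
  fix h \<pi> assume "x \<in> A" "h \<in> G" and \<pi>: "bij_betw \<pi> G G" "\<forall>g\<in>G. \<forall>x\<in>A. act h (act g x) = act (\<pi> g) x"
  then have "act h (trace x) = (\<Sum>g\<in>G. act (\<pi> g) x)"
    by (simp add: trace_def act_sum act_mem)
  then show "act h (trace x) = trace x"
    by (simp add: trace_def sum.reindex_bij_betw[OF \<pi>(1), of "\<lambda>g. act g x"])
qed (auto simp: trace_def sum_mem act_mem)

lemma norm_invariant: "x \<in> A \<Longrightarrow> (\<Prod>g\<in>G. act g x) \<in> invariants"
proof (rule invariant_if_permuted[of "\<lambda>g. act g x"])
  fix h \<pi> assume "x \<in> A" "h \<in> G" and \<pi>: "bij_betw \<pi> G G" "\<forall>g\<in>G. \<forall>x\<in>A. act h (act g x) = act (\<pi> g) x"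
  then have "act h (\<Prod>g\<in>G. act g x) = (\<Prod>g\<in>G. act (\<pi> g) x)"
    by (simp add: act_prod act_mem)
  then show "act h (\<Prod>g\<in>G. act g x) = (\<Prod>g\<in>G. act g x)"
    by (simp add: prod.reindex_bij_betw[OF \<pi>(1), of "\<lambda>g. act g x"])
qed (auto simp: prod_mem act_mem)

lemma additive_on_trace: "additive_on A trace"
  by (simp add: additive_on_def trace_def act_add sum.distrib)

lemma trace_scale: "b \<in> invariants \<Longrightarrow> x \<in> A \<Longrightarrow> trace (b * x) = b * trace x"
  using invariants_subset by (auto simp: trace_def act_mult invariants_fixed sum_distrib_left)

text \<open>\<open>a'\<close> is the product of the \<open>act g a\<close> with g \<noteq> e, so
  that \<open>a' * a\<close> is the norm of \<open>a\<close>.\<close>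

lemma invariant_multiple:
  assumes "a \<in> A" "a \<noteq> 0"
  obtains a' where "a' \<in> A" "a' * a \<in> invariants" "a' * a \<noteq> 0"
proof -
  have eq: "(\<Prod>g\<in>G. act g a) = (\<Prod>g\<in>G - {e}. act g a) * a"
    using prod.remove[OF finite_G e_mem, of "\<lambda>g. act g a"] act_e[OF assms(1)] by (simp add: mult.commute)
  show thesis
  proof (rule that)
    show "(\<Prod>g\<in>G - {e}. act g a) \<in> A"
      using assms by (intro prod_mem act_mem) auto
    show "(\<Prod>g\<in>G - {e}. act g a) * a \<in> invariants"
      unfolding eq[symmetric] by (rule norm_invariant[OF assms(1)])
    show "(\<Prod>g\<in>G - {e}. act g a) * a \<noteq> 0"
      unfolding eq[symmetric] using assms finite_G by (simp add: act_eq_0_iff)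
  qed
qed

text \<open>If \<open>b\<close> and \<open>b * x\<close> are invariant, then b (g x) = b x, and
  \<open>b\<close> cancels.\<close>

lemma fracs_invariants_Int: "x \<in> fracs invariants \<Longrightarrow> x \<in> A \<Longrightarrow> x \<in> invariants"
proof -
  assume "x \<in> fracs invariants" "x \<in> A"
  then obtain b where b: "b \<in> invariants" "b \<noteq> 0" "b * x \<in> invariants"
    using fracs_denom by blast
  have "act g x = x" if g: "g \<in> G" for g
  proof -
    have "b * act g x = b * x"
      using act_mult[OF g _ \<open>x \<in> A\<close>, of b] b invariants_fixed[OF _ g] invariants_subset by auto
    then show ?thesis
      using b(2) by simp
  qed
  then show ?thesis
    using \<open>x \<in> A\<close> unfolding invariants_def by blast
qed

section \<open>The polynomial of the conjugates of \<theta> and the dual basis of the powers of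
  \<theta>\<close>

lemma coeff_mult_mem:
  assumes "\<And>i. Polynomial.coeff p i \<in> A" "\<And>i. Polynomial.coeff q i \<in> A"
  shows "Polynomial.coeff (p * q) i \<in> A"
  unfolding coeff_mult using assms by (intro sum_mem mult_mem)

lemma map_act_mult:
  assumes "g \<in> G" "\<And>i. Polynomial.coeff p i \<in> A" "\<And>i. Polynomial.coeff q i \<in> A"
  shows "map_poly (act g) (p * q) = map_poly (act g) p * map_poly (act g) q"
  by (rule poly_eqI)
    (simp add: coeff_map_poly act_zero coeff_mult act_sum act_mult mult_mem assms)

lemma roots_poly_act:
  assumes "H \<subseteq> G"
  shows coeff_roots_poly: "Polynomial.coeff (roots_poly H) i \<in> A"
    and map_act_roots_poly: "g \<in> G \<Longrightarrow> map_poly (act g) (roots_poly H) = (\<Prod>h\<in>H. [:- act g (act h \<theta>), 1:])"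
proof -
  have "finite H"
    using assms finite_G finite_subset by blast
  then have "(\<forall>i. Polynomial.coeff (roots_poly H) i \<in> A) \<and>
    (\<forall>g\<in>G. map_poly (act g) (roots_poly H) = (\<Prod>h\<in>H. [:- act g (act h \<theta>), 1:]))"
    using assms
  proof (induction H)
    case empty
    then show ?case
      by (auto simp: roots_poly_def coeff_1 one_mem zero_mem act_one)
  next
    case (insert h H)
    have h: "act h \<theta> \<in> A"
      using insert theta_mem act_mem by blast
    have lin: "Polynomial.coeff [:- act h \<theta>, 1:] i \<in> A" for i
      using h by (auto simp: coeff_pCons one_mem zero_mem uminus_mem split: nat.split)
    have eq: "roots_poly (insert h H) = [:- act h \<theta>, 1:] * roots_poly H"
      using insert by (simp add: roots_poly_def)
    have "map_poly (act g) [:- act h \<theta>, 1:] = [:- act g (act h \<theta>), 1:]" if "g \<in> G" for g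
      using that h by (simp add: map_poly_pCons act_zero act_one act_uminus)
    then show ?case
      unfolding eq using insert lin by (auto simp: coeff_mult_mem map_act_mult simp del: mult_pCons_left)
  qed
  then show "Polynomial.coeff (roots_poly H) i \<in> A"
    "g \<in> G \<Longrightarrow> map_poly (act g) (roots_poly H) = (\<Prod>h\<in>H. [:- act g (act h \<theta>), 1:])"
    by auto
qed

lemma poly_roots_poly: "poly (roots_poly H) x = (\<Prod>h\<in>H. x - act h \<theta>)"
  by (simp add: roots_poly_def poly_prod)

lemma roots_poly_split: "roots_poly G = [:- \<theta>, 1:] * roots_poly (G - {e})"
  unfolding roots_poly_def using prod.remove[OF finite_G e_mem, of "\<lambda>h. [:- act h \<theta>, 1:]"]
  by (simp add: act_e theta_mem)

lemma coeff_roots_poly_invariant: "Polynomial.coeff (roots_poly G) i \<in> invariants"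
proof -
  have "act h (Polynomial.coeff (roots_poly G) i) = Polynomial.coeff (roots_poly G) i" if h: "h \<in> G" for h
  proof -
    obtain \<pi> where \<pi>: "bij_betw \<pi> G G" "\<forall>g\<in>G. \<forall>x\<in>A. act h (act g x) = act (\<pi> g) x"
      using act_translate[OF h] by blast
    have "map_poly (act h) (roots_poly G) = (\<Prod>g\<in>G. [:- act (\<pi> g) \<theta>, 1:])"
      using map_act_roots_poly[OF order_refl h] \<pi>(2) theta_mem by simp
    also have "\<dots> = roots_poly G"
      unfolding roots_poly_def by (rule prod.reindex_bij_betw[OF \<pi>(1)])
    finally show ?thesis
      using coeff_map_poly[of "act h" "roots_poly G" i] act_zero[OF h] by simp
  qed
  then show ?thesis
    using coeff_roots_poly[OF order_refl] unfolding invariants_def by blast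
qed

text \<open>The derivative of \<open>roots_poly G\<close> at \<open>\<theta>\<close>, nonzero
  because the orbit of \<open>\<theta>\<close> is free.\<close>

definition cofactor :: 'k where
  "cofactor = poly (roots_poly (G - {e})) \<theta>"

lemma cofactor_nonzero: "cofactor \<noteq> 0"
  using finite_G theta_free[THEN not_sym] by (auto simp: cofactor_def poly_roots_poly)

lemma cofactor_eq: "cofactor = (\<Prod>h\<in>G - {e}. \<theta> - act h \<theta>)"
  by (simp add: cofactor_def poly_roots_poly)

lemma cofactor_mem: "cofactor \<in> A"
  unfolding cofactor_eq by (auto intro!: prod_mem diff_mem act_mem theta_mem)

lemma poly_eq_sum_bound:
  fixes p :: "'k poly"
  shows "Polynomial.degree p \<le> n \<Longrightarrow> poly p x = (\<Sum>i\<le>n. Polynomial.coeff p i * x ^ i)"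
  unfolding poly_altdef by (rule sum.mono_neutral_left) (auto intro: Polynomial.coeff_eq_0)

text \<open>Euler's dual basis for the trace form, with its denominator cleared: up to the
  derivative, the coefficients of the quotient of \<open>roots_poly G\<close> by X - \<theta> are
  dual to the powers of \<theta>. It puts the multiples of \<open>cofactor\<close> into the ring
  generated by the invariants and \<theta>.\<close>

lemma cofactor_expansion:
  assumes f: "f \<in> A"
  shows "cofactor * f =
    (\<Sum>i\<le>Polynomial.degree (roots_poly (G - {e})).
      trace (f * Polynomial.coeff (roots_poly (G - {e})) i) * \<theta> ^ i)"
proof -
  let ?p = "roots_poly (G - {e})"
  let ?n = "Polynomial.degree ?p"
  have pA: "Polynomial.coeff ?p i \<in> A" for i
    by (rule coeff_roots_poly) auto
  \<comment> \<open>The conjugate of the polynomial by \<open>g\<close> has the roots g h \<theta>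
    with h \<noteq> e. For g \<noteq> e one of them is \<theta> itself, namely at the inverse
    \<open>h\<close> of \<open>g\<close>.\<close>
  have ev: "(\<Sum>i\<le>?n. act g (Polynomial.coeff ?p i) * \<theta> ^ i) = (if g = e then cofactor else 0)"
    if g: "g \<in> G" for g
  proof -
    have "(\<Sum>i\<le>?n. act g (Polynomial.coeff ?p i) * \<theta> ^ i) = poly (map_poly (act g) ?p) \<theta>"
      using poly_eq_sum_bound[of "map_poly (act g) ?p" ?n \<theta>] map_poly_degree_leq[of "act g" ?p]
      by (simp add: coeff_map_poly act_zero g)
    also have "\<dots> = (\<Prod>h\<in>G - {e}. \<theta> - act g (act h \<theta>))"
      by (simp add: map_act_roots_poly[OF _ g] poly_prod)
    also have "\<dots> = (if g = e then cofactor else 0)"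
    proof (cases "g = e")
      case True
      then show ?thesis
        by (simp add: cofactor_eq act_e act_mem theta_mem)
    next
      case False
      obtain h where h: "h \<in> G" "\<forall>x\<in>A. act g (act h x) = x"
        by (rule act_right_inverse[OF g])
      have "h \<noteq> e"
        using h(2) theta_mem act_e[OF theta_mem] theta_free[OF g False] by auto
      then show ?thesis
        using h theta_mem finite_G False by (auto intro!: prod_zero bexI[of _ h])
    qed
    finally show ?thesis .
  qed
  have "(\<Sum>i\<le>?n. trace (f * Polynomial.coeff ?p i) * \<theta> ^ i) =
      (\<Sum>i\<le>?n. \<Sum>g\<in>G. act g f * (act g (Polynomial.coeff ?p i) * \<theta> ^ i))"
    using f pA by (simp add: trace_def act_mult sum_distrib_right mult.assoc)
  also have "\<dots> = (\<Sum>g\<in>G. act g f * (\<Sum>i\<le>?n. act g (Polynomial.coeff ?p i) * \<theta> ^ i))"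
    by (subst sum.swap) (simp add: sum_distrib_left)
  also have "\<dots> = (\<Sum>g\<in>G. if g = e then act g f * cofactor else 0)"
    by (intro sum.cong) (simp_all add: ev)
  also have "\<dots> = cofactor * f"
    using finite_G e_mem f act_e by (simp add: mult.commute)
  finally show ?thesis
    by simp
qed

text \<open>The summand of \<open>g\<close> in the trace is an eigenoperator with eigenvalue g
  \<theta>, so the polynomial acts on it by its value there: zero for g \<noteq> e, and
  \<open>cofactor\<close> for \<open>e\<close>.\<close>

lemma pact_cofactor_trace:
  assumes x: "x \<in> A"
  shows "pact \<theta> (roots_poly (G - {e})) (\<lambda>x. a * trace x) x = cofactor * (a * x)"
proof -
  let ?p = "roots_poly (G - {e})"
  have ev: "poly ?p (act g \<theta>) = (if g = e then cofactor else 0)" if g: "g \<in> G" for g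
    using g finite_G by (auto simp: cofactor_def act_e theta_mem poly_roots_poly intro!: prod_zero)
  have "pact \<theta> ?p (\<lambda>x. a * trace x) x =
      (\<Sum>i\<le>Polynomial.degree ?p. \<Sum>g\<in>G. a * act g x * (Polynomial.coeff ?p i * act g \<theta> ^ i))"
  proof -
    have "act g (\<theta> ^ i * x) = act g \<theta> ^ i * act g x" if g: "g \<in> G" for g i
      by (induction i) (auto simp: g act_one act_mult mult_mem theta_mem power_mem x mult.assoc)
    then show ?thesis
      by (simp add: pact_def trace_def sum_distrib_left mult_ac)
  qed
  also have "\<dots> = (\<Sum>g\<in>G. a * act g x * poly ?p (act g \<theta>))"
    by (subst sum.swap) (simp add: sum_distrib_left poly_altdef)
  also have "\<dots> = (\<Sum>g\<in>G. if g = e then a * act g x * cofactor else 0)"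
    by (intro sum.cong) (simp_all add: ev)
  also have "\<dots> = cofactor * (a * x)"
    using finite_G e_mem x act_e by (simp add: mult_ac)
  finally show ?thesis .
qed

text \<open>By the Leibniz rule the bounds for the invariants and \<theta> extend to the ring they
  generate. That ring contains \<open>cofactor * f\<close>, and \<open>diff_ord_ad_cancel\<close>
  removes \<open>cofactor\<close>.\<close>

lemma diff_ord_ad_generated:
  assumes Y: "Y \<subseteq> A" and d: "additive_on A d"
    and "\<And>b. b \<in> invariants \<Longrightarrow> diff_ord A Y n (ad b d)" "diff_ord A Y n (ad \<theta> d)" and f: "f \<in> A"
  shows "diff_ord A Y n (ad f d)"
proof -
  interpret AY: operator_domain A Y
    by unfold_locales (rule Y)
  have pow: "diff_ord A Y n (ad (\<theta> ^ i) d)" for i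
  proof (induction i)
    case 0
    then show ?case
      by (intro AY.diff_ord_vanish) (simp add: ad_def)
  next
    case (Suc i)
    then show ?case
      using AY.diff_ord_ad_mult[OF assms(4) Suc power_mem[OF theta_mem]] by simp
  qed
  have pA: "Polynomial.coeff (roots_poly (G - {e})) i \<in> A" for i
    by (rule coeff_roots_poly) auto
  have *: "diff_ord A Y n (ad (cofactor * x) d)" if x: "x \<in> A" for x
    unfolding cofactor_expansion[OF x]
  proof (rule AY.diff_ord_ad_sum[OF d])
    fix i
    have t: "trace (x * Polynomial.coeff (roots_poly (G - {e})) i) \<in> invariants"
      using x pA by (intro trace_invariant mult_mem)
    then show "diff_ord A Y n (ad (trace (x * Polynomial.coeff (roots_poly (G - {e})) i) * \<theta> ^ i) d)"
      using assms(3) pow by (intro AY.diff_ord_ad_mult power_mem theta_mem)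
    show "trace (x * Polynomial.coeff (roots_poly (G - {e})) i) * \<theta> ^ i \<in> A"
      using t invariants_subset by (auto intro!: mult_mem power_mem theta_mem)
  qed
  show ?thesis
    using AY.diff_ord_ad_cancel[OF *[OF f] _ cofactor_nonzero f] *[OF one_mem] by simp
qed

text \<open>Commuting with an invariant lowers \<open>i\<close> and keeps \<open>j\<close>,
  commuting with \<theta> does the reverse; by \<open>diff_ord_ad_generated\<close> these
  commutators control all others.\<close>

lemma diff_ord_generated:
  assumes "additive_on A d" "diff_ord A invariants i d" "diff_ord A {\<theta>} j d"
  shows "diff_ord A A (i + j) d"
  using assms
proof (induction "i + j" arbitrary: i j d rule: less_induct)
  case less
  interpret At: operator_domain A "{\<theta>}"
    by unfold_locales (simp add: theta_mem)
  show ?case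
  proof (cases "i = 0 \<or> j = 0")
    case True
    then show ?thesis
      using less.prems by (intro AA.diff_ord_vanish) auto
  next
    case False
    then obtain i' j' where i: "i = Suc i'" and j: "j = Suc j'"
      by (meson not0_implies_Suc)
    have "diff_ord A A (i' + j) (ad f d)" if f: "f \<in> A" for f
    proof (rule diff_ord_ad_generated[OF order_refl less.prems(1) _ _ f])
      show "diff_ord A A (i' + j) (ad b d)" if b: "b \<in> invariants" for b
      proof (rule less.hyps)
        have "diff_ord A {\<theta>} j (\<lambda>x. d (b * x) - b * d x)"
          using b invariants_subset less.prems(3)
          by (intro At.diff_ord_minus At.diff_ord_shift At.diff_ord_scale) auto
        then show "diff_ord A {\<theta>} j (ad b d)"
          by (simp add: ad_def)
      qed (use b i less.prems invariants_subset in \<open>auto intro: additive_on_ad\<close>)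
      have "diff_ord A A (i + j') (ad \<theta> d)"
      proof (rule less.hyps)
        have "diff_ord A invariants i (\<lambda>x. d (\<theta> * x) - \<theta> * d x)"
          using theta_mem less.prems(2)
          by (intro AB.diff_ord_minus AB.diff_ord_shift AB.diff_ord_scale)
        then show "diff_ord A invariants i (ad \<theta> d)"
          by (simp add: ad_def)
      qed (use j less.prems theta_mem in \<open>auto intro: additive_on_ad\<close>)
      then show "diff_ord A A (i' + j) (ad \<theta> d)"
        using i j by simp
    qed
    then show ?thesis
      using i by simp
  qed
qed

text \<open>An operator linear over the invariants lets the coefficients of the polynomial p pass,
  so p acts on it as x \<mapsto> d(p(\<theta>) x), and p(\<theta>) = 0. Higher orders reduce to this
  because commutators commute with the action.\<close>

lemma diff_ord_pact_roots_poly: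
  assumes "additive_on A d" "diff_ord A invariants (Suc n) d"
  shows "diff_ord A invariants n (pact \<theta> (roots_poly G) d)"
  using assms
proof (induction n arbitrary: d)
  case 0
  let ?p = "roots_poly G"
  have lin: "d (b * x) = b * d x" if "b \<in> invariants" "x \<in> A" for b x
    using 0 that by (simp add: ad_def)
  have "pact \<theta> ?p d x = 0" if x: "x \<in> A" for x
  proof -
    have mem: "\<theta> ^ i * x \<in> A" "Polynomial.coeff ?p i * (\<theta> ^ i * x) \<in> A" for i
      using x coeff_roots_poly[OF order_refl] by (auto intro!: mult_mem power_mem theta_mem)
    have "pact \<theta> ?p d x = (\<Sum>i\<le>Polynomial.degree ?p. d (Polynomial.coeff ?p i * (\<theta> ^ i * x)))"
      unfolding pact_def using lin coeff_roots_poly_invariant mem by simp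
    also have "\<dots> = d (\<Sum>i\<le>Polynomial.degree ?p. Polynomial.coeff ?p i * (\<theta> ^ i * x))"
      using additive_sum[OF 0(1), of "{..Polynomial.degree ?p}" "\<lambda>i. Polynomial.coeff ?p i * (\<theta> ^ i * x)"] mem
      by simp
    also have "(\<Sum>i\<le>Polynomial.degree ?p. Polynomial.coeff ?p i * (\<theta> ^ i * x)) = poly ?p \<theta> * x"
      by (simp add: poly_altdef sum_distrib_right mult.assoc)
    also have "poly ?p \<theta> = 0"
      by (simp add: roots_poly_split)
    finally show ?thesis
      by (simp add: additive_zero[OF 0(1)])
  qed
  then show ?case
    by simp
next
  case (Suc n)
  have "diff_ord A invariants n (ad b (pact \<theta> (roots_poly G) d))" if b: "b \<in> invariants" for b
    unfolding ad_pact using Suc b invariants_subset by (auto intro!: Suc.IH additive_on_ad)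
  then show ?case
    by simp
qed

text \<open>The eigenvalue equation says [d, \<theta>] = (a - \<theta>) d, so division by a -
  \<theta> gives \<open>d\<close> the lower order of its commutator; repeated, this ends at
  zero.\<close>

lemma diff_op_eq_0_if_eigen:
  assumes "diff_ord A A n d" "a \<noteq> \<theta>" "\<And>x. x \<in> A \<Longrightarrow> d (\<theta> * x) = a * d x" "x \<in> A"
  shows "d x = 0"
  using assms(1,4)
proof (induction n arbitrary: x)
  case (Suc n)
  have "diff_ord A A n (\<lambda>x. (a - \<theta>) * d x)"
  proof (rule AA.diff_ord_cong)
    show "diff_ord A A n (ad \<theta> d)"
      using Suc.prems(1) theta_mem by simp
    show "ad \<theta> d x = (a - \<theta>) * d x" if "x \<in> A" for x
      using assms(3)[OF that] by (simp add: ad_def algebra_simps)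
  qed
  then have "diff_ord A A n (\<lambda>x. inverse (a - \<theta>) * ((a - \<theta>) * d x))"
    by (rule AA.diff_ord_scale)
  then have "diff_ord A A n d"
    using \<open>a \<noteq> \<theta>\<close> by (simp add: mult.assoc[symmetric])
  then show ?case
    using Suc by blast
qed simp

text \<open>One linear factor is cancelled at a time by \<open>diff_op_eq_0_if_eigen\<close>, whose
  eigenvalue \<open>act h \<theta>\<close> differs from \<theta> because \<open>h\<close> is not
  \<open>e\<close>.\<close>

lemma diff_op_eq_0_if_pact:
  assumes "H \<subseteq> G - {e}" "diff_ord A A n d" "\<And>x. x \<in> A \<Longrightarrow> pact \<theta> (roots_poly H) d x = 0" "x \<in> A"
  shows "d x = 0"
proof -
  have "finite H"
    using assms(1) finite_G by (metis finite_Diff finite_subset)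
  then show ?thesis
    using assms
  proof (induction H arbitrary: x)
    case empty
    then show ?case
      by (simp add: roots_poly_def pact_def)
  next
    case (insert h H)
    have "roots_poly (insert h H) = [:- act h \<theta>, 1:] * roots_poly H"
      using insert by (simp add: roots_poly_def)
    then have "pact \<theta> (roots_poly H) d (\<theta> * x) = act h \<theta> * pact \<theta> (roots_poly H) d x" if "x \<in> A" for x
      using insert.prems(3)[OF that] by (simp add: pact_mult pact_linear del: mult_pCons_left)
    then have "pact \<theta> (roots_poly H) d x = 0" if "x \<in> A" for x
      using insert.prems that theta_free
      by (intro diff_op_eq_0_if_eigen[of n _ "act h \<theta>"] AA.diff_ord_pact theta_mem) auto
    then show ?case
      using insert by blast
  qed
qed

text \<open>By induction the commutators with invariants vanish, so \<open>d\<close> is linear over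
  the invariants and killed by \<open>roots_poly G\<close>. Splitting off X - \<theta> leaves
  [d, \<theta>] killed by the other factors, hence zero. So \<open>d\<close> is multiplication by
  \<open>d 1\<close>, which is zero.\<close>

lemma diff_op_eq_0_if_invariants:
  assumes "additive_on A d" "diff_ord A A n d" "\<And>b. b \<in> invariants \<Longrightarrow> d b = 0" "x \<in> A"
  shows "d x = 0"
  using assms
proof (induction n arbitrary: d x)
  case (Suc n)
  have ad0: "ad b d x = 0" if b: "b \<in> invariants" and "x \<in> A" for b x
  proof (rule Suc.IH[OF _ _ _ \<open>x \<in> A\<close>])
    show "additive_on A (ad b d)" "diff_ord A A n (ad b d)"
      using b invariants_subset Suc.prems additive_on_ad by auto
    show "ad b d c = 0" if "c \<in> invariants" for c
      using that b Suc.prems(3) B.mult_mem by (simp add: ad_def)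
  qed
  have "pact \<theta> (roots_poly G) d x = 0" if "x \<in> A" for x
    using diff_ord_pact_roots_poly[of d 0] Suc.prems(1) ad0 that by simp
  then have "pact \<theta> (roots_poly (G - {e})) (ad \<theta> d) x = 0" if "x \<in> A" for x
    using that unfolding roots_poly_split ad_pact[symmetric]
    by (simp add: pact_mult pact_linear ad_def del: mult_pCons_left)
  then have "ad \<theta> d x = 0" if "x \<in> A" for x
    using diff_op_eq_0_if_pact[OF order_refl, of n "ad \<theta> d" x] Suc.prems(2) theta_mem that by simp
  then have "diff_ord A A 0 (ad x d)"
    by (intro diff_ord_ad_generated[OF order_refl Suc.prems(1) _ _ Suc.prems(4)]) (simp_all add: ad0)
  then have "ad x d 1 = 0"
    using one_mem by simp
  then have "d x = x * d 1"
    by (simp add: ad_def)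
  then show ?case
    using Suc.prems(3)[OF B.one_mem] by simp
qed simp

text \<open>The Lagrange interpolation polynomial with value 1 at \<theta> and 0 at its other
  conjugates, acting on operators.\<close>

definition project :: "('k \<Rightarrow> 'k) \<Rightarrow> 'k \<Rightarrow> 'k" where
  "project d = (\<lambda>x. inverse cofactor * pact \<theta> (roots_poly (G - {e})) d x)"

lemma ad_project: "ad y ((project ^^ N) d) = (project ^^ N) (ad y d)"
  by (induction N arbitrary: d) (simp_all add: project_def ad_scale ad_pact)

lemma additive_on_project:
  assumes "additive_on A d"
  shows "additive_on A ((project ^^ N) d)"
proof (induction N)
  case (Suc N)
  then show ?case
    using additive_on_pact[OF Suc theta_mem, of "roots_poly (G - {e})"]
    by (simp add: project_def additive_on_def algebra_simps)
qed (use assms in simp)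

lemma diff_ord_project_invariants:
  assumes "diff_ord A invariants n d"
  shows "diff_ord A invariants n ((project ^^ N) d)"
  by (induction N) (auto simp: project_def assms intro!: AB.diff_ord_scale AB.diff_ord_pact theta_mem)

lemma project_cong:
  assumes "\<And>x. x \<in> A \<Longrightarrow> d x = d' x" "x \<in> A"
  shows "(project ^^ N) d x = (project ^^ N) d' x"
  using assms(2)
  by (induction N arbitrary: x)
    (auto simp: assms(1) project_def pact_def power_mem mult_mem theta_mem)

text \<open>Up to a left factor, [project d, \<theta>] is \<open>roots_poly G\<close> acting on
  \<open>d\<close>, which lowers the order over the invariants. Each application of
  \<open>project\<close> thus trades one order over the invariants for one commutator with
  \<theta>.\<close>

lemma diff_ord_project_theta:
  assumes "additive_on A d" "diff_ord A invariants N d"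
  shows "diff_ord A {\<theta>} N ((project ^^ N) d)"
  using assms
proof (induction N arbitrary: d)
  case (Suc N)
  let ?d = "ad \<theta> (project d)"
  have eq: "?d = (\<lambda>x. inverse cofactor * pact \<theta> (roots_poly G) d x)"
    unfolding roots_poly_split
    by (simp add: fun_eq_iff project_def ad_scale pact_mult pact_linear ad_def del: mult_pCons_left)
  have "diff_ord A invariants N ?d"
    unfolding eq using Suc.prems by (intro AB.diff_ord_scale diff_ord_pact_roots_poly)
  moreover have "additive_on A ?d"
    using additive_on_project[OF Suc.prems(1), of 1] theta_mem additive_on_ad by simp
  ultimately have "diff_ord A {\<theta>} N ((project ^^ N) ?d)"
    using Suc.IH by blast
  then show ?case
    by (simp add: funpow_swap1 ad_project del: funpow.simps(2) add: funpow_Suc_right)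
qed (simp)

text \<open>The first application extracts multiplication by \<open>a\<close> from the trace;
  further ones fix it because the interpolation polynomial has value 1 at \<theta>.\<close>

lemma project_trace:
  assumes "0 < N" "x \<in> A"
  shows "(project ^^ N) (\<lambda>x. a * trace x) x = a * x"
  using assms
proof (induction N arbitrary: x rule: nat_induct_non_zero)
  case 1
  then show ?case
    using pact_cofactor_trace[OF 1] cofactor_nonzero by (simp add: project_def)
next
  case (Suc N)
  have "(project ^^ Suc N) (\<lambda>x. a * trace x) x = project (\<lambda>x. a * x) x"
    using project_cong[of "(project ^^ N) (\<lambda>x. a * trace x)" "\<lambda>x. a * x" x 1] Suc by simp
  also have "\<dots> = inverse cofactor * (poly (roots_poly (G - {e})) \<theta> * (a * x))"
    by (simp add: project_def pact_def poly_altdef sum_distrib_right sum_distrib_left mult_ac)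
  also have "\<dots> = a * x"
    using cofactor_nonzero by (simp add: cofactor_def)
  finally show ?case .
qed

lemma fracs_project:
  assumes "\<And>x. x \<in> A \<Longrightarrow> d x \<in> fracs A" "x \<in> A"
  shows "(project ^^ N) d x \<in> fracs A"
  using assms(2)
proof (induction N arbitrary: x)
  case (Suc N)
  interpret L: subring_set "fracs A"
    by (rule subring_set_fracs)
  have pA: "Polynomial.coeff (roots_poly (G - {e})) i \<in> fracs A" for i
    using coeff_roots_poly[of "G - {e}"] subset_fracs by auto
  have "pact \<theta> (roots_poly (G - {e})) ((project ^^ N) d) x \<in> fracs A"
    unfolding pact_def using Suc pA
    by (intro L.sum_mem L.mult_mem) (auto intro!: mult_mem power_mem theta_mem)
  then have "pact \<theta> (roots_poly (G - {e})) ((project ^^ N) d) x / cofactor \<in> fracs A"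
    using cofactor_mem subset_fracs by (intro fracs_divide) auto
  moreover have "(project ^^ Suc N) d x = pact \<theta> (roots_poly (G - {e})) ((project ^^ N) d) x / cofactor"
    by (simp add: project_def[of "(project ^^ N) d"] divide_inverse mult.commute)
  ultimately show ?case
    by simp
qed (use assms in simp)

text \<open>The trace is linear over the invariants, so commutators with invariants pass through it.
  In general it is not linear over \<open>A\<close>, which is what the projections repair.\<close>

lemma trace_operator:
  assumes "additive_on invariants q" "diff_ord invariants invariants n q"
  shows "additive_on A (\<lambda>x. q (trace x))" "diff_ord A invariants n (\<lambda>x. q (trace x))"
proof -
  show "additive_on A (\<lambda>x. q (trace x))"
    using assms(1) additive_on_trace trace_invariant unfolding additive_on_def by simp
  show "diff_ord A invariants n (\<lambda>x. q (trace x))"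
    using assms(2)
  proof (induction n arbitrary: q)
    case 0
    then show ?case
      using trace_invariant by simp
  next
    case (Suc n)
    have "diff_ord A invariants n (ad b (\<lambda>x. q (trace x)))" if b: "b \<in> invariants" for b
    proof (rule AB.diff_ord_cong)
      show "diff_ord A invariants n (\<lambda>x. ad b q (trace x))"
        using Suc b by simp
      show "ad b q (trace x) = ad b (\<lambda>x. q (trace x)) x" if "x \<in> A" for x
        using trace_scale[OF b that] by (simp add: ad_def)
    qed
    then show ?case
      by simp
  qed
qed

interpretation BB: operator_domain invariants invariants
  by (rule B.operator_domain_self)

text \<open>At the lowest order \<open>q\<close> is multiplication by \<open>q 1\<close>, which
  \<open>project\<close> recovers from the trace. Commutators with invariants are compatible with
  the trace and with \<open>project\<close>, so in general the two operators agree up to lower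
  order.\<close>

lemma diff_ord_project_error:
  assumes "additive_on invariants q" "diff_ord invariants invariants (Suc n) q" "0 < N"
  shows "diff_ord invariants invariants n (\<lambda>x. q x - (project ^^ N) (\<lambda>x. q (trace x)) x)"
  using assms(1,2)
proof (induction n arbitrary: q)
  case 0
  have q: "q b = q 1 * b" if "b \<in> invariants" for b
  proof -
    have "ad b q 1 = 0"
      using 0(2) that B.one_mem by auto
    then show ?thesis
      by (simp add: ad_def mult.commute)
  qed
  have "(project ^^ N) (\<lambda>x. q (trace x)) b = q b" if b: "b \<in> invariants" for b
  proof -
    have bA: "b \<in> A"
      using b invariants_subset by blast
    have "(project ^^ N) (\<lambda>x. q (trace x)) b = (project ^^ N) (\<lambda>x. q 1 * trace x) b"
      using q trace_invariant by (intro project_cong[OF _ bA]) auto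
    then show ?thesis
      using project_trace[OF \<open>0 < N\<close> bA] q[OF b] by simp
  qed
  then show ?case
    by simp
next
  case (Suc n)
  have "diff_ord invariants invariants n (ad b (\<lambda>x. q x - (project ^^ N) (\<lambda>x. q (trace x)) x))"
    if b: "b \<in> invariants" for b
  proof (rule BB.diff_ord_cong)
    show "diff_ord invariants invariants n
        (\<lambda>x. ad b q x - (project ^^ N) (\<lambda>x. ad b q (trace x)) x)"
      using Suc b by (intro Suc.IH) (auto intro: B.additive_on_ad)
    fix x assume "x \<in> invariants"
    then have x: "x \<in> A"
      using invariants_subset by blast
    have "(project ^^ N) (\<lambda>x. ad b q (trace x)) x = (project ^^ N) (ad b (\<lambda>x. q (trace x))) x"
      using trace_scale[OF b] by (intro project_cong[OF _ x]) (simp add: ad_def)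
    then show "ad b q x - (project ^^ N) (\<lambda>x. ad b q (trace x)) x =
        ad b (\<lambda>x. q x - (project ^^ N) (\<lambda>x. q (trace x)) x) x"
      by (simp add: ad_minus ad_project)
  qed
  then show ?case
    by simp
qed

text \<open>The operator \<open>q \<circ> trace\<close> is a sum of the operators \<open>d \<circ> g\<close>, where \<open>d\<close> is the lift of \<open>q\<close>. A high power
  of \<open>project\<close> kills the terms with \<open>g\<close> nontrivial and changes \<open>d\<close> only in lower order.\<close>

lemma invariants_operator_lift:
  assumes "additive_on invariants q" "diff_ord invariants invariants n q"
    and "\<And>x. x \<in> invariants \<Longrightarrow> q x \<in> fracs A"
  shows "\<exists>d N. additive_on A d \<and> diff_ord A A N d \<and> (\<forall>x\<in>A. d x \<in> fracs A) \<and> (\<forall>x\<in>invariants. d x = q x)"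
  using assms
proof (induction n arbitrary: q)
  interpret L: subring_set "fracs A"
    by (rule subring_set_fracs)
  {
    case 0
    then show ?case
      by (intro exI[of _ "\<lambda>x. 0"] exI[of _ 0]) (auto simp: additive_on_def L.zero_mem)
  next
    case (Suc n)
    \<comment> \<open>The exponent equals the order index of \<open>q\<close>, so that by
      \<open>diff_ord_project_theta\<close> the order against \<theta> is bounded too. What
      \<open>?d\<close> misses of \<open>q\<close> on the invariants has lower order and is lifted
      by induction.\<close>
    let ?d = "(project ^^ Suc n) (\<lambda>x. q (trace x))"
    note tr = trace_operator[OF Suc.prems(1,2)]
    have d_add: "additive_on A ?d"
      using additive_on_project[OF tr(1)] .
    have d_ord: "diff_ord A A (Suc n + Suc n) ?d"
      by (intro diff_ord_generated d_add diff_ord_project_invariants diff_ord_project_theta tr)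
    have d_mem: "?d x \<in> fracs A" if "x \<in> A" for x
      using that Suc.prems(3) trace_invariant by (intro fracs_project) auto
    have "additive_on invariants (\<lambda>x. q x - ?d x)"
      unfolding additive_on_def
    proof (intro ballI)
      fix x y assume "x \<in> invariants" "y \<in> invariants"
      then have "q (x + y) = q x + q y" "?d (x + y) = ?d x + ?d y"
        using Suc.prems(1) d_add invariants_subset unfolding additive_on_def by blast+
      then show "q (x + y) - ?d (x + y) = (q x - ?d x) + (q y - ?d y)"
        by (simp del: funpow.simps)
    qed
    moreover have "q x - ?d x \<in> fracs A" if "x \<in> invariants" for x
      using that Suc.prems(3) d_mem invariants_subset by (intro L.diff_mem) auto
    moreover have "diff_ord invariants invariants n (\<lambda>x. q x - ?d x)"
      using Suc.prems by (intro diff_ord_project_error) auto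
    ultimately obtain d N where d: "additive_on A d" "diff_ord A A N d" "\<forall>x\<in>A. d x \<in> fracs A"
      "\<forall>x\<in>invariants. d x = q x - ?d x"
      using Suc.IH by blast
    show ?case
    proof (intro exI conjI ballI)
      show "additive_on A (\<lambda>x. d x + ?d x)"
        using d(1) d_add unfolding additive_on_def by (simp del: funpow.simps)
      show "diff_ord A A (max N (Suc n + Suc n)) (\<lambda>x. d x + ?d x)"
        using d(2) d_ord by (intro AA.diff_ord_plus; elim AA.diff_ord_le) auto
      show "d x + ?d x \<in> fracs A" if "x \<in> A" for x
        using that d(3) d_mem by (intro L.add_mem) auto
      show "d x + ?d x = q x" if "x \<in> invariants" for x
        using that d(4) by simp
    qed
  }
qed

end

section \<open>Embeddings inducing isomorphisms of fraction skew fields\<close>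

lemma frac_iff:
  "(t, b) \<in> frac R s a \<longleftrightarrow> s \<in> nonzeros R \<and> t \<in> nonzeros R \<and> a \<in> carrier R \<and> b \<in> carrier R \<and>
    (\<exists>u\<in>carrier R. \<exists>v\<in>carrier R. u \<otimes>\<^bsub>R\<^esub> s = v \<otimes>\<^bsub>R\<^esub> t \<and> u \<otimes>\<^bsub>R\<^esub> s \<noteq> \<zero>\<^bsub>R\<^esub> \<and>
      u \<otimes>\<^bsub>R\<^esub> a = v \<otimes>\<^bsub>R\<^esub> b)"
  by (auto simp: frac_def frac_rel_def)

lemma fracI:
  assumes "u \<in> carrier R" "v \<in> carrier R" "s \<in> nonzeros R" "t \<in> nonzeros R" "a \<in> carrier R" "b \<in> carrier R"
    and "u \<otimes>\<^bsub>R\<^esub> s = v \<otimes>\<^bsub>R\<^esub> t" "u \<otimes>\<^bsub>R\<^esub> s \<noteq> \<zero>\<^bsub>R\<^esub>" "u \<otimes>\<^bsub>R\<^esub> a = v \<otimes>\<^bsub>R\<^esub> b"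
  shows "(t, b) \<in> frac R s a"
  using assms unfolding frac_iff by blast

lemma frac_sym:
  assumes "(t, b) \<in> frac R s a"
  shows "(s, a) \<in> frac R t b"
proof -
  obtain u v where "u \<in> carrier R" "v \<in> carrier R" "s \<in> nonzeros R" "t \<in> nonzeros R" "a \<in> carrier R"
    "b \<in> carrier R" "u \<otimes>\<^bsub>R\<^esub> s = v \<otimes>\<^bsub>R\<^esub> t" "u \<otimes>\<^bsub>R\<^esub> s \<noteq> \<zero>\<^bsub>R\<^esub>" "u \<otimes>\<^bsub>R\<^esub> a = v \<otimes>\<^bsub>R\<^esub> b"
    using assms unfolding frac_iff by blast
  then show ?thesis
    by (intro fracI[of v R u]) auto
qed

lemma carrier_Frac: "carrier (Frac R) = {frac R s a | s a. s \<in> nonzeros R \<and> a \<in> carrier R}"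
  by (auto simp: Frac_def quotient_def frac_def)

text \<open>Without an Ore condition the operations of \<open>Frac\<close> need not yield fraction classes; images and
  preimages are therefore compared on arbitrary unions of classes.\<close>

locale frac_embedding = Q: ring Q
  for R :: "(complex, 'a, 'm) module_scheme" and Q :: "(complex, 'b, 'n) module_scheme" (structure) +
  fixes \<eta> :: "'a \<Rightarrow> 'b"
  assumes Q_smult: "q \<in> carrier Q \<Longrightarrow> c \<odot> q \<in> carrier Q"
    and Q_smult_mult: "w \<in> carrier Q \<Longrightarrow> q \<in> carrier Q \<Longrightarrow> w \<otimes> (c \<odot> q) = c \<odot> (w \<otimes> q)"
    and R_one: "\<one>\<^bsub>R\<^esub> \<in> carrier R" and R_zero: "\<zero>\<^bsub>R\<^esub> \<in> carrier R"
    and R_mult: "x \<in> carrier R \<Longrightarrow> y \<in> carrier R \<Longrightarrow> x \<otimes>\<^bsub>R\<^esub> y \<in> carrier R"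
    and R_add: "x \<in> carrier R \<Longrightarrow> y \<in> carrier R \<Longrightarrow> x \<oplus>\<^bsub>R\<^esub> y \<in> carrier R"
    and R_smult: "x \<in> carrier R \<Longrightarrow> c \<odot>\<^bsub>R\<^esub> x \<in> carrier R"
    and \<eta>_mem: "x \<in> carrier R \<Longrightarrow> \<eta> x \<in> carrier Q"
    and \<eta>_inj: "x \<in> carrier R \<Longrightarrow> y \<in> carrier R \<Longrightarrow> \<eta> x = \<eta> y \<Longrightarrow> x = y"
    and \<eta>_one: "\<eta> \<one>\<^bsub>R\<^esub> = \<one>" and \<eta>_zero: "\<eta> \<zero>\<^bsub>R\<^esub> = \<zero>"
    and \<eta>_mult: "x \<in> carrier R \<Longrightarrow> y \<in> carrier R \<Longrightarrow> \<eta> (x \<otimes>\<^bsub>R\<^esub> y) = \<eta> x \<otimes> \<eta> y"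
    and \<eta>_add: "x \<in> carrier R \<Longrightarrow> y \<in> carrier R \<Longrightarrow> \<eta> (x \<oplus>\<^bsub>R\<^esub> y) = \<eta> x \<oplus> \<eta> y"
    and \<eta>_smult: "x \<in> carrier R \<Longrightarrow> \<eta> (c \<odot>\<^bsub>R\<^esub> x) = c \<odot> \<eta> x"
    and localize: "p \<in> carrier Q \<Longrightarrow> q \<in> carrier Q \<Longrightarrow>
      \<exists>w\<in>Units Q. \<exists>s\<in>carrier R. \<exists>a\<in>carrier R. w \<otimes> p = \<eta> s \<and> w \<otimes> q = \<eta> a"
begin

text \<open>A left fraction does not change when both entries are multiplied by a unit from the
  left, so the class over \<open>Q\<close> is recovered from the members of \<open>P\<close> by unit
  multiples.\<close>

definition extend_class :: "('a \<times> 'a) set \<Rightarrow> ('b \<times> 'b) set" where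
  "extend_class P = {(x, y). x \<in> nonzeros Q \<and> y \<in> carrier Q \<and>
     (\<exists>w\<in>Units Q. \<exists>s a. (s, a) \<in> P \<and> w \<otimes> x = \<eta> s \<and> w \<otimes> y = \<eta> a)}"

definition restrict_class :: "('b \<times> 'b) set \<Rightarrow> ('a \<times> 'a) set" where
  "restrict_class T = {(s, a). s \<in> carrier R \<and> a \<in> carrier R \<and> (\<eta> s, \<eta> a) \<in> T}"

section \<open>Fraction classes along the embedding\<close>

lemma extend_class_Union: "extend_class (\<Union>F) = \<Union>(extend_class ` F)"
  unfolding extend_class_def by blast

lemma restrict_class_Union: "restrict_class (\<Union>F) = \<Union>(restrict_class ` F)"
  unfolding restrict_class_def by blast

lemma unit_cancel:
  assumes "w \<in> Units Q" "x \<in> carrier Q"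
  shows "inv w \<otimes> (w \<otimes> x) = x" "w \<otimes> x = \<zero> \<longleftrightarrow> x = \<zero>"
proof -
  have w: "w \<in> carrier Q" "inv w \<in> carrier Q"
    using assms by auto
  show 1: "inv w \<otimes> (w \<otimes> x) = x"
    using w assms by (simp add: Q.m_assoc[symmetric])
  show "w \<otimes> x = \<zero> \<longleftrightarrow> x = \<zero>"
    using 1 w by (metis Q.r_null)
qed

lemma unit_shift:
  assumes "w \<in> Units Q" "u \<in> carrier Q" "x \<in> carrier Q"
  shows "(u \<otimes> inv w) \<otimes> (w \<otimes> x) = u \<otimes> x"
proof -
  have w: "w \<in> carrier Q" "inv w \<in> carrier Q"
    using assms by auto
  show ?thesis
    using w assms unit_cancel(1)[OF assms(1,3)] by (simp add: Q.m_assoc)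
qed

lemma nonzeros_unit:
  assumes "w \<in> Units Q" "x \<in> carrier Q"
  shows "w \<otimes> x \<in> nonzeros Q \<longleftrightarrow> x \<in> nonzeros Q"
  using assms unit_cancel(2)[OF assms] by (auto simp: nonzeros_def)

lemma frac_unit_mem:
  assumes w: "w \<in> Units Q" and x: "x \<in> carrier Q" and y: "y \<in> carrier Q"
  shows "(w \<otimes> x, w \<otimes> y) \<in> frac Q s a \<longleftrightarrow> (x, y) \<in> frac Q s a"
proof -
  have wQ: "w \<in> carrier Q" "inv w \<in> carrier Q"
    using w by auto
  show ?thesis
  proof
    assume "(w \<otimes> x, w \<otimes> y) \<in> frac Q s a"
    then obtain u v where "u \<in> carrier Q" "v \<in> carrier Q" "s \<in> nonzeros Q" "a \<in> carrier Q"
      "w \<otimes> x \<in> nonzeros Q"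
      "u \<otimes> s = v \<otimes> (w \<otimes> x)" "u \<otimes> s \<noteq> \<zero>" "u \<otimes> a = v \<otimes> (w \<otimes> y)"
      unfolding frac_iff by blast
    then show "(x, y) \<in> frac Q s a"
      using x y wQ nonzeros_unit[OF w x] by (intro fracI[of u _ "v \<otimes> w"]) (auto simp: Q.m_assoc)
  next
    assume "(x, y) \<in> frac Q s a"
    then obtain u v where "u \<in> carrier Q" "v \<in> carrier Q" "s \<in> nonzeros Q" "a \<in> carrier Q"
      "x \<in> nonzeros Q"
      "u \<otimes> s = v \<otimes> x" "u \<otimes> s \<noteq> \<zero>" "u \<otimes> a = v \<otimes> y"
      unfolding frac_iff by blast
    then show "(w \<otimes> x, w \<otimes> y) \<in> frac Q s a"
      using x y wQ nonzeros_unit[OF w x]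
      by (intro fracI[of u _ "v \<otimes> inv w"]) (auto simp: unit_shift[OF w])
  qed
qed

lemma frac_unit:
  assumes w: "w \<in> Units Q" and x: "x \<in> carrier Q" and y: "y \<in> carrier Q"
  shows "frac Q (w \<otimes> x) (w \<otimes> y) = frac Q x y"
proof -
  have "(t, b) \<in> frac Q (w \<otimes> x) (w \<otimes> y) \<longleftrightarrow> (t, b) \<in> frac Q x y" for t b
    using frac_unit_mem[OF assms, of t b] frac_sym by meson
  then show ?thesis
    by auto
qed

lemma nonzeros_\<eta>: "s \<in> carrier R \<Longrightarrow> \<eta> s \<in> nonzeros Q \<longleftrightarrow> s \<in> nonzeros R"
  using \<eta>_inj[OF _ R_zero] \<eta>_zero \<eta>_mem by (auto simp: nonzeros_def)

text \<open>The multipliers that witness the equivalence over \<open>Q\<close> need not come from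
  \<open>R\<close>; \<open>localize\<close> moves both into \<open>R\<close> by one unit, and the
  equations survive multiplication by it.\<close>

lemma frac_\<eta>_iff:
  assumes s: "s \<in> carrier R" and a: "a \<in> carrier R" and t: "t \<in> carrier R" and b: "b \<in> carrier R"
  shows "(\<eta> t, \<eta> b) \<in> frac Q (\<eta> s) (\<eta> a) \<longleftrightarrow> (t, b) \<in> frac R s a"
proof
  assume "(\<eta> t, \<eta> b) \<in> frac Q (\<eta> s) (\<eta> a)"
  then obtain u v where uv: "u \<in> carrier Q" "v \<in> carrier Q"
    and nz: "\<eta> s \<in> nonzeros Q" "\<eta> t \<in> nonzeros Q"
    and eq: "u \<otimes> \<eta> s = v \<otimes> \<eta> t" "u \<otimes> \<eta> s \<noteq> \<zero>" "u \<otimes> \<eta> a = v \<otimes> \<eta> b"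
    unfolding frac_iff by blast
  obtain w u' v' where w: "w \<in> Units Q" and u'v': "u' \<in> carrier R" "v' \<in> carrier R"
    and w_eq: "w \<otimes> u = \<eta> u'" "w \<otimes> v = \<eta> v'"
    using localize[OF uv] by blast
  have wQ: "w \<in> carrier Q"
    using w by auto
  have \<eta>u: "\<eta> (u' \<otimes>\<^bsub>R\<^esub> c) = w \<otimes> (u \<otimes> \<eta> c)"
    and \<eta>v: "\<eta> (v' \<otimes>\<^bsub>R\<^esub> c) = w \<otimes> (v \<otimes> \<eta> c)" if "c \<in> carrier R" for c
    using that u'v' uv wQ \<eta>_mem by (simp_all add: \<eta>_mult w_eq[symmetric] Q.m_assoc)
  have "u' \<otimes>\<^bsub>R\<^esub> s = v' \<otimes>\<^bsub>R\<^esub> t" "u' \<otimes>\<^bsub>R\<^esub> a = v' \<otimes>\<^bsub>R\<^esub> b"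
    using assms u'v' eq by (auto intro!: \<eta>_inj R_mult simp: \<eta>u \<eta>v)
  moreover have "u' \<otimes>\<^bsub>R\<^esub> s \<noteq> \<zero>\<^bsub>R\<^esub>"
    using \<eta>u[OF s] eq(2) unit_cancel(2)[OF w, of "u \<otimes> \<eta> s"] uv \<eta>_mem[OF s] \<eta>_zero by auto
  ultimately show "(t, b) \<in> frac R s a"
    unfolding frac_iff using nz nonzeros_\<eta> assms u'v' by blast
next
  assume "(t, b) \<in> frac R s a"
  then obtain u v where uv: "u \<in> carrier R" "v \<in> carrier R"
    and nz: "s \<in> nonzeros R" "t \<in> nonzeros R"
    and eq: "u \<otimes>\<^bsub>R\<^esub> s = v \<otimes>\<^bsub>R\<^esub> t" "u \<otimes>\<^bsub>R\<^esub> s \<noteq> \<zero>\<^bsub>R\<^esub>" "u \<otimes>\<^bsub>R\<^esub> a = v \<otimes>\<^bsub>R\<^esub> b"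
    unfolding frac_iff by blast
  have "\<eta> u \<otimes> \<eta> s = \<eta> v \<otimes> \<eta> t" "\<eta> u \<otimes> \<eta> a = \<eta> v \<otimes> \<eta> b"
    using assms uv eq by (simp_all add: \<eta>_mult[symmetric])
  moreover have "\<eta> u \<otimes> \<eta> s \<noteq> \<zero>"
    using \<eta>_inj[OF R_mult[OF uv(1) s] R_zero] eq(2) \<eta>_zero \<eta>_mult[OF uv(1) s] by auto
  ultimately show "(\<eta> t, \<eta> b) \<in> frac Q (\<eta> s) (\<eta> a)"
    unfolding frac_iff using nz nonzeros_\<eta> assms uv \<eta>_mem by blast
qed

lemma extend_class_frac:
  assumes s: "s \<in> carrier R" and a: "a \<in> carrier R"
  shows "extend_class (frac R s a) = frac Q (\<eta> s) (\<eta> a)"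
proof (rule subset_antisym; clarify)
  fix x y assume "(x, y) \<in> extend_class (frac R s a)"
  then obtain w t b where w: "w \<in> Units Q" and tb: "(t, b) \<in> frac R s a" and xy: "x \<in> carrier Q" "y \<in> carrier Q"
    and eq: "w \<otimes> x = \<eta> t" "w \<otimes> y = \<eta> b"
    unfolding extend_class_def nonzeros_def by blast
  have "t \<in> carrier R" "b \<in> carrier R"
    using tb unfolding frac_iff nonzeros_def by auto
  then have "(\<eta> t, \<eta> b) \<in> frac Q (\<eta> s) (\<eta> a)"
    using frac_\<eta>_iff[OF s a] tb by blast
  then show "(x, y) \<in> frac Q (\<eta> s) (\<eta> a)"
    using frac_unit_mem[OF w xy] eq by simp
next
  fix x y assume xy: "(x, y) \<in> frac Q (\<eta> s) (\<eta> a)"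
  then have xyQ: "x \<in> nonzeros Q" "x \<in> carrier Q" "y \<in> carrier Q"
    unfolding frac_iff nonzeros_def by auto
  obtain w t b where w: "w \<in> Units Q" and tb: "t \<in> carrier R" "b \<in> carrier R"
    and eq: "w \<otimes> x = \<eta> t" "w \<otimes> y = \<eta> b"
    using localize[OF xyQ(2,3)] by blast
  have "(t, b) \<in> frac R s a"
    using frac_\<eta>_iff[OF s a tb] frac_unit_mem[OF w xyQ(2,3)] xy eq by simp
  then show "(x, y) \<in> extend_class (frac R s a)"
    unfolding extend_class_def using xyQ w eq by blast
qed

lemma restrict_class_frac:
  assumes "s \<in> carrier R" "a \<in> carrier R"
  shows "restrict_class (frac Q (\<eta> s) (\<eta> a)) = frac R s a"
  using frac_\<eta>_iff[OF assms] by (auto simp: restrict_class_def) (auto simp: frac_iff nonzeros_def)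

lemma restrict_extend_class:
  assumes "\<And>P. P \<in> F \<Longrightarrow> \<exists>s\<in>carrier R. \<exists>a\<in>carrier R. P = frac R s a"
  shows "restrict_class (extend_class (\<Union>F)) = \<Union>F"
proof -
  have "restrict_class (extend_class P) = P" if "P \<in> F" for P
    using assms[OF that] by (auto simp: extend_class_frac restrict_class_frac)
  then show ?thesis
    unfolding extend_class_Union restrict_class_Union image_image by (simp cong: image_cong_simp)
qed

lemma Frac_carrierE:
  assumes "P \<in> carrier (Frac R)"
  obtains s a where "s \<in> nonzeros R" "s \<in> carrier R" "a \<in> carrier R" "P = frac R s a"
  using assms by (auto simp: carrier_Frac nonzeros_def intro: that)

lemma mem_carriers:
  assumes "P \<in> carrier (Frac R)" "(s, a) \<in> P"
  shows "s \<in> nonzeros R" "s \<in> carrier R" "a \<in> carrier R"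
  using assms by (auto simp: carrier_Frac frac_iff nonzeros_def)

lemma extend_class_\<eta>:
  assumes "P \<in> carrier (Frac R)" "(s, a) \<in> P"
  shows "(\<eta> s, \<eta> a) \<in> extend_class P"
  unfolding extend_class_def using mem_carriers[OF assms] assms(2)
  by (intro CollectI case_prodI conjI bexI[of _ "\<one>"] exI[of _ s] exI[of _ a])
    (simp_all add: nonzeros_\<eta> \<eta>_mem)

lemma extend_class_mem:
  assumes "P \<in> carrier (Frac R)" "(x, y) \<in> extend_class P"
  obtains w s a where "w \<in> Units Q" "(s, a) \<in> P" "x \<in> carrier Q" "y \<in> carrier Q"
    "w \<otimes> x = \<eta> s" "w \<otimes> y = \<eta> a" "s \<in> carrier R" "a \<in> carrier R"
proof -
  obtain w s a where *: "w \<in> Units Q" "(s, a) \<in> P" "x \<in> carrier Q" "y \<in> carrier Q"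
    "w \<otimes> x = \<eta> s" "w \<otimes> y = \<eta> a"
    using assms(2) unfolding extend_class_def nonzeros_def by blast
  then show thesis
    using that[OF *] mem_carriers[OF assms(1) *(2)] by blast
qed

lemma extend_class_bij: "bij_betw extend_class (carrier (Frac R)) (carrier (Frac Q))"
proof (rule bij_betw_byWitness[where f' = restrict_class])
  show "\<forall>P\<in>carrier (Frac R). restrict_class (extend_class P) = P"
    by (auto simp: extend_class_frac restrict_class_frac elim!: Frac_carrierE)
  have Q: "\<exists>s\<in>nonzeros R. \<exists>a\<in>carrier R. T = frac Q (\<eta> s) (\<eta> a)" if T: "T \<in> carrier (Frac Q)" for T
  proof -
    obtain x y where xy: "x \<in> nonzeros Q" "x \<in> carrier Q" "y \<in> carrier Q" "T = frac Q x y"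
      using T by (auto simp: carrier_Frac nonzeros_def)
    obtain w s a where w: "w \<in> Units Q" and sa: "s \<in> carrier R" "a \<in> carrier R"
      and eq: "w \<otimes> x = \<eta> s" "w \<otimes> y = \<eta> a"
      using localize[OF xy(2,3)] by blast
    have "s \<in> nonzeros R"
      using nonzeros_\<eta>[OF sa(1)] nonzeros_unit[OF w xy(2)] xy(1) eq(1) by simp
    moreover have "T = frac Q (\<eta> s) (\<eta> a)"
      using frac_unit[OF w xy(2,3)] eq xy(4) by simp
    ultimately show ?thesis
      using sa by blast
  qed
  have nz: "nonzeros R \<subseteq> carrier R"
    by (auto simp: nonzeros_def)
  show "\<forall>T\<in>carrier (Frac Q). extend_class (restrict_class T) = T"
    using Q nz by (metis extend_class_frac restrict_class_frac subsetD)
  show "extend_class ` carrier (Frac R) \<subseteq> carrier (Frac Q)"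
  proof clarify
    fix P assume "P \<in> carrier (Frac R)"
    then obtain s a where "s \<in> nonzeros R" "s \<in> carrier R" "a \<in> carrier R" "P = frac R s a"
      by (rule Frac_carrierE)
    then have "extend_class P = frac Q (\<eta> s) (\<eta> a)" "\<eta> s \<in> nonzeros Q" "\<eta> a \<in> carrier Q"
      using nonzeros_\<eta> \<eta>_mem extend_class_frac by simp_all
    then show "extend_class P \<in> carrier (Frac Q)"
      unfolding carrier_Frac by blast
  qed
  show "restrict_class ` carrier (Frac Q) \<subseteq> carrier (Frac R)"
  proof clarify
    fix T assume "T \<in> carrier (Frac Q)"
    then obtain s a where sa: "s \<in> nonzeros R" "a \<in> carrier R" "T = frac Q (\<eta> s) (\<eta> a)"
      using Q by blast
    then have "restrict_class T = frac R s a"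
      using nz restrict_class_frac by blast
    then show "restrict_class T \<in> carrier (Frac R)"
      unfolding carrier_Frac using sa by blast
  qed
qed

text \<open>With \<open>w\<close> and \<open>w'\<close> bringing the two fractions into
  \<open>R\<close>, the new multipliers are p = z u w^-1 and r = z v w'^-1, where
  \<open>localize\<close> supplies \<open>z\<close>. Relations between multiples by \<open>u\<close>
  and \<open>v\<close> over \<open>Q\<close> so become relations over \<open>R\<close>.\<close>

lemma common_denominator:
  assumes P: "P \<in> carrier (Frac R)" "(x, y) \<in> extend_class P"
    and P': "P' \<in> carrier (Frac R)" "(x', y') \<in> extend_class P'"
    and uv: "u \<in> carrier Q" "v \<in> carrier Q"
  obtains z s a t b p r where "z \<in> Units Q" "(s, a) \<in> P" "(t, b) \<in> P'" "p \<in> carrier R" "r \<in> carrier R"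
    "\<eta> (p \<otimes>\<^bsub>R\<^esub> s) = z \<otimes> (u \<otimes> x)" "\<eta> (p \<otimes>\<^bsub>R\<^esub> a) = z \<otimes> (u \<otimes> y)"
    "\<eta> (r \<otimes>\<^bsub>R\<^esub> t) = z \<otimes> (v \<otimes> x')" "\<eta> (r \<otimes>\<^bsub>R\<^esub> b) = z \<otimes> (v \<otimes> y')"
    "x \<in> carrier Q" "y \<in> carrier Q" "x' \<in> carrier Q" "y' \<in> carrier Q"
    "\<eta> p = \<zero> \<longrightarrow> u = \<zero>"
proof -
  obtain w s a where w: "w \<in> Units Q" "(s, a) \<in> P" "x \<in> carrier Q" "y \<in> carrier Q"
    "w \<otimes> x = \<eta> s" "w \<otimes> y = \<eta> a" "s \<in> carrier R" "a \<in> carrier R"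
    by (rule extend_class_mem[OF P])
  obtain w' t b where w': "w' \<in> Units Q" "(t, b) \<in> P'" "x' \<in> carrier Q" "y' \<in> carrier Q"
    "w' \<otimes> x' = \<eta> t" "w' \<otimes> y' = \<eta> b" "t \<in> carrier R" "b \<in> carrier R"
    by (rule extend_class_mem[OF P'])
  have wQ: "w \<in> carrier Q" "w' \<in> carrier Q" "inv w \<in> carrier Q" "inv w' \<in> carrier Q"
    using w(1) w'(1) by auto
  obtain z p r where z: "z \<in> Units Q" and pr: "p \<in> carrier R" "r \<in> carrier R"
    and zp: "z \<otimes> (u \<otimes> inv w) = \<eta> p" and zr: "z \<otimes> (v \<otimes> inv w') = \<eta> r"
    using localize[of "u \<otimes> inv w" "v \<otimes> inv w'"] uv wQ by blast
  have zQ: "z \<in> carrier Q"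
    using z by auto
  have p: "\<eta> p \<otimes> (w \<otimes> c) = z \<otimes> (u \<otimes> c)" and r: "\<eta> r \<otimes> (w' \<otimes> c) = z \<otimes> (v \<otimes> c)"
    if c: "c \<in> carrier Q" for c
    unfolding zp[symmetric] zr[symmetric]
    using zQ uv wQ c unit_shift[OF w(1) uv(1) c] unit_shift[OF w'(1) uv(2) c]
    by (simp_all add: Q.m_assoc)
  show thesis
  proof (rule that[OF z w(2) w'(2) pr])
    show "\<eta> p = \<zero> \<longrightarrow> u = \<zero>"
    proof
      assume "\<eta> p = \<zero>"
      then have "u \<otimes> inv w = \<zero>"
        using zp unit_cancel(2)[OF z, of "u \<otimes> inv w"] uv wQ by simp
      then show "u = \<zero>"
        using unit_shift[OF w(1) uv(1) Q.one_closed] uv wQ by simp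
    qed
  qed (use p[OF w(3)] p[OF w(4)] r[OF w'(3)] r[OF w'(4)] w w' pr in \<open>simp_all add: \<eta>_mult\<close>)
qed

text \<open>A product is a union of classes over all choices of Ore multipliers, and the choices
  over \<open>R\<close> and over \<open>Q\<close> give corresponding families. The second claim
  inverts \<open>extend_class\<close> on the product itself, which is not assumed to be a single
  class.\<close>

lemma extend_class_mult:
  assumes P: "P \<in> carrier (Frac R)" and P': "P' \<in> carrier (Frac R)"
  shows "extend_class (P \<otimes>\<^bsub>Frac R\<^esub> P') = extend_class P \<otimes>\<^bsub>Frac Q\<^esub> extend_class P'" (is ?mult)
    and "restrict_class (extend_class (P \<otimes>\<^bsub>Frac R\<^esub> P')) = P \<otimes>\<^bsub>Frac R\<^esub> P'" (is ?ret)
proof -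
  define F where "F = {frac R (t' \<otimes>\<^bsub>R\<^esub> s) (a' \<otimes>\<^bsub>R\<^esub> b) | s a t b t' a'.
      (s, a) \<in> P \<and> (t, b) \<in> P' \<and> t' \<in> nonzeros R \<and> a' \<in> carrier R \<and> t' \<otimes>\<^bsub>R\<^esub> a = a' \<otimes>\<^bsub>R\<^esub> t}"
  define F' where "F' = {frac Q (t' \<otimes> s) (a' \<otimes> b) | s a t b t' a'.
      (s, a) \<in> extend_class P \<and> (t, b) \<in> extend_class P' \<and> t' \<in> nonzeros Q \<and> a' \<in> carrier Q \<and>
      t' \<otimes> a = a' \<otimes> t}"
  have F: "P \<otimes>\<^bsub>Frac R\<^esub> P' = \<Union>F" and F': "extend_class P \<otimes>\<^bsub>Frac Q\<^esub> extend_class P' = \<Union>F'"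
    by (simp_all add: Frac_def F_def F'_def)
  have nz: "x \<in> nonzeros R \<Longrightarrow> x \<in> carrier R" "z \<in> nonzeros Q \<Longrightarrow> z \<in> carrier Q" for x z
    by (auto simp: nonzeros_def)
  have "\<exists>s\<in>carrier R. \<exists>a\<in>carrier R. T = frac R s a" if "T \<in> F" for T
  proof -
    obtain s a t b t' a' where "T = frac R (t' \<otimes>\<^bsub>R\<^esub> s) (a' \<otimes>\<^bsub>R\<^esub> b)" "(s, a) \<in> P" "(t, b) \<in> P'"
      "t' \<in> nonzeros R" "a' \<in> carrier R"
      using \<open>T \<in> F\<close> unfolding F_def by blast
    then show ?thesis
      using mem_carriers[OF P] mem_carriers[OF P'] nz R_mult by blast
  qed
  then show ?ret
    unfolding F by (rule restrict_extend_class)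
  have "extend_class ` F = F'"
  proof (intro equalityI subsetI)
    fix T assume "T \<in> extend_class ` F"
    then obtain s a t b t' a' where T: "T = extend_class (frac R (t' \<otimes>\<^bsub>R\<^esub> s) (a' \<otimes>\<^bsub>R\<^esub> b))"
      and sa: "(s, a) \<in> P" and tb: "(t, b) \<in> P'"
      and t': "t' \<in> nonzeros R" and a': "a' \<in> carrier R" and eq: "t' \<otimes>\<^bsub>R\<^esub> a = a' \<otimes>\<^bsub>R\<^esub> t"
      unfolding F_def by blast
    note m = mem_carriers[OF P sa] mem_carriers[OF P' tb] a' nz(1)[OF t']
    have "T = frac Q (\<eta> t' \<otimes> \<eta> s) (\<eta> a' \<otimes> \<eta> b)"
      unfolding T using m by (simp add: extend_class_frac R_mult \<eta>_mult)
    moreover have "\<eta> t' \<otimes> \<eta> a = \<eta> a' \<otimes> \<eta> t"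
      using m eq by (simp add: \<eta>_mult[symmetric])
    ultimately show "T \<in> F'"
      unfolding F'_def using extend_class_\<eta>[OF P sa] extend_class_\<eta>[OF P' tb]
        nonzeros_\<eta> t' m \<eta>_mem[OF a'] by blast
  next
    fix T assume "T \<in> F'"
    then obtain x y x' y' t' a' where T: "T = frac Q (t' \<otimes> x) (a' \<otimes> y')"
      and xy: "(x, y) \<in> extend_class P" and xy': "(x', y') \<in> extend_class P'"
      and t': "t' \<in> nonzeros Q" and a': "a' \<in> carrier Q" and eq: "t' \<otimes> y = a' \<otimes> x'"
      unfolding F'_def by blast
    have t'Q: "t' \<in> carrier Q"
      using nz t' by blast
    obtain z s a t b p r where z: "z \<in> Units Q" and sa: "(s, a) \<in> P" and tb: "(t, b) \<in> P'"
      and pr: "p \<in> carrier R" "r \<in> carrier R"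
      and ps: "\<eta> (p \<otimes>\<^bsub>R\<^esub> s) = z \<otimes> (t' \<otimes> x)" and pa: "\<eta> (p \<otimes>\<^bsub>R\<^esub> a) = z \<otimes> (t' \<otimes> y)"
      and rt: "\<eta> (r \<otimes>\<^bsub>R\<^esub> t) = z \<otimes> (a' \<otimes> x')" and rb: "\<eta> (r \<otimes>\<^bsub>R\<^esub> b) = z \<otimes> (a' \<otimes> y')"
      and Q: "x \<in> carrier Q" "y \<in> carrier Q" "x' \<in> carrier Q" "y' \<in> carrier Q"
      and p0: "\<eta> p = \<zero> \<longrightarrow> t' = \<zero>"
      by (rule common_denominator[OF P xy P' xy' t'Q a'])
    note m = mem_carriers[OF P sa] mem_carriers[OF P' tb]
    have eq': "p \<otimes>\<^bsub>R\<^esub> a = r \<otimes>\<^bsub>R\<^esub> t"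
      using pr m pa rt eq by (intro \<eta>_inj) (auto intro: R_mult)
    have p_nz: "p \<in> nonzeros R"
      using nonzeros_\<eta>[OF pr(1)] \<eta>_mem[OF pr(1)] p0 t' by (auto simp: nonzeros_def)
    have "frac Q (\<eta> (p \<otimes>\<^bsub>R\<^esub> s)) (\<eta> (r \<otimes>\<^bsub>R\<^esub> b)) = T"
      unfolding ps rb T using t'Q a' Q by (intro frac_unit[OF z]) auto
    then have "T = extend_class (frac R (p \<otimes>\<^bsub>R\<^esub> s) (r \<otimes>\<^bsub>R\<^esub> b))"
      using pr m by (simp add: extend_class_frac R_mult)
    moreover have "frac R (p \<otimes>\<^bsub>R\<^esub> s) (r \<otimes>\<^bsub>R\<^esub> b) \<in> F"
      unfolding F_def using sa tb p_nz pr(2) eq' by blast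
    ultimately show "T \<in> extend_class ` F"
      by blast
  qed
  then show ?mult
    unfolding F F' extend_class_Union by simp
qed

lemma extend_class_add:
  assumes P: "P \<in> carrier (Frac R)" and P': "P' \<in> carrier (Frac R)"
  shows "extend_class (P \<oplus>\<^bsub>Frac R\<^esub> P') = extend_class P \<oplus>\<^bsub>Frac Q\<^esub> extend_class P'" (is ?add)
    and "restrict_class (extend_class (P \<oplus>\<^bsub>Frac R\<^esub> P')) = P \<oplus>\<^bsub>Frac R\<^esub> P'" (is ?ret)
proof -
  define F where "F = {frac R (u \<otimes>\<^bsub>R\<^esub> s) (u \<otimes>\<^bsub>R\<^esub> a \<oplus>\<^bsub>R\<^esub> v \<otimes>\<^bsub>R\<^esub> b) | s a t b u v.
      (s, a) \<in> P \<and> (t, b) \<in> P' \<and> u \<in> carrier R \<and> v \<in> carrier R \<and>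
      u \<otimes>\<^bsub>R\<^esub> s = v \<otimes>\<^bsub>R\<^esub> t \<and> u \<otimes>\<^bsub>R\<^esub> s \<noteq> \<zero>\<^bsub>R\<^esub>}"
  define F' where "F' = {frac Q (u \<otimes> s) (u \<otimes> a \<oplus> v \<otimes> b) | s a t b u v.
      (s, a) \<in> extend_class P \<and> (t, b) \<in> extend_class P' \<and> u \<in> carrier Q \<and> v \<in> carrier Q \<and>
      u \<otimes> s = v \<otimes> t \<and> u \<otimes> s \<noteq> \<zero>}"
  have F: "P \<oplus>\<^bsub>Frac R\<^esub> P' = \<Union>F" and F': "extend_class P \<oplus>\<^bsub>Frac Q\<^esub> extend_class P' = \<Union>F'"
    by (simp_all add: Frac_def F_def F'_def)
  have "\<exists>s\<in>carrier R. \<exists>a\<in>carrier R. T = frac R s a" if "T \<in> F" for T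
  proof -
    obtain s a t b u v where T: "T = frac R (u \<otimes>\<^bsub>R\<^esub> s) (u \<otimes>\<^bsub>R\<^esub> a \<oplus>\<^bsub>R\<^esub> v \<otimes>\<^bsub>R\<^esub> b)"
      and sa: "(s, a) \<in> P" and tb: "(t, b) \<in> P'" and uv: "u \<in> carrier R" "v \<in> carrier R"
      using \<open>T \<in> F\<close> unfolding F_def by blast
    have "u \<otimes>\<^bsub>R\<^esub> s \<in> carrier R" "u \<otimes>\<^bsub>R\<^esub> a \<oplus>\<^bsub>R\<^esub> v \<otimes>\<^bsub>R\<^esub> b \<in> carrier R"
      using mem_carriers[OF P sa] mem_carriers[OF P' tb] uv by (auto intro: R_mult R_add)
    then show ?thesis
      using T by blast
  qed
  then show ?ret
    unfolding F by (rule restrict_extend_class)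
  have "extend_class ` F = F'"
  proof (intro equalityI subsetI)
    fix T assume "T \<in> extend_class ` F"
    then obtain s a t b u v where T: "T = extend_class (frac R (u \<otimes>\<^bsub>R\<^esub> s) (u \<otimes>\<^bsub>R\<^esub> a \<oplus>\<^bsub>R\<^esub> v \<otimes>\<^bsub>R\<^esub> b))"
      and sa: "(s, a) \<in> P" and tb: "(t, b) \<in> P'" and uv: "u \<in> carrier R" "v \<in> carrier R"
      and eq: "u \<otimes>\<^bsub>R\<^esub> s = v \<otimes>\<^bsub>R\<^esub> t" "u \<otimes>\<^bsub>R\<^esub> s \<noteq> \<zero>\<^bsub>R\<^esub>"
      unfolding F_def by blast
    note m = mem_carriers[OF P sa] mem_carriers[OF P' tb] uv
    have "T = frac Q (\<eta> u \<otimes> \<eta> s) (\<eta> u \<otimes> \<eta> a \<oplus> \<eta> v \<otimes> \<eta> b)"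
      unfolding T using m by (simp add: extend_class_frac R_mult R_add \<eta>_mult \<eta>_add)
    moreover have "\<eta> u \<otimes> \<eta> s = \<eta> v \<otimes> \<eta> t"
      using m eq by (simp add: \<eta>_mult[symmetric])
    moreover have "\<eta> u \<otimes> \<eta> s \<noteq> \<zero>"
      using \<eta>_inj[OF R_mult[OF m(7,2)] R_zero] eq(2) \<eta>_zero \<eta>_mult[OF m(7,2)] by auto
    ultimately show "T \<in> F'"
      unfolding F'_def using extend_class_\<eta>[OF P sa] extend_class_\<eta>[OF P' tb]
        \<eta>_mem[OF uv(1)] \<eta>_mem[OF uv(2)] by blast
  next
    fix T assume "T \<in> F'"
    then obtain x y x' y' u v where T: "T = frac Q (u \<otimes> x) (u \<otimes> y \<oplus> v \<otimes> y')"
      and xy: "(x, y) \<in> extend_class P" and xy': "(x', y') \<in> extend_class P'"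
      and uv: "u \<in> carrier Q" "v \<in> carrier Q"
      and eq: "u \<otimes> x = v \<otimes> x'" "u \<otimes> x \<noteq> \<zero>"
      unfolding F'_def by blast
    obtain z s a t b p r where z: "z \<in> Units Q" and sa: "(s, a) \<in> P" and tb: "(t, b) \<in> P'"
      and pr: "p \<in> carrier R" "r \<in> carrier R"
      and ps: "\<eta> (p \<otimes>\<^bsub>R\<^esub> s) = z \<otimes> (u \<otimes> x)" and pa: "\<eta> (p \<otimes>\<^bsub>R\<^esub> a) = z \<otimes> (u \<otimes> y)"
      and rt: "\<eta> (r \<otimes>\<^bsub>R\<^esub> t) = z \<otimes> (v \<otimes> x')" and rb: "\<eta> (r \<otimes>\<^bsub>R\<^esub> b) = z \<otimes> (v \<otimes> y')"
      and Q: "x \<in> carrier Q" "y \<in> carrier Q" "x' \<in> carrier Q" "y' \<in> carrier Q"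
      by (rule common_denominator[OF P xy P' xy' uv])
    note m = mem_carriers[OF P sa] mem_carriers[OF P' tb]
    have eq': "p \<otimes>\<^bsub>R\<^esub> s = r \<otimes>\<^bsub>R\<^esub> t"
      using pr m ps rt eq by (intro \<eta>_inj) (auto intro: R_mult)
    have nz: "p \<otimes>\<^bsub>R\<^esub> s \<noteq> \<zero>\<^bsub>R\<^esub>"
      using ps eq(2) unit_cancel(2)[OF z, of "u \<otimes> x"] uv Q(1) \<eta>_zero by auto
    have sum: "\<eta> (p \<otimes>\<^bsub>R\<^esub> a \<oplus>\<^bsub>R\<^esub> r \<otimes>\<^bsub>R\<^esub> b) = z \<otimes> (u \<otimes> y \<oplus> v \<otimes> y')"
      using pr m uv Q z by (simp add: \<eta>_add R_mult pa rb Q.r_distr Q.Units_closed)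
    have "frac Q (\<eta> (p \<otimes>\<^bsub>R\<^esub> s)) (\<eta> (p \<otimes>\<^bsub>R\<^esub> a \<oplus>\<^bsub>R\<^esub> r \<otimes>\<^bsub>R\<^esub> b)) = T"
      unfolding ps sum T using uv Q by (intro frac_unit[OF z]) auto
    then have "T = extend_class (frac R (p \<otimes>\<^bsub>R\<^esub> s) (p \<otimes>\<^bsub>R\<^esub> a \<oplus>\<^bsub>R\<^esub> r \<otimes>\<^bsub>R\<^esub> b))"
      using pr m by (simp add: extend_class_frac R_mult R_add)
    moreover have "frac R (p \<otimes>\<^bsub>R\<^esub> s) (p \<otimes>\<^bsub>R\<^esub> a \<oplus>\<^bsub>R\<^esub> r \<otimes>\<^bsub>R\<^esub> b) \<in> F"
      unfolding F_def using sa tb pr eq' nz by blast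
    ultimately show "T \<in> extend_class ` F"
      by blast
  qed
  then show ?add
    unfolding F F' extend_class_Union by simp
qed

lemma extend_class_smult:
  assumes P: "P \<in> carrier (Frac R)"
  shows "extend_class (c \<odot>\<^bsub>Frac R\<^esub> P) = c \<odot>\<^bsub>Frac Q\<^esub> extend_class P" (is ?smult)
    and "restrict_class (extend_class (c \<odot>\<^bsub>Frac R\<^esub> P)) = c \<odot>\<^bsub>Frac R\<^esub> P" (is ?ret)
proof -
  define F where "F = {frac R s (c \<odot>\<^bsub>R\<^esub> a) | s a. (s, a) \<in> P}"
  define F' where "F' = {frac Q s (c \<odot> a) | s a. (s, a) \<in> extend_class P}"
  have F: "c \<odot>\<^bsub>Frac R\<^esub> P = \<Union>F" and F': "c \<odot>\<^bsub>Frac Q\<^esub> extend_class P = \<Union>F'"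
    by (simp_all add: Frac_def F_def F'_def)
  have "\<exists>s\<in>carrier R. \<exists>a\<in>carrier R. T = frac R s a" if "T \<in> F" for T
    using that mem_carriers[OF P] R_smult unfolding F_def by blast
  then show ?ret
    unfolding F by (rule restrict_extend_class)
  have "extend_class ` F = F'"
  proof (intro equalityI subsetI)
    fix T assume "T \<in> extend_class ` F"
    then obtain s a where T: "T = extend_class (frac R s (c \<odot>\<^bsub>R\<^esub> a))" and sa: "(s, a) \<in> P"
      unfolding F_def by blast
    have "T = frac Q (\<eta> s) (c \<odot> \<eta> a)"
      unfolding T using mem_carriers[OF P sa] by (simp add: extend_class_frac R_smult \<eta>_smult)
    then show "T \<in> F'"
      unfolding F'_def using extend_class_\<eta>[OF P sa] by blast
  next
    fix T assume "T \<in> F'"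
    then obtain x y where T: "T = frac Q x (c \<odot> y)" and xy: "(x, y) \<in> extend_class P"
      unfolding F'_def by blast
    obtain w s a where w: "w \<in> Units Q" "(s, a) \<in> P" "x \<in> carrier Q" "y \<in> carrier Q"
      "w \<otimes> x = \<eta> s" "w \<otimes> y = \<eta> a" "s \<in> carrier R" "a \<in> carrier R"
      by (rule extend_class_mem[OF P xy])
    have "frac Q (\<eta> s) (\<eta> (c \<odot>\<^bsub>R\<^esub> a)) = T"
      using frac_unit[OF w(1,3) Q_smult[OF w(4)], of c] Q_smult_mult[of w y c] w
      by (simp add: T \<eta>_smult Q.Units_closed)
    then have "T = extend_class (frac R s (c \<odot>\<^bsub>R\<^esub> a))"
      using w by (simp add: extend_class_frac R_smult)
    then show "T \<in> extend_class ` F"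
      unfolding F_def using w(2) by blast
  qed
  then show ?smult
    unfolding F F' extend_class_Union by simp
qed

lemma extend_class_one: "extend_class \<one>\<^bsub>Frac R\<^esub> = \<one>\<^bsub>Frac Q\<^esub>"
  by (simp add: Frac_def extend_class_frac R_one \<eta>_one)

lemma restrict_class_extend: "P \<in> carrier (Frac R) \<Longrightarrow> restrict_class (extend_class P) = P"
  by (auto simp: extend_class_frac restrict_class_frac elim!: Frac_carrierE)

lemma restrict_class_one: "restrict_class \<one>\<^bsub>Frac Q\<^esub> = \<one>\<^bsub>Frac R\<^esub>"
  using restrict_class_frac[OF R_one R_one] by (simp add: Frac_def \<eta>_one)

lemma restrict_class_bij: "bij_betw restrict_class (carrier (Frac Q)) (carrier (Frac R))"
proof -
  have "inv_into (carrier (Frac R)) extend_class T = restrict_class T" if T: "T \<in> carrier (Frac Q)" for T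
  proof -
    obtain P where "P \<in> carrier (Frac R)" "T = extend_class P"
      using T extend_class_bij unfolding bij_betw_def by blast
    then show ?thesis
      using bij_betw_inv_into_left[OF extend_class_bij] restrict_class_extend by simp
  qed
  then show ?thesis
    using bij_betw_cong[of "carrier (Frac Q)" "inv_into (carrier (Frac R)) extend_class" restrict_class]
      bij_betw_inv_into[OF extend_class_bij] by blast
qed

end

text \<open>Both fraction rings are copies of \<open>Frac Q\<close>. Going up along one embedding
  and down along the other respects the operations because restriction undoes extension on sums and
  products too.\<close>

lemma Frac_isomorphic_of_embeddings:
  assumes "frac_embedding R Q \<eta>" "frac_embedding R' Q \<eta>'"
  shows "alg_isomorphic (Frac R) (Frac R')"
proof -
  interpret A: frac_embedding R Q \<eta>
    by fact
  interpret B: frac_embedding R' Q \<eta>'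
    by fact
  let ?f = "\<lambda>P. B.restrict_class (A.extend_class P)"
  have bij: "bij_betw ?f (carrier (Frac R)) (carrier (Frac R'))"
    using bij_betw_trans[OF A.extend_class_bij B.restrict_class_bij] by (simp add: comp_def)
  have B: "\<exists>P'\<in>carrier (Frac R'). A.extend_class P = B.extend_class P' \<and> ?f P = P'"
    if "P \<in> carrier (Frac R)" for P
  proof -
    have "A.extend_class P \<in> B.extend_class ` carrier (Frac R')"
      using that A.extend_class_bij B.extend_class_bij unfolding bij_betw_def by blast
    then show ?thesis
      using B.restrict_class_extend by auto
  qed
  have "?f \<in> ring_iso (Frac R) (Frac R')"
    unfolding ring_iso_def
  proof (intro CollectI conjI bij ring_hom_memI)
    show "?f P \<in> carrier (Frac R')" if "P \<in> carrier (Frac R)" for P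
      using bij that unfolding bij_betw_def by blast
    show "?f (P \<otimes>\<^bsub>Frac R\<^esub> P') = ?f P \<otimes>\<^bsub>Frac R'\<^esub> ?f P'"
      if "P \<in> carrier (Frac R)" "P' \<in> carrier (Frac R)" for P P'
      using B[OF that(1)] B[OF that(2)] A.extend_class_mult(1)[OF that] B.extend_class_mult by metis
    show "?f (P \<oplus>\<^bsub>Frac R\<^esub> P') = ?f P \<oplus>\<^bsub>Frac R'\<^esub> ?f P'"
      if "P \<in> carrier (Frac R)" "P' \<in> carrier (Frac R)" for P P'
      using B[OF that(1)] B[OF that(2)] A.extend_class_add(1)[OF that] B.extend_class_add by metis
    show "?f \<one>\<^bsub>Frac R\<^esub> = \<one>\<^bsub>Frac R'\<^esub>"
      by (simp add: A.extend_class_one B.restrict_class_one)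
  qed
  moreover have "?f (c \<odot>\<^bsub>Frac R\<^esub> P) = c \<odot>\<^bsub>Frac R'\<^esub> ?f P" if "P \<in> carrier (Frac R)" for c P
    using B[OF that] A.extend_class_smult(1)[OF that] B.extend_class_smult by metis
  ultimately show ?thesis
    unfolding alg_isomorphic_def by (intro bexI[of _ ?f] allI ballI)
qed

section \<open>Differential operators on a field\<close>

text \<open>Operators are made total by the value 0 outside \<open>L\<close>, so that operators
  equal on \<open>L\<close> are equal functions. Composition respects this because additive
  operators vanish at 0.\<close>

definition field_ops :: "'k::field set \<Rightarrow> (complex \<Rightarrow> 'k) \<Rightarrow> (complex, 'k \<Rightarrow> 'k) module" where
  "field_ops L \<iota> =
     \<lparr>carrier = {q. (\<forall>x. x \<notin> L \<longrightarrow> q x = 0) \<and> (\<forall>x\<in>L. q x \<in> L) \<and> additive_on L q \<and>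
        (\<forall>c. \<forall>x\<in>L. q (\<iota> c * x) = \<iota> c * q x) \<and> (\<exists>n. diff_ord L L n q)},
      mult = (\<lambda>p q x. p (q x)),
      one = (\<lambda>x. if x \<in> L then x else 0),
      ring.zero = (\<lambda>x. 0),
      add = (\<lambda>p q x. p x + q x),
      smult = (\<lambda>c q x. \<iota> c * q x)\<rparr>"

lemma field_ops_simps [simp]:
  "p \<otimes>\<^bsub>field_ops L \<iota>\<^esub> q = (\<lambda>x. p (q x))"
  "\<one>\<^bsub>field_ops L \<iota>\<^esub> = (\<lambda>x. if x \<in> L then x else 0)"
  "\<zero>\<^bsub>field_ops L \<iota>\<^esub> = (\<lambda>x. 0)"
  "p \<oplus>\<^bsub>field_ops L \<iota>\<^esub> q = (\<lambda>x. p x + q x)"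
  "c \<odot>\<^bsub>field_ops L \<iota>\<^esub> q = (\<lambda>x. \<iota> c * q x)"
  by (simp_all add: field_ops_def)

lemma field_ops_carrier:
  "q \<in> carrier (field_ops L \<iota>) \<longleftrightarrow> (\<forall>x. x \<notin> L \<longrightarrow> q x = 0) \<and> (\<forall>x\<in>L. q x \<in> L) \<and> additive_on L q \<and>
    (\<forall>c. \<forall>x\<in>L. q (\<iota> c * x) = \<iota> c * q x) \<and> (\<exists>n. diff_ord L L n q)"
  by (simp add: field_ops_def)

locale field_operators = subring_set L for L :: "'k::field set" +
  fixes \<iota> :: "complex \<Rightarrow> 'k"
  assumes inverse_mem: "x \<in> L \<Longrightarrow> inverse x \<in> L"
    and \<iota>_mem: "\<iota> c \<in> L"
begin

interpretation LL: operator_domain L L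
  by (rule operator_domain_self)

lemma mult_left_mem:
  assumes "m \<in> L"
  shows "(\<lambda>x. if x \<in> L then m * x else 0) \<in> carrier (field_ops L \<iota>)"
proof -
  have "diff_ord L L 1 (\<lambda>x. if x \<in> L then m * x else 0)"
    by (simp add: ad_def mult_mem)
  then show ?thesis
    using assms unfolding field_ops_carrier
    by (auto simp: additive_on_def mult_mem add_mem \<iota>_mem algebra_simps
        simp del: diff_ord.simps intro: exI[of _ "Suc 0"])
qed

lemma field_ops_one_closed: "(\<lambda>x. if x \<in> L then x else 0) \<in> carrier (field_ops L \<iota>)"
  using mult_left_mem[OF one_mem] by (simp cong: if_cong)

lemma field_ops_mult_closed:
  assumes p: "p \<in> carrier (field_ops L \<iota>)" and q: "q \<in> carrier (field_ops L \<iota>)"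
  shows "(\<lambda>x. p (q x)) \<in> carrier (field_ops L \<iota>)"
proof -
  obtain n m where nm: "diff_ord L L n p" "diff_ord L L m q"
    using p q unfolding field_ops_carrier by blast
  have "diff_ord L L (n + m) (\<lambda>x. p (q x))"
    using p q nm unfolding field_ops_carrier by (intro diff_ord_compose) auto
  moreover have "p 0 = 0"
    using p additive_zero unfolding field_ops_carrier by blast
  ultimately show ?thesis
    using p q unfolding field_ops_carrier additive_on_def by auto
qed

lemma field_ops_add_closed:
  assumes p: "p \<in> carrier (field_ops L \<iota>)" and q: "q \<in> carrier (field_ops L \<iota>)"
  shows "(\<lambda>x. p x + q x) \<in> carrier (field_ops L \<iota>)"
proof -
  obtain n m where nm: "diff_ord L L n p" "diff_ord L L m q"
    using p q unfolding field_ops_carrier by blast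
  then have "diff_ord L L (max n m) (\<lambda>x. p x + q x)"
    by (intro LL.diff_ord_plus; elim LL.diff_ord_le) auto
  then show ?thesis
    using p q unfolding field_ops_carrier additive_on_def by (auto simp: algebra_simps add_mem)
qed

lemma field_ops_smult_closed:
  assumes q: "q \<in> carrier (field_ops L \<iota>)"
  shows "(\<lambda>x. \<iota> c * q x) \<in> carrier (field_ops L \<iota>)"
proof -
  obtain n where "diff_ord L L n q"
    using q unfolding field_ops_carrier by blast
  then have "diff_ord L L n (\<lambda>x. \<iota> c * q x)"
    by (rule LL.diff_ord_scale)
  then show ?thesis
    using q \<iota>_mem unfolding field_ops_carrier additive_on_def by (auto simp: algebra_simps mult_mem)
qed

lemma field_ops_zero_closed: "(\<lambda>x. 0) \<in> carrier (field_ops L \<iota>)"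
  unfolding field_ops_carrier using LL.diff_ord_zero zero_mem by (auto simp: additive_on_def)

lemma ring_field_ops: "ring (field_ops L \<iota>)"
proof (intro ringI abelian_groupI monoidI, goal_cases)
  \<comment> \<open>The goals treated apart are additive inverses (6), distributivity of an operator
    over a sum (13) and the unit laws (10, 11); the last three involve the value 0 outside
    \<open>L\<close>.\<close>
  case (6 p)
  have "(\<lambda>x. - p x) \<in> carrier (field_ops L \<iota>)"
  proof -
    obtain n where "diff_ord L L n p"
      using 6 unfolding field_ops_carrier by blast
    then have "diff_ord L L n (\<lambda>x. - 1 * p x)"
      by (rule LL.diff_ord_scale)
    then show ?thesis
      using 6 unfolding field_ops_carrier additive_on_def by (auto simp: uminus_mem)
  qed
  then show ?case
    by (intro bexI[of _ "\<lambda>x. - p x"]) simp_all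
next
  case (13 p q r)
  have "r (p x + q x) = r (p x) + r (q x)" for x
  proof (cases "x \<in> L")
    case True
    then show ?thesis
      using 13 unfolding field_ops_carrier additive_on_def by auto
  next
    case False
    have "r 0 = 0"
      using 13 additive_zero unfolding field_ops_carrier by blast
    with False show ?thesis
      using 13 unfolding field_ops_carrier by auto
  qed
  then show ?case
    by simp
next
  case (10 p)
  have "(if p x \<in> L then p x else 0) = p x" for x
    using 10 unfolding field_ops_carrier by (cases "x \<in> L") auto
  then show ?case
    by simp
next
  case (11 p)
  have "p 0 = 0"
    using 11 additive_zero unfolding field_ops_carrier by blast
  then have "p (if x \<in> L then x else 0) = p x" for x
    using 11 unfolding field_ops_carrier by auto
  then show ?case
    by simp
qed (simp_all add: field_ops_mult_closed field_ops_add_closed field_ops_zero_closed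
    field_ops_one_closed algebra_simps)

lemma mult_left_Units:
  assumes "m \<in> L" "m \<noteq> 0"
  shows "(\<lambda>x. if x \<in> L then m * x else 0) \<in> Units (field_ops L \<iota>)"
  unfolding Units_def using assms inverse_mem[OF assms(1)] mult_left_mem
  by (auto simp: fun_eq_iff mult_mem mult.assoc[symmetric]
      intro!: bexI[of _ "\<lambda>x. if x \<in> L then inverse m * x else 0"])

end

section \<open>Algebras embedded in a field\<close>

lemma (in operator_domain) diff_ord_cong_iff:
  "(\<And>x. x \<in> S \<Longrightarrow> d x = d' x) \<Longrightarrow> diff_ord S Y n d \<longleftrightarrow> diff_ord S Y n d'"
  using diff_ord_cong[of d d' n] diff_ord_cong[of d' d n] by auto

text \<open>An algebra given by a record is moved along \<open>ev\<close> into the ambient field,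
  where the order calculus applies; by injectivity, equations can be checked there.\<close>

locale embedded_algebra = cring M for M :: "(complex, 'a, 'm) module_scheme" (structure) +
  fixes ev :: "'a \<Rightarrow> 'k::field" and \<iota> :: "complex \<Rightarrow> 'k"
  assumes ev_inj: "x \<in> carrier M \<Longrightarrow> y \<in> carrier M \<Longrightarrow> ev x = ev y \<Longrightarrow> x = y"
    and ev_add: "x \<in> carrier M \<Longrightarrow> y \<in> carrier M \<Longrightarrow> ev (x \<oplus> y) = ev x + ev y"
    and ev_mult: "x \<in> carrier M \<Longrightarrow> y \<in> carrier M \<Longrightarrow> ev (x \<otimes> y) = ev x * ev y"
    and ev_one: "ev \<one> = 1"
    and M_smult: "x \<in> carrier M \<Longrightarrow> c \<odot> x \<in> carrier M"
    and ev_smult: "x \<in> carrier M \<Longrightarrow> ev (c \<odot> x) = \<iota> c * ev x"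
begin

text \<open>Meaningful only on the image of \<open>ev\<close>, since \<open>inv_into\<close> is
  arbitrary elsewhere.\<close>

definition transport :: "('a \<Rightarrow> 'a) \<Rightarrow> 'k \<Rightarrow> 'k" where
  "transport d = (\<lambda>x. ev (d (inv_into (carrier M) ev x)))"

lemma ev_inv_into: "x \<in> carrier M \<Longrightarrow> inv_into (carrier M) ev (ev x) = x"
  using ev_inj by (intro inv_into_f_f inj_onI)

lemma transport_ev: "x \<in> carrier M \<Longrightarrow> transport d (ev x) = ev (d x)"
  by (simp add: transport_def ev_inv_into)

lemma ev_zero: "ev \<zero> = 0"
  using ev_add[OF zero_closed zero_closed] add_left_cancel[of "ev \<zero>" "ev \<zero>" 0] by simp

lemma ev_minus:
  assumes "x \<in> carrier M" "y \<in> carrier M"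
  shows "ev (x \<ominus> y) = ev x - ev y"
proof -
  have "ev y + ev (\<ominus> y) = 0"
    using assms ev_add[of y "\<ominus> y"] ev_zero by (simp add: r_neg)
  then have "ev (\<ominus> y) = - ev y"
    by (simp add: eq_neg_iff_add_eq_0 add.commute)
  then show ?thesis
    using assms by (simp add: a_minus_def ev_add)
qed

lemma subring_set_image: "subring_set (ev ` carrier M)"
proof
  show "1 \<in> ev ` carrier M"
    using ev_one by (metis image_eqI one_closed)
  fix x y assume "x \<in> ev ` carrier M" "y \<in> ev ` carrier M"
  then obtain a b where ab: "a \<in> carrier M" "b \<in> carrier M" "x = ev a" "y = ev b"
    by blast
  show "x - y \<in> ev ` carrier M" "x * y \<in> ev ` carrier M"
    unfolding ab(3,4) using ab(1,2) ev_minus[OF ab(1,2)] ev_mult[OF ab(1,2)]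
    by (metis image_eqI minus_closed m_closed)+
qed

interpretation A: subring_set "ev ` carrier M"
  by (rule subring_set_image)

interpretation AA: operator_domain "ev ` carrier M" "ev ` carrier M"
  by (rule A.operator_domain_self)

section \<open>Operators on the algebra and on its image\<close>

lemma lin_endosD:
  assumes "d \<in> lin_endos M"
  shows "f \<in> carrier M \<Longrightarrow> d f \<in> carrier M"
    and "f \<in> carrier M \<Longrightarrow> g \<in> carrier M \<Longrightarrow> d (f \<oplus> g) = d f \<oplus> d g"
    and "f \<in> carrier M \<Longrightarrow> d (c \<odot> f) = c \<odot> d f"
    and "d \<in> extensional (carrier M)"
  using assms unfolding lin_endos_def PiE_def by auto

lemma lin_endosI:
  assumes "\<And>f. f \<in> carrier M \<Longrightarrow> D f \<in> carrier M"
    and "\<And>f g. f \<in> carrier M \<Longrightarrow> g \<in> carrier M \<Longrightarrow> ev (D (f \<oplus> g)) = ev (D f) + ev (D g)"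
    and "\<And>f c. f \<in> carrier M \<Longrightarrow> ev (D (c \<odot> f)) = \<iota> c * ev (D f)"
  shows "(\<lambda>f\<in>carrier M. D f) \<in> lin_endos M"
  unfolding lin_endos_def
proof (intro CollectI conjI ballI allI)
  show "(\<lambda>f\<in>carrier M. D f) \<in> carrier M \<rightarrow>\<^sub>E carrier M"
    using assms(1) by auto
  show "(\<lambda>f\<in>carrier M. D f) (f \<oplus> g) = (\<lambda>f\<in>carrier M. D f) f \<oplus> (\<lambda>f\<in>carrier M. D f) g"
    if "f \<in> carrier M" "g \<in> carrier M" for f g
    using that assms(1,2) by (auto intro!: ev_inj simp: ev_add)
  show "(\<lambda>f\<in>carrier M. D f) (c \<odot> f) = c \<odot> (\<lambda>f\<in>carrier M. D f) f" if "f \<in> carrier M" for f c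
    using that assms(1,3) by (auto intro!: ev_inj M_smult simp: ev_smult M_smult)
qed

lemma transport_lin:
  assumes "d \<in> lin_endos M"
  shows "additive_on (ev ` carrier M) (transport d)"
    and "x \<in> ev ` carrier M \<Longrightarrow> transport d x \<in> ev ` carrier M"
    and "x \<in> ev ` carrier M \<Longrightarrow> transport d (\<iota> c * x) = \<iota> c * transport d x"
proof -
  show "additive_on (ev ` carrier M) (transport d)"
    unfolding additive_on_def using lin_endosD[OF assms]
    by (auto simp: ev_add[symmetric] transport_ev)
  show "transport d x \<in> ev ` carrier M" if "x \<in> ev ` carrier M"
    using that lin_endosD[OF assms] by (auto simp: transport_ev)
  show "transport d (\<iota> c * x) = \<iota> c * transport d x" if "x \<in> ev ` carrier M"
    using that lin_endosD[OF assms] by (auto simp: ev_smult[symmetric] M_smult transport_ev)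
qed

lemma lin_endos_commutator:
  assumes d: "d \<in> lin_endos M" and b: "b \<in> carrier M"
  defines "D \<equiv> \<lambda>f\<in>carrier M. d (b \<otimes> f) \<ominus> b \<otimes> d f"
  shows "D \<in> lin_endos M" "x \<in> ev ` carrier M \<Longrightarrow> transport D x = ad (ev b) (transport d) x"
proof -
  have ev: "ev (d (b \<otimes> f) \<ominus> b \<otimes> d f) = ad (ev b) (transport d) (ev f)" if "f \<in> carrier M" for f
    using that b lin_endosD(1)[OF d] transport_ev[of "b \<otimes> f" d]
    by (simp add: ev_minus ev_mult ad_def transport_ev)
  have add: "additive_on (ev ` carrier M) (ad (ev b) (transport d))"
    using A.additive_on_ad transport_lin(1)[OF d] b by blast
  show "D \<in> lin_endos M"
    unfolding D_def
  proof (rule lin_endosI)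
    show "d (b \<otimes> f) \<ominus> b \<otimes> d f \<in> carrier M" if "f \<in> carrier M" for f
      using that b lin_endosD(1)[OF d] by simp
    show "ev (d (b \<otimes> (f \<oplus> g)) \<ominus> b \<otimes> d (f \<oplus> g)) =
        ev (d (b \<otimes> f) \<ominus> b \<otimes> d f) + ev (d (b \<otimes> g) \<ominus> b \<otimes> d g)"
      if "f \<in> carrier M" "g \<in> carrier M" for f g
      using that add by (simp add: ev ev_add additive_on_def)
    show "ev (d (b \<otimes> (c \<odot> f)) \<ominus> b \<otimes> d (c \<odot> f)) =
        \<iota> c * ev (d (b \<otimes> f) \<ominus> b \<otimes> d f)" if f: "f \<in> carrier M" for f c
    proof -
      have "ev b * ev f \<in> ev ` carrier M"
        using b f A.mult_mem by blast
      then have "transport d (ev b * (\<iota> c * ev f)) = \<iota> c * transport d (ev b * ev f)"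
        using transport_lin(3)[OF d] by (simp add: mult.left_commute)
      then show ?thesis
        using f transport_lin(3)[OF d, of "ev f" c] by (simp add: ev M_smult ev_smult ad_def algebra_simps)
    qed
  qed
  show "transport D x = ad (ev b) (transport d) x" if "x \<in> ev ` carrier M"
    using that ev by (auto simp: transport_ev D_def)
qed

text \<open>The shift of the index comes from the base case: an endomorphism that commutes with all
  multiplications is multiplication by its value at the unit, so order 0 corresponds to index
  1.\<close>

lemma diff_ops_upto_iff:
  "d \<in> diff_ops_upto M n \<longleftrightarrow> d \<in> lin_endos M \<and> diff_ord (ev ` carrier M) (ev ` carrier M) (Suc n) (transport d)"
proof (induction n arbitrary: d)
  case 0
  show ?case
  proof
    assume "d \<in> diff_ops_upto M 0"
    then obtain a where a: "a \<in> carrier M" and d: "d = (\<lambda>f\<in>carrier M. a \<otimes> f)"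
      by auto
    have "d \<in> lin_endos M"
      unfolding d using a by (intro lin_endosI) (auto simp: ev_mult ev_add ev_smult M_smult algebra_simps)
    moreover have "transport d x = ev a * x" if "x \<in> ev ` carrier M" for x
      using that a by (auto simp: transport_ev d ev_mult)
    ultimately show "d \<in> lin_endos M \<and> diff_ord (ev ` carrier M) (ev ` carrier M) (Suc 0) (transport d)"
      using A.mult_mem by (simp add: ad_def)
  next
    assume d: "d \<in> lin_endos M \<and> diff_ord (ev ` carrier M) (ev ` carrier M) (Suc 0) (transport d)"
    have "d f = (\<lambda>f\<in>carrier M. d \<one> \<otimes> f) f" for f
    proof (cases "f \<in> carrier M")
      case True
      have "ad (ev f) (transport d) (ev \<one>) = 0"
        using d True by auto
      then have "ev (d f) = ev (d \<one> \<otimes> f)"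
        using True d lin_endosD(1) transport_ev[OF True, of d] transport_ev[OF one_closed, of d]
        by (simp add: ad_def ev_one ev_mult mult.commute)
      then show ?thesis
        using True d lin_endosD(1) by (simp add: ev_inj)
    next
      case False
      then show ?thesis
        using d lin_endosD(4)[of d] by (simp add: extensional_def)
    qed
    then have "d = (\<lambda>f\<in>carrier M. d \<one> \<otimes> f)"
      by (rule ext)
    moreover have "d \<one> \<in> carrier M"
      using d lin_endosD(1) by blast
    ultimately show "d \<in> diff_ops_upto M 0"
      by auto
  qed
next
  case (Suc n)
  have "(\<lambda>f\<in>carrier M. d (b \<otimes> f) \<ominus> b \<otimes> d f) \<in> diff_ops_upto M n \<longleftrightarrow>
      diff_ord (ev ` carrier M) (ev ` carrier M) (Suc n) (ad (ev b) (transport d))"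
    if "d \<in> lin_endos M" "b \<in> carrier M" for b
  proof -
    let ?D = "\<lambda>f\<in>carrier M. d (b \<otimes> f) \<ominus> b \<otimes> d f"
    have "diff_ord (ev ` carrier M) (ev ` carrier M) (Suc n) (transport ?D) \<longleftrightarrow>
        diff_ord (ev ` carrier M) (ev ` carrier M) (Suc n) (ad (ev b) (transport d))"
      by (rule AA.diff_ord_cong_iff) (rule lin_endos_commutator(2)[OF that])
    then show ?thesis
      unfolding Suc.IH using lin_endos_commutator(1)[OF that] by blast
  qed
  then show ?case
    by (simp only: diff_ops_upto.simps diff_ord.simps(2)[of _ _ "Suc n"] mem_Collect_eq ball_simps) blast
qed

lemma carrier_diff_op_alg:
  "d \<in> carrier (diff_op_alg M) \<longleftrightarrow>
    d \<in> lin_endos M \<and> (\<exists>n. diff_ord (ev ` carrier M) (ev ` carrier M) n (transport d))"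
proof -
  have "(\<exists>n. diff_ord (ev ` carrier M) (ev ` carrier M) (Suc n) (transport d)) \<longleftrightarrow>
      (\<exists>n. diff_ord (ev ` carrier M) (ev ` carrier M) n (transport d))"
    using AA.diff_ord_Suc by blast
  then show ?thesis
    by (simp add: diff_op_alg_def diff_ops_upto_iff)
qed

lemma diff_op_alg_mult_closed:
  assumes d: "d \<in> carrier (diff_op_alg M)" and d': "d' \<in> carrier (diff_op_alg M)"
  shows "compose (carrier M) d d' \<in> carrier (diff_op_alg M)"
    and "x \<in> ev ` carrier M \<Longrightarrow> transport (compose (carrier M) d d') x = transport d (transport d' x)"
proof -
  have l: "d \<in> lin_endos M" "d' \<in> lin_endos M"
    using d d' carrier_diff_op_alg by auto
  show tr: "transport (compose (carrier M) d d') x = transport d (transport d' x)" if x: "x \<in> ev ` carrier M" for x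
  proof -
    obtain f where f: "f \<in> carrier M" "x = ev f"
      using x by blast
    then have "d' f \<in> carrier M"
      using lin_endosD(1)[OF l(2)] by blast
    then show ?thesis
      unfolding f(2) using f(1) by (simp add: transport_ev compose_eq)
  qed
  obtain n m where "diff_ord (ev ` carrier M) (ev ` carrier M) n (transport d)"
    "diff_ord (ev ` carrier M) (ev ` carrier M) m (transport d')"
    using d d' carrier_diff_op_alg by blast
  then have "diff_ord (ev ` carrier M) (ev ` carrier M) (n + m) (\<lambda>x. transport d (transport d' x))"
    using transport_lin l by (intro A.diff_ord_compose) auto
  then have "diff_ord (ev ` carrier M) (ev ` carrier M) (n + m) (transport (compose (carrier M) d d'))"
    by (rule AA.diff_ord_cong[rotated]) (simp add: tr)
  moreover have "compose (carrier M) d d' \<in> lin_endos M"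
    unfolding compose_def using lin_endosD[OF l(1)] lin_endosD[OF l(2)]
    by (intro lin_endosI) (simp_all add: ev_add ev_smult)
  ultimately show "compose (carrier M) d d' \<in> carrier (diff_op_alg M)"
    using carrier_diff_op_alg by blast
qed

lemma diff_op_alg_add_closed:
  assumes d: "d \<in> carrier (diff_op_alg M)" and d': "d' \<in> carrier (diff_op_alg M)"
  shows "(\<lambda>f\<in>carrier M. d f \<oplus> d' f) \<in> carrier (diff_op_alg M)"
    and "x \<in> ev ` carrier M \<Longrightarrow> transport (\<lambda>f\<in>carrier M. d f \<oplus> d' f) x = transport d x + transport d' x"
proof -
  have l: "d \<in> lin_endos M" "d' \<in> lin_endos M"
    using d d' carrier_diff_op_alg by auto
  show tr: "transport (\<lambda>f\<in>carrier M. d f \<oplus> d' f) x = transport d x + transport d' x"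
    if x: "x \<in> ev ` carrier M" for x
  proof -
    obtain f where f: "f \<in> carrier M" "x = ev f"
      using x by blast
    then have "d f \<in> carrier M" "d' f \<in> carrier M"
      using lin_endosD(1)[OF l(1)] lin_endosD(1)[OF l(2)] by blast+
    then show ?thesis
      unfolding f(2) using f(1) by (simp add: transport_ev ev_add)
  qed
  obtain n m where "diff_ord (ev ` carrier M) (ev ` carrier M) n (transport d)"
    "diff_ord (ev ` carrier M) (ev ` carrier M) m (transport d')"
    using d d' carrier_diff_op_alg by blast
  then have "diff_ord (ev ` carrier M) (ev ` carrier M) (max n m) (\<lambda>x. transport d x + transport d' x)"
    by (intro AA.diff_ord_plus; elim AA.diff_ord_le) auto
  then have "diff_ord (ev ` carrier M) (ev ` carrier M) (max n m) (transport (\<lambda>f\<in>carrier M. d f \<oplus> d' f))"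
    by (rule AA.diff_ord_cong[rotated]) (simp add: tr)
  moreover have "(\<lambda>f\<in>carrier M. d f \<oplus> d' f) \<in> lin_endos M"
    using lin_endosD[OF l(1)] lin_endosD[OF l(2)]
    by (intro lin_endosI) (simp_all add: ev_add ev_smult M_smult algebra_simps)
  ultimately show "(\<lambda>f\<in>carrier M. d f \<oplus> d' f) \<in> carrier (diff_op_alg M)"
    using carrier_diff_op_alg by blast
qed

lemma diff_op_alg_smult_closed:
  assumes d: "d \<in> carrier (diff_op_alg M)"
  shows "(\<lambda>f\<in>carrier M. c \<odot> d f) \<in> carrier (diff_op_alg M)"
    and "x \<in> ev ` carrier M \<Longrightarrow> transport (\<lambda>f\<in>carrier M. c \<odot> d f) x = \<iota> c * transport d x"
proof -
  have l: "d \<in> lin_endos M"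
    using d carrier_diff_op_alg by auto
  show tr: "transport (\<lambda>f\<in>carrier M. c \<odot> d f) x = \<iota> c * transport d x"
    if x: "x \<in> ev ` carrier M" for x
  proof -
    obtain f where f: "f \<in> carrier M" "x = ev f"
      using x by blast
    then have "d f \<in> carrier M"
      using lin_endosD(1)[OF l] by blast
    then show ?thesis
      unfolding f(2) using f(1) by (simp add: transport_ev ev_smult)
  qed
  obtain n where "diff_ord (ev ` carrier M) (ev ` carrier M) n (transport d)"
    using d carrier_diff_op_alg by blast
  then have "diff_ord (ev ` carrier M) (ev ` carrier M) n (\<lambda>x. \<iota> c * transport d x)"
    by (rule AA.diff_ord_scale)
  then have "diff_ord (ev ` carrier M) (ev ` carrier M) n (transport (\<lambda>f\<in>carrier M. c \<odot> d f))"
    by (rule AA.diff_ord_cong[rotated]) (simp add: tr)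
  moreover have "(\<lambda>f\<in>carrier M. c \<odot> d f) \<in> lin_endos M"
    using lin_endosD[OF l]
    by (intro lin_endosI) (simp_all add: ev_add ev_smult M_smult algebra_simps)
  ultimately show "(\<lambda>f\<in>carrier M. c \<odot> d f) \<in> carrier (diff_op_alg M)"
    using carrier_diff_op_alg by blast
qed

lemma diff_op_of_field_op:
  assumes "additive_on (ev ` carrier M) D" "diff_ord (ev ` carrier M) (ev ` carrier M) n D"
    and D: "\<And>x. x \<in> ev ` carrier M \<Longrightarrow> D x \<in> ev ` carrier M"
    and "\<And>x c. x \<in> ev ` carrier M \<Longrightarrow> D (\<iota> c * x) = \<iota> c * D x"
  obtains d where "d \<in> carrier (diff_op_alg M)" "\<forall>f\<in>carrier M. ev (d f) = D (ev f)"
proof -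
  define d where "d = (\<lambda>f\<in>carrier M. inv_into (carrier M) ev (D (ev f)))"
  have d: "inv_into (carrier M) ev (D (ev f)) \<in> carrier M" "ev (inv_into (carrier M) ev (D (ev f))) = D (ev f)"
    if "f \<in> carrier M" for f
    using D[of "ev f"] that by (auto intro: inv_into_into f_inv_into_f)
  have ev_d: "ev (d f) = D (ev f)" if "f \<in> carrier M" for f
    using d that by (simp add: d_def)
  have "d \<in> lin_endos M"
    unfolding d_def
  proof (rule lin_endosI)
    fix f g c assume f: "f \<in> carrier M"
    show "ev (inv_into (carrier M) ev (D (ev (c \<odot> f)))) = \<iota> c * ev (inv_into (carrier M) ev (D (ev f)))"
      unfolding d(2)[OF M_smult[OF f]] d(2)[OF f] using f assms(4) by (simp add: ev_smult)
    assume g: "g \<in> carrier M"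
    show "ev (inv_into (carrier M) ev (D (ev (f \<oplus> g)))) =
        ev (inv_into (carrier M) ev (D (ev f))) + ev (inv_into (carrier M) ev (D (ev g)))"
      unfolding d(2)[OF a_closed[OF f g]] d(2)[OF f] d(2)[OF g]
      using f g assms(1) by (simp add: ev_add additive_on_def)
  qed (rule d(1))
  moreover have "diff_ord (ev ` carrier M) (ev ` carrier M) n (transport d)"
    by (rule AA.diff_ord_cong[OF _ assms(2)]) (auto simp: transport_ev ev_d)
  ultimately show thesis
    using that[of d] ev_d carrier_diff_op_alg by blast
qed

end

section \<open>Operators preserving the invariants\<close>

locale embedded_action =
  embedded_algebra M ev \<iota> + galois_action "ev ` carrier M" G act e \<theta>
  for M :: "(complex, 'a, 'm) module_scheme" (structure) and ev :: "'a \<Rightarrow> 'k::field" and \<iota> :: "complex \<Rightarrow> 'k"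
    and G :: "'g set" and act and e and \<theta> +
  fixes T :: "'k set"
  assumes \<iota>_invariant: "\<iota> c \<in> invariants"
    and finite_T: "finite T" and T_subset: "T \<subseteq> ev ` carrier M"
    and generated: "\<And>C. range \<iota> \<subseteq> C \<Longrightarrow> T \<subseteq> C \<Longrightarrow> (\<And>x y. x \<in> C \<Longrightarrow> y \<in> C \<Longrightarrow> x + y \<in> C) \<Longrightarrow>
      (\<And>x y. x \<in> C \<Longrightarrow> y \<in> C \<Longrightarrow> x * y \<in> C) \<Longrightarrow> ev ` carrier M \<subseteq> C"
begin

abbreviation "A \<equiv> ev ` carrier M"
abbreviation "L \<equiv> fracs invariants"

interpretation AA: operator_domain A A
  by (rule operator_domain_self)

interpretation B: subring_set invariants
  by (rule subring_set_invariants)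

interpretation L: subring_set L
  by (rule B.subring_set_fracs)

interpretation LL: operator_domain L L
  by (rule L.operator_domain_self)

lemma field_operators_L: "field_operators L \<iota>"
proof
  show "inverse x \<in> L" if "x \<in> L" for x
    using B.fracs_divide[OF L.one_mem that] by (simp add: divide_inverse)
  show "\<iota> c \<in> L" for c
    using \<iota>_invariant B.subset_fracs by blast
qed

interpretation F: field_operators L \<iota>
  by (rule field_operators_L)

lemma diff_op_eqI:
  assumes d: "d \<in> carrier (diff_op_alg M)" and d': "d' \<in> carrier (diff_op_alg M)"
    and eq: "\<And>b. b \<in> carrier M \<Longrightarrow> ev b \<in> invariants \<Longrightarrow> d b = d' b"
  shows "d = d'"
proof (rule extensionalityI[of _ "carrier M"])
  have l: "d \<in> lin_endos M" "d' \<in> lin_endos M"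
    using d d' carrier_diff_op_alg by auto
  show "d \<in> extensional (carrier M)" "d' \<in> extensional (carrier M)"
    using lin_endosD(4) l by auto
  fix f assume f: "f \<in> carrier M"
  obtain n m where nm: "diff_ord A A n (transport d)" "diff_ord A A m (transport d')"
    using d d' carrier_diff_op_alg by blast
  have "transport d (ev f) - transport d' (ev f) = 0"
  proof (rule diff_op_eq_0_if_invariants[of "\<lambda>x. transport d x - transport d' x" "max n m" "ev f"])
    show "additive_on A (\<lambda>x. transport d x - transport d' x)"
      using transport_lin(1)[OF l(1)] transport_lin(1)[OF l(2)] by (simp add: additive_on_def)
    show "diff_ord A A (max n m) (\<lambda>x. transport d x - transport d' x)"
      using nm by (intro AA.diff_ord_minus; elim AA.diff_ord_le) auto
    show "transport d b - transport d' b = 0" if b: "b \<in> invariants" for b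
    proof -
      obtain c where "c \<in> carrier M" "b = ev c"
        using b invariants_subset by blast
      then show ?thesis
        using eq b by (simp add: transport_ev)
    qed
  qed (use f in simp)
  then show "d f = d' f"
    using f lin_endosD(1) l by (auto simp: transport_ev intro: ev_inj)
qed

text \<open>For a coordinate ring this turns out to be the ring of operators fixed by the group,
  here described without an action on operators.\<close>

definition preserving_alg :: "(complex, 'a \<Rightarrow> 'a) module" where
  "preserving_alg = diff_op_alg M
     \<lparr>carrier := {d \<in> carrier (diff_op_alg M). \<forall>b\<in>carrier M. ev b \<in> invariants \<longrightarrow> ev (d b) \<in> invariants}\<rparr>"

lemma preserving_alg_simps [simp]:
  "x \<otimes>\<^bsub>preserving_alg\<^esub> y = compose (carrier M) x y"
  "\<one>\<^bsub>preserving_alg\<^esub> = (\<lambda>f\<in>carrier M. f)"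
  "\<zero>\<^bsub>preserving_alg\<^esub> = (\<lambda>f\<in>carrier M. \<zero>)"
  "x \<oplus>\<^bsub>preserving_alg\<^esub> y = (\<lambda>f\<in>carrier M. x f \<oplus> y f)"
  "c \<odot>\<^bsub>preserving_alg\<^esub> x = (\<lambda>f\<in>carrier M. c \<odot> x f)"
  by (simp_all add: preserving_alg_def diff_op_alg_def)

lemma carrier_preserving_alg:
  "d \<in> carrier preserving_alg \<longleftrightarrow>
    d \<in> carrier (diff_op_alg M) \<and> (\<forall>b\<in>carrier M. ev b \<in> invariants \<longrightarrow> ev (d b) \<in> invariants)"
  by (simp add: preserving_alg_def)

lemma preserving_invariants:
  assumes "d \<in> carrier preserving_alg" "x \<in> invariants"
  shows "transport d x \<in> invariants"
proof -
  obtain b where "b \<in> carrier M" "x = ev b"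
    using assms(2) invariants_subset by blast
  then show ?thesis
    using assms by (simp add: transport_ev carrier_preserving_alg)
qed

lemma preserving_mem:
  assumes "d \<in> carrier preserving_alg"
  shows "d \<in> carrier (diff_op_alg M)" "d \<in> lin_endos M"
  using assms carrier_preserving_alg carrier_diff_op_alg by auto

lemma preserving_closed:
  shows "(\<lambda>f\<in>carrier M. f) \<in> carrier preserving_alg"
    and "(\<lambda>f\<in>carrier M. \<zero>) \<in> carrier preserving_alg"
    and "d \<in> carrier preserving_alg \<Longrightarrow> d' \<in> carrier preserving_alg \<Longrightarrow>
      compose (carrier M) d d' \<in> carrier preserving_alg"
    and "d \<in> carrier preserving_alg \<Longrightarrow> d' \<in> carrier preserving_alg \<Longrightarrow>
      (\<lambda>f\<in>carrier M. d f \<oplus> d' f) \<in> carrier preserving_alg"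
    and "d \<in> carrier preserving_alg \<Longrightarrow> (\<lambda>f\<in>carrier M. c \<odot> d f) \<in> carrier preserving_alg"
proof -
  have "(\<lambda>f\<in>carrier M. \<one> \<otimes> f) \<in> diff_ops_upto M 0" "(\<lambda>f\<in>carrier M. \<zero> \<otimes> f) \<in> diff_ops_upto M 0"
    by auto
  moreover have "(\<lambda>f\<in>carrier M. \<one> \<otimes> f) = (\<lambda>f\<in>carrier M. f)"
    "(\<lambda>f\<in>carrier M. \<zero> \<otimes> f) = (\<lambda>f\<in>carrier M. \<zero>)"
    by (auto simp: restrict_def)
  ultimately have "(\<lambda>f\<in>carrier M. f) \<in> carrier (diff_op_alg M)" "(\<lambda>f\<in>carrier M. \<zero>) \<in> carrier (diff_op_alg M)"
    unfolding diff_op_alg_def by (auto simp del: diff_ops_upto.simps)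
  then show "(\<lambda>f\<in>carrier M. f) \<in> carrier preserving_alg" "(\<lambda>f\<in>carrier M. \<zero>) \<in> carrier preserving_alg"
    by (auto simp: carrier_preserving_alg ev_zero B.zero_mem)
  show "compose (carrier M) d d' \<in> carrier preserving_alg"
    if "d \<in> carrier preserving_alg" "d' \<in> carrier preserving_alg"
    using that preserving_mem diff_op_alg_mult_closed(1) lin_endosD(1)
    by (simp add: carrier_preserving_alg compose_eq)
  show "(\<lambda>f\<in>carrier M. d f \<oplus> d' f) \<in> carrier preserving_alg"
    if "d \<in> carrier preserving_alg" "d' \<in> carrier preserving_alg"
    using that preserving_mem diff_op_alg_add_closed(1) lin_endosD(1)
    by (simp add: carrier_preserving_alg ev_add B.add_mem)
  show "(\<lambda>f\<in>carrier M. c \<odot> d f) \<in> carrier preserving_alg" if "d \<in> carrier preserving_alg"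
    using that preserving_mem diff_op_alg_smult_closed(1) lin_endosD(1) \<iota>_invariant
    by (simp add: carrier_preserving_alg ev_smult B.mult_mem)
qed

lemma field_ops_eqI:
  assumes p: "p \<in> carrier (field_ops L \<iota>)" and q: "q \<in> carrier (field_ops L \<iota>)"
    and eq: "\<And>b. b \<in> invariants \<Longrightarrow> p b = q b"
  shows "p = q"
proof
  fix x
  obtain n m where "diff_ord L L n p" "diff_ord L L m q"
    using p q unfolding field_ops_carrier by blast
  then have "p x = q x" if "x \<in> L"
    using B.fracs_operator_eqI[of p n q m x] eq that p q unfolding field_ops_carrier by blast
  then show "p x = q x"
    using p q unfolding field_ops_carrier by (cases "x \<in> L") auto
qed

text \<open>Restriction to the invariants keeps the bound on the order, and the restricted operator
  extends to the fractions. Linearity over constants follows from uniqueness of extensions.\<close>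

lemma field_op_of_preserving:
  assumes d: "d \<in> carrier preserving_alg"
  shows "\<exists>q\<in>carrier (field_ops L \<iota>). \<forall>b\<in>invariants. q b = transport d b"
proof -
  note l = preserving_mem(2)[OF d]
  obtain n where n: "diff_ord A A n (transport d)"
    using preserving_mem(1)[OF d] carrier_diff_op_alg by blast
  have "additive_on invariants (transport d)"
    using transport_lin(1)[OF l] invariants_subset unfolding additive_on_def by blast
  moreover have "diff_ord invariants invariants n (transport d)"
    using diff_ord_mono[OF invariants_subset invariants_subset n] .
  moreover have "transport d b \<in> L" if "b \<in> invariants" for b
    using preserving_invariants[OF d that] B.subset_fracs by blast
  ultimately obtain q where q: "additive_on L q" "diff_ord L L n q" "\<forall>x\<in>L. q x \<in> L"
    "\<forall>x\<in>invariants. q x = transport d x"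
    using B.fracs_operator_extend[of "transport d" n] by blast
  have lin: "q (\<iota> c * x) = \<iota> c * q x" if x: "x \<in> L" for c x
  proof (rule B.fracs_operator_eqI[OF _ _ _ _ _ x])
    have c: "\<iota> c \<in> L"
      by (rule F.\<iota>_mem)
    show "additive_on L (\<lambda>x. q (\<iota> c * x))" "additive_on L (\<lambda>x. \<iota> c * q x)"
      using q(1) c L.mult_mem unfolding additive_on_def by (simp_all add: distrib_left)
    show "diff_ord L L n (\<lambda>x. q (\<iota> c * x))" "diff_ord L L n (\<lambda>x. \<iota> c * q x)"
      using LL.diff_ord_shift[OF q(2) c] LL.diff_ord_scale[OF q(2)] by auto
    show "q (\<iota> c * b) = \<iota> c * q b" if b: "b \<in> invariants" for b
      using q(4) b B.mult_mem[OF \<iota>_invariant b] transport_lin(3)[OF l] invariants_subset by auto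
  qed
  define q' where "q' x = (if x \<in> L then q x else 0)" for x
  have "diff_ord L L n q'"
    by (rule LL.diff_ord_cong[OF _ q(2)]) (simp add: q'_def)
  then have "q' \<in> carrier (field_ops L \<iota>)"
    unfolding field_ops_carrier using q lin F.\<iota>_mem
    by (auto simp: q'_def additive_on_def L.add_mem L.mult_mem)
  then show ?thesis
    using q(4) B.subset_fracs by (intro bexI[of _ q']) (auto simp: q'_def)
qed

definition extend_op :: "('a \<Rightarrow> 'a) \<Rightarrow> 'k \<Rightarrow> 'k" where
  "extend_op d = (SOME q. q \<in> carrier (field_ops L \<iota>) \<and> (\<forall>b\<in>invariants. q b = transport d b))"

lemma extend_op:
  assumes "d \<in> carrier preserving_alg"
  shows "extend_op d \<in> carrier (field_ops L \<iota>)" "b \<in> invariants \<Longrightarrow> extend_op d b = transport d b"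
  using someI_ex[of "\<lambda>q. q \<in> carrier (field_ops L \<iota>) \<and> (\<forall>b\<in>invariants. q b = transport d b)"]
    field_op_of_preserving[OF assms] unfolding extend_op_def by blast+

lemma extend_op_eqI:
  assumes "d \<in> carrier preserving_alg" "q \<in> carrier (field_ops L \<iota>)"
    and "\<And>b. b \<in> invariants \<Longrightarrow> transport d b = q b"
  shows "extend_op d = q"
  using assms extend_op[OF assms(1)] by (intro field_ops_eqI) auto

lemma field_op_lift:
  assumes q: "q \<in> carrier (field_ops L \<iota>)"
  obtains D N m where "additive_on A D" "diff_ord A A N D" "\<forall>c. \<forall>x\<in>A. D (\<iota> c * x) = \<iota> c * D x"
    "\<forall>b\<in>invariants. D b = q b" "m \<in> invariants" "m \<noteq> 0" "\<forall>x\<in>A. m * D x \<in> A"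
proof -
  obtain n where n: "diff_ord L L n q"
    using q unfolding field_ops_carrier by blast
  have sub: "L \<subseteq> fracs A"
    unfolding fracs_def using invariants_subset by blast
  have "additive_on invariants q"
    using q B.subset_fracs unfolding field_ops_carrier additive_on_def by blast
  moreover have "diff_ord invariants invariants n q"
    using diff_ord_mono[OF B.subset_fracs B.subset_fracs n] .
  moreover have "q b \<in> fracs A" if "b \<in> invariants" for b
    using q that sub B.subset_fracs unfolding field_ops_carrier by blast
  ultimately obtain D N where D: "additive_on A D" "diff_ord A A N D" "\<forall>x\<in>A. D x \<in> fracs A"
    "\<forall>b\<in>invariants. D b = q b"
    using invariants_operator_lift[of q n] by blast
  have lin: "D (\<iota> c * x) = \<iota> c * D x" if x: "x \<in> A" for c x
  proof -
    have c: "\<iota> c \<in> A"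
      using \<iota>_invariant invariants_subset by blast
    \<comment> \<open>Linearity over constants is the vanishing of a commutator, which suffices to
      be checked on the invariants.\<close>
    have "ad (\<iota> c) D x = 0"
    proof (rule diff_op_eq_0_if_invariants[OF _ _ _ x])
      show "additive_on A (ad (\<iota> c) D)"
        using additive_on_ad D(1) c by blast
      show "diff_ord A A N (ad (\<iota> c) D)"
        using AA.diff_ord_ad[OF D(2) c] .
      show "ad (\<iota> c) D b = 0" if b: "b \<in> invariants" for b
        using D(4) b B.mult_mem[OF \<iota>_invariant b] q B.subset_fracs
        unfolding ad_def field_ops_carrier by auto
    qed
    then show ?thesis
      by (simp add: ad_def)
  qed
  have "range \<iota> \<subseteq> A"
    using \<iota>_invariant invariants_subset by blast
  \<comment> \<open>Finite generation of the coordinate ring enters here.\<close>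
  have "\<exists>a\<in>A. a \<noteq> 0 \<and> (\<forall>x\<in>A. a * D x \<in> A)"
    by (rule bounded_denominator[OF finite_T T_subset \<open>range \<iota> \<subseteq> A\<close> generated D(1) _ D(2)])
      (use lin D(3) in auto)
  then obtain a where a: "a \<in> A" "a \<noteq> 0" "\<forall>x\<in>A. a * D x \<in> A"
    by blast
  \<comment> \<open>The multiplier has to be invariant in order to act as a unit on the operators
    over \<open>L\<close>.\<close>
  obtain a' where a': "a' \<in> A" "a' * a \<in> invariants" "a' * a \<noteq> 0"
    by (rule invariant_multiple[OF a(1,2)])
  show thesis
  proof (rule that[OF D(1,2) _ D(4) a'(2,3)])
    show "\<forall>x\<in>A. a' * a * D x \<in> A"
      using mult_mem[OF a'(1)] a(3) by (simp add: mult.assoc)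
  qed (use lin in blast)
qed

text \<open>The operator \<open>m\<close> times \<open>D\<close> maps the algebra into itself and
  the invariants into \<open>L\<close>, hence the invariants into themselves by
  \<open>fracs_invariants_Int\<close>.\<close>

lemma preserving_of_field_op:
  assumes q: "q \<in> carrier (field_ops L \<iota>)"
    and D: "additive_on A D" "diff_ord A A N D" "\<forall>c. \<forall>x\<in>A. D (\<iota> c * x) = \<iota> c * D x"
    and Dq: "\<forall>b\<in>invariants. D b = q b"
    and m: "m \<in> invariants" "\<forall>x\<in>A. m * D x \<in> A"
  shows "\<exists>d\<in>carrier preserving_alg. (\<lambda>x. if x \<in> L then m * x else 0) \<otimes>\<^bsub>field_ops L \<iota>\<^esub> q = extend_op d"
proof -
  have mL: "m \<in> L"
    using m(1) B.subset_fracs by blast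
  have qL: "q x \<in> L" if "x \<in> L" for x
    using q that unfolding field_ops_carrier by blast
  obtain d where d: "d \<in> carrier (diff_op_alg M)" "\<forall>f\<in>carrier M. ev (d f) = m * D (ev f)"
  proof (rule diff_op_of_field_op)
    show "additive_on A (\<lambda>x. m * D x)"
      using D(1) by (simp add: additive_on_def distrib_left)
    show "diff_ord A A N (\<lambda>x. m * D x)"
      using AA.diff_ord_scale[OF D(2)] .
  qed (use D(3) m(2) in auto)
  have "ev (d b) \<in> invariants" if b: "b \<in> carrier M" "ev b \<in> invariants" for b
  proof (rule fracs_invariants_Int)
    have "q (ev b) \<in> L"
      using b(2) qL B.subset_fracs by blast
    then show "ev (d b) \<in> L"
      using bspec[OF d(2) b(1)] bspec[OF Dq b(2)] L.mult_mem[OF mL] by simp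
    show "ev (d b) \<in> A"
      using bspec[OF d(2) b(1)] m(2) b(1) by simp
  qed
  then have dR: "d \<in> carrier preserving_alg"
    using d(1) carrier_preserving_alg by blast
  have "extend_op d = (\<lambda>x. if x \<in> L then m * x else 0) \<otimes>\<^bsub>field_ops L \<iota>\<^esub> q"
  proof (rule extend_op_eqI[OF dR])
    show "(\<lambda>x. if x \<in> L then m * x else 0) \<otimes>\<^bsub>field_ops L \<iota>\<^esub> q \<in> carrier (field_ops L \<iota>)"
      using F.field_ops_mult_closed[OF F.mult_left_mem[OF mL] q] by simp
    fix b assume b: "b \<in> invariants"
    then obtain c where "c \<in> carrier M" "b = ev c"
      using invariants_subset by blast
    moreover have "q b \<in> L"
      using b qL B.subset_fracs by blast
    ultimately show "transport d b = ((\<lambda>x. if x \<in> L then m * x else 0) \<otimes>\<^bsub>field_ops L \<iota>\<^esub> q) b"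
      using d(2) bspec[OF Dq b] by (simp add: transport_ev)
  qed
  then show ?thesis
    using dR by metis
qed

theorem frac_embedding_preserving: "frac_embedding preserving_alg (field_ops L \<iota>) extend_op"
proof (intro frac_embedding.intro F.ring_field_ops, unfold_locales)
  note closed = preserving_closed
  have tr: "b \<in> A" if "b \<in> invariants" for b
    using that invariants_subset by blast
  note mem = extend_op(1)
  show "c \<odot>\<^bsub>field_ops L \<iota>\<^esub> q \<in> carrier (field_ops L \<iota>)" if "q \<in> carrier (field_ops L \<iota>)" for q c
    using F.field_ops_smult_closed[OF that] by simp
  show "w \<otimes>\<^bsub>field_ops L \<iota>\<^esub> (c \<odot>\<^bsub>field_ops L \<iota>\<^esub> q) = c \<odot>\<^bsub>field_ops L \<iota>\<^esub> (w \<otimes>\<^bsub>field_ops L \<iota>\<^esub> q)"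
    if "w \<in> carrier (field_ops L \<iota>)" "q \<in> carrier (field_ops L \<iota>)" for w q c
  proof -
    have "w (\<iota> c * q x) = \<iota> c * w (q x)" for x
    proof (cases "x \<in> L")
      case False
      moreover have "w 0 = 0"
        using that(1) L.additive_zero unfolding field_ops_carrier by blast
      ultimately show ?thesis
        using that(2) unfolding field_ops_carrier by simp
    qed (use that in \<open>auto simp: field_ops_carrier\<close>)
    then show ?thesis
      by simp
  qed
  show "\<one>\<^bsub>preserving_alg\<^esub> \<in> carrier preserving_alg" "\<zero>\<^bsub>preserving_alg\<^esub> \<in> carrier preserving_alg"
    using closed(1,2) by simp_all
  show "x \<otimes>\<^bsub>preserving_alg\<^esub> y \<in> carrier preserving_alg" "x \<oplus>\<^bsub>preserving_alg\<^esub> y \<in> carrier preserving_alg"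
    if "x \<in> carrier preserving_alg" "y \<in> carrier preserving_alg" for x y
    using closed(3,4)[OF that] by simp_all
  show "c \<odot>\<^bsub>preserving_alg\<^esub> x \<in> carrier preserving_alg" if "x \<in> carrier preserving_alg" for x c
    using closed(5)[OF that] by simp
  show "extend_op x \<in> carrier (field_ops L \<iota>)" if "x \<in> carrier preserving_alg" for x
    by (rule mem[OF that])
  show "x = y" if x: "x \<in> carrier preserving_alg" and y: "y \<in> carrier preserving_alg"
    and eq: "extend_op x = extend_op y" for x y
  proof (rule diff_op_eqI)
    fix b assume b: "b \<in> carrier M" "ev b \<in> invariants"
    have "ev (x b) = ev (y b)"
      using extend_op(2)[OF x b(2)] extend_op(2)[OF y b(2)] eq b(1) by (simp add: transport_ev)
    then show "x b = y b"
      using b(1) lin_endosD(1)[OF preserving_mem(2)[OF x]] lin_endosD(1)[OF preserving_mem(2)[OF y]]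
      by (intro ev_inj) auto
  qed (use x y preserving_mem in auto)
  show "extend_op \<one>\<^bsub>preserving_alg\<^esub> = \<one>\<^bsub>field_ops L \<iota>\<^esub>"
    using closed(1) F.field_ops_one_closed B.subset_fracs tr
    by (auto intro!: extend_op_eqI simp: transport_def inv_into_into f_inv_into_f)
  show "extend_op \<zero>\<^bsub>preserving_alg\<^esub> = \<zero>\<^bsub>field_ops L \<iota>\<^esub>"
    using closed(2) F.field_ops_zero_closed tr
    by (auto intro!: extend_op_eqI simp: transport_def inv_into_into ev_zero)
  show "extend_op (x \<otimes>\<^bsub>preserving_alg\<^esub> y) = extend_op x \<otimes>\<^bsub>field_ops L \<iota>\<^esub> extend_op y"
    if x: "x \<in> carrier preserving_alg" and y: "y \<in> carrier preserving_alg" for x y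
  proof (rule extend_op_eqI)
    show "extend_op x \<otimes>\<^bsub>field_ops L \<iota>\<^esub> extend_op y \<in> carrier (field_ops L \<iota>)"
      using F.field_ops_mult_closed mem x y by simp
    fix b assume b: "b \<in> invariants"
    show "transport (x \<otimes>\<^bsub>preserving_alg\<^esub> y) b = (extend_op x \<otimes>\<^bsub>field_ops L \<iota>\<^esub> extend_op y) b"
      using diff_op_alg_mult_closed(2)[OF preserving_mem(1)[OF x] preserving_mem(1)[OF y] tr[OF b]]
        extend_op(2)[OF y b] extend_op(2)[OF x preserving_invariants[OF y b]] by simp
  qed (use closed(3)[OF x y] in simp)
  show "extend_op (x \<oplus>\<^bsub>preserving_alg\<^esub> y) = extend_op x \<oplus>\<^bsub>field_ops L \<iota>\<^esub> extend_op y"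
    if x: "x \<in> carrier preserving_alg" and y: "y \<in> carrier preserving_alg" for x y
  proof (rule extend_op_eqI)
    show "extend_op x \<oplus>\<^bsub>field_ops L \<iota>\<^esub> extend_op y \<in> carrier (field_ops L \<iota>)"
      using F.field_ops_add_closed mem x y by simp
    fix b assume b: "b \<in> invariants"
    show "transport (x \<oplus>\<^bsub>preserving_alg\<^esub> y) b = (extend_op x \<oplus>\<^bsub>field_ops L \<iota>\<^esub> extend_op y) b"
      using diff_op_alg_add_closed(2)[OF preserving_mem(1)[OF x] preserving_mem(1)[OF y] tr[OF b]]
        extend_op(2)[OF y b] extend_op(2)[OF x b] by simp
  qed (use closed(4)[OF x y] in simp)
  show "extend_op (c \<odot>\<^bsub>preserving_alg\<^esub> x) = c \<odot>\<^bsub>field_ops L \<iota>\<^esub> extend_op x"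
    if x: "x \<in> carrier preserving_alg" for x c
  proof (rule extend_op_eqI)
    show "c \<odot>\<^bsub>field_ops L \<iota>\<^esub> extend_op x \<in> carrier (field_ops L \<iota>)"
      using F.field_ops_smult_closed mem x by simp
    fix b assume b: "b \<in> invariants"
    show "transport (c \<odot>\<^bsub>preserving_alg\<^esub> x) b = (c \<odot>\<^bsub>field_ops L \<iota>\<^esub> extend_op x) b"
      using diff_op_alg_smult_closed(2)[OF preserving_mem(1)[OF x] tr[OF b]]
        extend_op(2)[OF x b] by simp
  qed (use closed(5)[OF x] in simp)
  show "\<exists>w\<in>Units (field_ops L \<iota>). \<exists>s\<in>carrier preserving_alg. \<exists>a\<in>carrier preserving_alg.
      w \<otimes>\<^bsub>field_ops L \<iota>\<^esub> p = extend_op s \<and> w \<otimes>\<^bsub>field_ops L \<iota>\<^esub> q = extend_op a"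
    if p: "p \<in> carrier (field_ops L \<iota>)" and q: "q \<in> carrier (field_ops L \<iota>)" for p q
  proof -
    obtain D N m where D: "additive_on A D" "diff_ord A A N D" "\<forall>c. \<forall>x\<in>A. D (\<iota> c * x) = \<iota> c * D x"
      "\<forall>b\<in>invariants. D b = p b"
      and m: "m \<in> invariants" "m \<noteq> 0" "\<forall>x\<in>A. m * D x \<in> A"
      by (rule field_op_lift[OF p])
    obtain D' N' m' where D': "additive_on A D'" "diff_ord A A N' D'" "\<forall>c. \<forall>x\<in>A. D' (\<iota> c * x) = \<iota> c * D' x"
      "\<forall>b\<in>invariants. D' b = q b"
      and m': "m' \<in> invariants" "m' \<noteq> 0" "\<forall>x\<in>A. m' * D' x \<in> A"
      by (rule field_op_lift[OF q])
    \<comment> \<open>One unit must serve both operators, so the product of the two multipliers is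
      taken.\<close>
    have mm: "m * m' \<in> invariants" "m * m' \<noteq> 0"
      using m m' B.mult_mem by auto
    have "m' * (m * D x) \<in> A" if "x \<in> A" for x
      using mult_mem[OF tr[OF m'(1)]] m(3) that by blast
    then have "\<forall>x\<in>A. m * m' * D x \<in> A"
      by (simp add: mult_ac)
    then have 1: "\<exists>d\<in>carrier preserving_alg.
        (\<lambda>x. if x \<in> L then m * m' * x else 0) \<otimes>\<^bsub>field_ops L \<iota>\<^esub> p = extend_op d"
      by (rule preserving_of_field_op[OF p D mm(1)])
    have "m * (m' * D' x) \<in> A" if "x \<in> A" for x
      using mult_mem[OF tr[OF m(1)]] m'(3) that by blast
    then have "\<forall>x\<in>A. m * m' * D' x \<in> A"
      by (simp add: mult.assoc)
    then have 2: "\<exists>d\<in>carrier preserving_alg.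
        (\<lambda>x. if x \<in> L then m * m' * x else 0) \<otimes>\<^bsub>field_ops L \<iota>\<^esub> q = extend_op d"
      by (rule preserving_of_field_op[OF q D' mm(1)])
    have "(\<lambda>x. if x \<in> L then m * m' * x else 0) \<in> Units (field_ops L \<iota>)"
      using mm B.subset_fracs by (intro F.mult_left_Units) auto
    then show ?thesis
      using 1 2 by blast
  qed
qed

end

text \<open>With \<open>h\<close> as the inverse of \<open>g\<close>, the commutator of g D h with y
  is g [D, h y] h, again a conjugate and of lower order.\<close>

lemma (in galois_action) diff_ord_conjugate:
  assumes g: "g \<in> G" and h: "h \<in> G" and gh: "\<And>x. x \<in> A \<Longrightarrow> act g (act h x) = x"
    and "diff_ord A A n D" "\<And>x. x \<in> A \<Longrightarrow> D x \<in> A"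
  shows "diff_ord A A n (\<lambda>x. act g (D (act h x)))"
  using assms(4,5)
proof (induction n arbitrary: D)
  case 0
  then show ?case
    using act_mem[OF h] act_zero[OF g] by simp
next
  case (Suc n)
  interpret AA: operator_domain A A
    by (rule operator_domain_self)
  have "diff_ord A A n (ad y (\<lambda>x. act g (D (act h x))))" if y: "y \<in> A" for y
  proof (rule AA.diff_ord_cong)
    have hy: "act h y \<in> A"
      using act_mem[OF h y] .
    show "diff_ord A A n (\<lambda>x. act g (ad (act h y) D (act h x)))"
    proof (rule Suc.IH)
      show "diff_ord A A n (ad (act h y) D)"
        using Suc.prems(1) hy by simp
      show "ad (act h y) D x \<in> A" if "x \<in> A" for x
        using that hy Suc.prems(2) by (auto simp: ad_def intro!: diff_mem mult_mem)
    qed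
    show "act g (ad (act h y) D (act h x)) = ad y (\<lambda>x. act g (D (act h x))) x" if x: "x \<in> A" for x
    proof -
      have hx: "act h x \<in> A"
        using act_mem[OF h x] .
      have "D (act h y * act h x) \<in> A" "D (act h x) \<in> A" "act h y * D (act h x) \<in> A"
        using hx hy Suc.prems(2) mult_mem by auto
      then show ?thesis
        using hy by (simp add: ad_def act_diff[OF g] act_mult[OF g] act_mult[OF h y x] gh[OF y])
    qed
  qed
  then show ?case
    by simp
qed

section \<open>Coordinate rings\<close>

lemma coord_funs_iff: "f \<in> coord_funs V \<longleftrightarrow> (\<exists>p\<in>poly_funs. f = restrict p V)"
  unfolding coord_funs_def by blast

lemma coord_funsI: "p \<in> poly_funs \<Longrightarrow> (\<And>x. x \<in> V \<Longrightarrow> h x = p x) \<Longrightarrow> restrict h V \<in> coord_funs V"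
  unfolding coord_funs_iff by (intro bexI[of _ p] restrict_ext)

lemma coord_funs_closed:
  assumes "f \<in> coord_funs V" "g \<in> coord_funs V"
  shows "(\<lambda>x\<in>V. f x + g x) \<in> coord_funs V" "(\<lambda>x\<in>V. f x * g x) \<in> coord_funs V"
    "(\<lambda>x\<in>V. c * f x) \<in> coord_funs V" "(\<lambda>x\<in>V. f x - g x) \<in> coord_funs V"
proof -
  obtain p q where pq: "p \<in> poly_funs" "q \<in> poly_funs" "f = restrict p V" "g = restrict q V"
    using assms unfolding coord_funs_iff by blast
  have 1: "(\<lambda>x. p x + - 1 * q x) \<in> poly_funs" "(\<lambda>x. p x + q x) \<in> poly_funs" "(\<lambda>x. p x * q x) \<in> poly_funs"
    "(\<lambda>x. c * p x) \<in> poly_funs"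
    by (intro poly_funs.intros pq)+
  show "(\<lambda>x\<in>V. f x + g x) \<in> coord_funs V"
    by (rule coord_funsI[OF 1(2)]) (simp add: pq)
  show "(\<lambda>x\<in>V. f x * g x) \<in> coord_funs V"
    by (rule coord_funsI[OF 1(3)]) (simp add: pq)
  show "(\<lambda>x\<in>V. c * f x) \<in> coord_funs V"
    by (rule coord_funsI[OF 1(4)]) (simp add: pq)
  show "(\<lambda>x\<in>V. f x - g x) \<in> coord_funs V"
    by (rule coord_funsI[OF 1(1)]) (simp add: pq)
qed

lemma const_coord_funs: "(\<lambda>x\<in>V. c) \<in> coord_funs V"
  unfolding coord_funs_iff using poly_funs.const by blast

lemma coord_funs_extensional: "f \<in> coord_funs V \<Longrightarrow> f \<in> extensional V"
  unfolding coord_funs_iff by auto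

lemma coord_alg_simps [simp]:
  "carrier (coord_alg V) = coord_funs V"
  "f \<otimes>\<^bsub>coord_alg V\<^esub> g = (\<lambda>x\<in>V. f x * g x)"
  "\<one>\<^bsub>coord_alg V\<^esub> = (\<lambda>x\<in>V. 1)"
  "\<zero>\<^bsub>coord_alg V\<^esub> = (\<lambda>x\<in>V. 0)"
  "f \<oplus>\<^bsub>coord_alg V\<^esub> g = (\<lambda>x\<in>V. f x + g x)"
  "c \<odot>\<^bsub>coord_alg V\<^esub> f = (\<lambda>x\<in>V. c * f x)"
  by (simp_all add: coord_alg_def)

lemma cring_coord_alg: "cring (coord_alg V)"
proof (intro cringI abelian_groupI comm_monoidI, goal_cases)
  case (6 f)
  then show ?case
    using coord_funs_closed(3)[of f V f "-1"]
    by (intro bexI[of _ "\<lambda>x\<in>V. - 1 * f x"]) (auto simp: restrict_def fun_eq_iff)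
next
  case (5 f)
  then show ?case
    using coord_funs_extensional[of f V] by (auto simp: restrict_def fun_eq_iff extensional_def)
next
  case (10 f)
  then show ?case
    using coord_funs_extensional[of f V] by (auto simp: restrict_def fun_eq_iff extensional_def)
qed (auto simp: coord_funs_closed const_coord_funs fun_eq_iff algebra_simps)

lemma poly_funs_compose:
  assumes "p \<in> poly_funs" "\<And>i. q i \<in> poly_funs"
  shows "(\<lambda>x. p (\<chi> i. q i x)) \<in> poly_funs"
  using assms(1) by induction (auto intro: poly_funs.intros assms(2))

lemma compose_polynomial_map:
  assumes f: "f \<in> coord_funs V" and g: "polynomial_map_on V g" "g \<in> V \<rightarrow> V"
  shows "compose V f g \<in> coord_funs V"
proof -
  obtain p where p: "p \<in> poly_funs" "f = restrict p V"
    using f unfolding coord_funs_iff by blast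
  obtain q where q: "\<And>i. q i \<in> poly_funs" "\<And>x. x \<in> V \<Longrightarrow> g x = (\<chi> i. q i x)"
    using g(1) unfolding polynomial_map_on_def by blast
  have "compose V f g = restrict (\<lambda>x. p (\<chi> i. q i x)) V"
    using g(2) q(2) by (auto simp: compose_def restrict_def p(2) fun_eq_iff Pi_iff)
  then show ?thesis
    unfolding coord_funs_iff using poly_funs_compose[OF p(1)] q(1) by blast
qed

text \<open>Otherwise \<open>V\<close> is the union of the zero sets of \<open>f\<close> and
  \<open>g\<close>, one of which is then all of \<open>V\<close>. This makes the coordinate ring a
  domain.\<close>

lemma irreducible_coord_funs:
  assumes V: "irreducible_affine_variety V" and f: "f \<in> coord_funs V" "g \<in> coord_funs V"
    and nz: "\<exists>x\<in>V. f x \<noteq> 0" "\<exists>x\<in>V. g x \<noteq> 0"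
  shows "\<exists>x\<in>V. f x \<noteq> 0 \<and> g x \<noteq> 0"
proof (rule ccontr)
  assume neg: "\<not> (\<exists>x\<in>V. f x \<noteq> 0 \<and> g x \<noteq> 0)"
  obtain p q where pq: "p \<in> poly_funs" "q \<in> poly_funs" "f = restrict p V" "g = restrict q V"
    using f unfolding coord_funs_iff by blast
  obtain S where S: "S \<subseteq> poly_funs" "V = {x. \<forall>p\<in>S. p x = 0}"
    using V unfolding irreducible_affine_variety_def algebraic_set_def by blast
  have alg: "algebraic_set {x\<in>V. r x = 0}" if "r \<in> poly_funs" for r
    unfolding algebraic_set_def using S that by (intro exI[of _ "insert r S"]) auto
  have "V = {x\<in>V. p x = 0} \<union> {x\<in>V. q x = 0}"
    using neg pq by auto
  then have "V = {x\<in>V. p x = 0} \<or> V = {x\<in>V. q x = 0}"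
    using V alg[OF pq(1)] alg[OF pq(2)] unfolding irreducible_affine_variety_def by blast
  then show False
    using nz pq by auto
qed

section \<open>Generic points with values in the ultrapower\<close>

definition ev_at :: "('b set \<Rightarrow> 'p) \<Rightarrow> ('p \<Rightarrow> complex) \<Rightarrow> 'b upow" where
  "ev_at \<xi> f = abs_upow (\<lambda>F. f (\<xi> F))"

definition const_upow :: "complex \<Rightarrow> 'b upow" where
  "const_upow c = abs_upow (\<lambda>_. c)"

text \<open>A point with coordinates in the ultrapower, given by representatives
  \<open>\<xi> F\<close>, at which no nonzero function on \<open>V\<close> vanishes. Evaluation
  there embeds the coordinate ring into a field.\<close>

locale generic_point =
  fixes V :: "(complex ^ 'n) set" and \<xi> :: "'b set \<Rightarrow> complex ^ 'n"
  assumes generic_mem: "eventually (\<lambda>F. \<xi> F \<in> V) fin_ultra"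
    and generic_nonzero: "f \<in> coord_funs V \<Longrightarrow> \<exists>x\<in>V. f x \<noteq> 0 \<Longrightarrow> eventually (\<lambda>F. f (\<xi> F) \<noteq> 0) fin_ultra"
begin

lemma ev_at_eqI:
  assumes "\<And>x. x \<in> V \<Longrightarrow> f x = g x"
  shows "ev_at \<xi> f = ev_at \<xi> g"
  unfolding ev_at_def upow.abs_eq_iff using generic_mem by eventually_elim (rule assms)

lemma ev_at_inj:
  assumes f: "f \<in> coord_funs V" and g: "g \<in> coord_funs V" and eq: "ev_at \<xi> f = ev_at \<xi> g"
  shows "f = g"
proof (rule extensionalityI[OF coord_funs_extensional[OF f] coord_funs_extensional[OF g]])
  have ev: "eventually (\<lambda>F. f (\<xi> F) = g (\<xi> F)) fin_ultra"
    using eq unfolding ev_at_def upow.abs_eq_iff .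
  show "f x = g x" if x: "x \<in> V" for x
  proof (rule ccontr)
    assume "f x \<noteq> g x"
    then have "\<exists>x\<in>V. (\<lambda>x\<in>V. f x - g x) x \<noteq> 0"
      using x by (auto intro!: bexI[of _ x])
    then have "eventually (\<lambda>F. (\<lambda>x\<in>V. f x - g x) (\<xi> F) \<noteq> 0) fin_ultra"
      by (rule generic_nonzero[OF coord_funs_closed(4)[OF f g]])
    with ev generic_mem have "eventually (\<lambda>F. False) (fin_ultra :: 'b set filter)"
      by eventually_elim simp
    then show False
      by (simp add: eventually_False fin_ultra_proper)
  qed
qed

lemma embedded_algebra_coord: "embedded_algebra (coord_alg V) (ev_at \<xi>) const_upow"
proof (intro embedded_algebra.intro cring_coord_alg, unfold_locales)
  show "f = g" if "f \<in> carrier (coord_alg V)" "g \<in> carrier (coord_alg V)" "ev_at \<xi> f = ev_at \<xi> g" for f g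
    using ev_at_inj that by simp
  show "ev_at \<xi> (f \<oplus>\<^bsub>coord_alg V\<^esub> g) = ev_at \<xi> f + ev_at \<xi> g" for f g
    using ev_at_eqI[of "\<lambda>x\<in>V. f x + g x" "\<lambda>x. f x + g x"] by (simp add: ev_at_def plus_upow.abs_eq)
  show "ev_at \<xi> (f \<otimes>\<^bsub>coord_alg V\<^esub> g) = ev_at \<xi> f * ev_at \<xi> g" for f g
    using ev_at_eqI[of "\<lambda>x\<in>V. f x * g x" "\<lambda>x. f x * g x"] by (simp add: ev_at_def times_upow.abs_eq)
  show "ev_at \<xi> \<one>\<^bsub>coord_alg V\<^esub> = 1"
    using ev_at_eqI[of "\<lambda>x\<in>V. 1" "\<lambda>x. 1"] by (simp add: ev_at_def one_upow_def)
  show "ev_at \<xi> (c \<odot>\<^bsub>coord_alg V\<^esub> f) = const_upow c * ev_at \<xi> f" for c f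
    using ev_at_eqI[of "\<lambda>x\<in>V. c * f x" "\<lambda>x. c * f x"]
    by (simp add: ev_at_def const_upow_def times_upow.abs_eq)
  show "c \<odot>\<^bsub>coord_alg V\<^esub> f \<in> carrier (coord_alg V)" if "f \<in> carrier (coord_alg V)" for c f
    using that coord_funs_closed(3) by simp
qed

lemma ev_at_const: "ev_at \<xi> (\<lambda>x\<in>V. c) = const_upow c"
  using ev_at_eqI[of "\<lambda>x\<in>V. c" "\<lambda>x. c"] by (simp add: ev_at_def const_upow_def)

lemma coord_funs_generated:
  assumes "range const_upow \<subseteq> C" "\<And>i. ev_at \<xi> (\<lambda>x\<in>V. x $ i) \<in> C"
    and "\<And>x y. x \<in> C \<Longrightarrow> y \<in> C \<Longrightarrow> x + y \<in> C" "\<And>x y. x \<in> C \<Longrightarrow> y \<in> C \<Longrightarrow> x * y \<in> C"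
  shows "ev_at \<xi> ` coord_funs V \<subseteq> C"
proof -
  have "ev_at \<xi> p \<in> C" if "p \<in> poly_funs" for p
    using that
  proof induction
    case (const c)
    then show ?case
      using assms(1) by (auto simp: ev_at_def const_upow_def)
  next
    case (coord i)
    then show ?case
      using assms(2)[of i] ev_at_eqI[of "\<lambda>x\<in>V. x $ i" "\<lambda>x. x $ i"] by simp
  next
    case (add p q)
    then show ?case
      using assms(3)[of "ev_at \<xi> p" "ev_at \<xi> q"] by (simp add: ev_at_def plus_upow.abs_eq)
  next
    case (mult p q)
    then show ?case
      using assms(4)[of "ev_at \<xi> p" "ev_at \<xi> q"] by (simp add: ev_at_def times_upow.abs_eq)
  qed
  moreover have "ev_at \<xi> (restrict p V) = ev_at \<xi> p" for p
    by (rule ev_at_eqI) simp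
  ultimately show ?thesis
    unfolding coord_funs_def by auto
qed

end

text \<open>\<open>h\<close> is the product of the functions, nonzero because the coordinate ring is
  a domain.\<close>

lemma finite_nonvanishing:
  assumes V: "irreducible_affine_variety V" and "finite F"
    and "\<And>f. f \<in> F \<Longrightarrow> f \<in> coord_funs V \<and> (\<exists>x\<in>V. f x \<noteq> 0)"
  shows "\<exists>h\<in>coord_funs V. (\<exists>x\<in>V. h x \<noteq> 0) \<and> (\<forall>x\<in>V. h x \<noteq> 0 \<longrightarrow> (\<forall>f\<in>F. f x \<noteq> 0))"
  using assms(2,3)
proof (induction F)
  case empty
  then show ?case
    using V const_coord_funs[of 1 V] unfolding irreducible_affine_variety_def
    by (intro bexI[of _ "\<lambda>x\<in>V. 1"]) auto
next
  case (insert f F)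
  then obtain h where h: "h \<in> coord_funs V" "\<exists>x\<in>V. h x \<noteq> 0" "\<forall>x\<in>V. h x \<noteq> 0 \<longrightarrow> (\<forall>f\<in>F. f x \<noteq> 0)"
    by blast
  have f: "f \<in> coord_funs V" "\<exists>x\<in>V. f x \<noteq> 0"
    using insert by auto
  obtain x where "x \<in> V" "f x \<noteq> 0" "h x \<noteq> 0"
    using irreducible_coord_funs[OF V f(1) h(1) f(2) h(2)] by blast
  then show ?case
    using h(3) by (intro bexI[of _ "\<lambda>x\<in>V. f x * h x"] conjI)
      (auto simp: coord_funs_closed(2)[OF f(1) h(1)] intro!: bexI[of _ x])
qed

lemma generic_point_exists:
  assumes V: "irreducible_affine_variety V"
  shows "\<exists>\<xi> :: (complex ^ 'n \<Rightarrow> complex) set \<Rightarrow> complex ^ 'n. generic_point V \<xi>"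
proof -
  \<comment> \<open>The point chosen for a finite \<open>F\<close> avoids the zeros of all nonzero
    functions in \<open>F\<close>, and a given function belongs to almost all
    \<open>F\<close>.\<close>
  let ?P = "\<lambda>F x. x \<in> V \<and> (\<forall>f\<in>F. f \<in> coord_funs V \<longrightarrow> (\<exists>x\<in>V. f x \<noteq> 0) \<longrightarrow> f x \<noteq> 0)"
  have ex: "\<exists>x. ?P F x" if fin: "finite F" for F
  proof -
    let ?F = "{f\<in>F. f \<in> coord_funs V \<and> (\<exists>x\<in>V. f x \<noteq> 0)}"
    have "\<exists>h\<in>coord_funs V. (\<exists>x\<in>V. h x \<noteq> 0) \<and> (\<forall>x\<in>V. h x \<noteq> 0 \<longrightarrow> (\<forall>f\<in>?F. f x \<noteq> 0))"
      by (rule finite_nonvanishing[OF V]) (use fin in auto)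
    then obtain x where "x \<in> V" "\<forall>f\<in>?F. f x \<noteq> 0"
      by blast
    then show ?thesis
      by (intro exI[of _ x]) simp
  qed
  define \<xi> where "\<xi> F = (SOME x. ?P F x)" for F
  have \<xi>: "?P F (\<xi> F)" if "finite F" for F
    unfolding \<xi>_def by (rule someI_ex[OF ex[OF that]])
  have "generic_point V \<xi>"
  proof
    show "eventually (\<lambda>F. \<xi> F \<in> V) fin_ultra"
      using eventually_fin_ultra_member by eventually_elim (use \<xi> in blast)
    show "eventually (\<lambda>F. f (\<xi> F) \<noteq> 0) fin_ultra" if "f \<in> coord_funs V" "\<exists>x\<in>V. f x \<noteq> 0" for f
      using eventually_fin_ultra_member[of f] by eventually_elim (use \<xi> that in blast)
  qed
  then show ?thesis
    by blast
qed

section \<open>The quotient variety\<close>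

locale generic_action = generic_point V \<xi>
  for V :: "(complex ^ 'n) set" and \<xi> :: "'b set \<Rightarrow> complex ^ 'n" +
  fixes G :: "(complex ^ 'n \<Rightarrow> complex ^ 'n) set"
  assumes subgroup_G: "subgroup G (BijGroup V)" and G_auts: "G \<subseteq> variety_auts V"
    and finite_G: "finite G"
begin

section \<open>The action of the group on functions\<close>

interpretation Bij: group "BijGroup V"
  by (rule group_BijGroup)

abbreviation "inverse_map g \<equiv> inv\<^bsub>BijGroup V\<^esub> g"

lemma G_Bij: "g \<in> G \<Longrightarrow> g \<in> Bij V"
  using subgroup.mem_carrier[OF subgroup_G] by (simp add: BijGroup_def)

lemma inverse_map_G: "g \<in> G \<Longrightarrow> inverse_map g \<in> G"
  using subgroup.m_inv_closed[OF subgroup_G] .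

lemma inverse_map_V: "g \<in> G \<Longrightarrow> x \<in> V \<Longrightarrow> inverse_map g x \<in> V"
  using G_Bij[OF inverse_map_G] Bij_imp_funcset by blast

lemma fun_act_coord:
  assumes "g \<in> G" "f \<in> coord_funs V"
  shows "fun_act V g f \<in> coord_funs V"
  unfolding fun_act_def
proof (rule compose_polynomial_map[OF assms(2)])
  show "polynomial_map_on V (inverse_map g)"
    using G_auts assms(1) unfolding variety_auts_def by blast
  show "inverse_map g \<in> V \<rightarrow> V"
    using inverse_map_V[OF assms(1)] by blast
qed

lemma fun_act_eq: "x \<in> V \<Longrightarrow> fun_act V g f x = f (inverse_map g x)"
  by (simp add: fun_act_def compose_eq)

lemma fun_act_extensional: "fun_act V g f \<in> extensional V"
  by (simp add: fun_act_def)

lemma fun_act_fun_act: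
  assumes g: "g \<in> G" and h: "h \<in> G"
  shows "fun_act V h (fun_act V g f) = fun_act V (h \<otimes>\<^bsub>BijGroup V\<^esub> g) f"
proof (rule extensionalityI[OF fun_act_extensional fun_act_extensional])
  fix x assume x: "x \<in> V"
  have "inverse_map (h \<otimes>\<^bsub>BijGroup V\<^esub> g) = inverse_map g \<otimes>\<^bsub>BijGroup V\<^esub> inverse_map h"
    using Bij.inv_mult_group subgroup.mem_carrier[OF subgroup_G] g h by blast
  also have "\<dots> = compose V (inverse_map g) (inverse_map h)"
    using G_Bij inverse_map_G g h by (simp add: BijGroup_def)
  finally show "fun_act V h (fun_act V g f) x = fun_act V (h \<otimes>\<^bsub>BijGroup V\<^esub> g) f x"
    using x inverse_map_V[OF h x] by (simp add: fun_act_eq compose_eq)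
qed

lemma fun_act_one:
  assumes "f \<in> extensional V"
  shows "fun_act V \<one>\<^bsub>BijGroup V\<^esub> f = f"
proof (rule extensionalityI[OF fun_act_extensional assms])
  fix x assume "x \<in> V"
  then show "fun_act V \<one>\<^bsub>BijGroup V\<^esub> f x = f x"
    by (simp add: fun_act_eq) (simp add: BijGroup_def)
qed

lemma fun_act_inverse:
  assumes g: "g \<in> G" and f: "f \<in> extensional V"
  shows "fun_act V g (fun_act V (inverse_map g) f) = f" "fun_act V (inverse_map g) (fun_act V g f) = f"
  using fun_act_fun_act[OF inverse_map_G[OF g] g, of f] fun_act_fun_act[OF g inverse_map_G[OF g], of f]
    fun_act_one[OF f] subgroup.mem_carrier[OF subgroup_G g] by simp_all

text \<open>An automorphism other than the identity moves some point, hence some coordinate of it;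
  the witness is that coordinate function.\<close>

lemma fun_act_faithful:
  assumes g: "g \<in> G" and "g \<noteq> \<one>\<^bsub>BijGroup V\<^esub>"
  shows "\<exists>f\<in>coord_funs V. fun_act V g f \<noteq> f"
proof -
  have "inverse_map g \<noteq> \<one>\<^bsub>BijGroup V\<^esub>"
    using assms subgroup.mem_carrier[OF subgroup_G g] by (metis Bij.inv_inv Bij.inv_one)
  moreover have "inverse_map g \<in> extensional V"
    using G_Bij[OF inverse_map_G[OF g]] by (simp add: Bij_def)
  ultimately obtain x where x: "x \<in> V" "inverse_map g x \<noteq> x"
    using extensionalityI[of "inverse_map g" V "\<lambda>x\<in>V. x"] by (auto simp: BijGroup_def)
  then obtain i where i: "inverse_map g x $ i \<noteq> x $ i"
    by (auto simp: vec_eq_iff)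
  have "fun_act V g (\<lambda>x\<in>V. x $ i) x \<noteq> (\<lambda>x\<in>V. x $ i) x"
    using x(1) i inverse_map_V[OF g x(1)] by (simp add: fun_act_eq)
  then have "fun_act V g (\<lambda>x\<in>V. x $ i) \<noteq> (\<lambda>x\<in>V. x $ i)"
    by metis
  moreover have "(\<lambda>x\<in>V. x $ i) \<in> coord_funs V"
    by (rule coord_funsI[OF poly_funs.coord]) (rule refl)
  ultimately show ?thesis
    by blast
qed

text \<open>The perturbation argument for primitive elements: with \<open>f\<close> moved by all of
  \<open>H\<close> and \<open>a\<close> moved by the new \<open>g\<close>, all but finitely many f +
  c a are moved by each of these maps.\<close>

lemma free_function_exists:
  "\<exists>f\<in>coord_funs V. \<forall>g\<in>G - {\<one>\<^bsub>BijGroup V\<^esub>}. fun_act V g f \<noteq> f"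
proof -
  have "\<exists>f\<in>coord_funs V. \<forall>g\<in>H. fun_act V g f \<noteq> f" if "finite H" "H \<subseteq> G - {\<one>\<^bsub>BijGroup V\<^esub>}" for H
    using that
  proof (induction H)
    case empty
    then show ?case
      using const_coord_funs by blast
  next
    case (insert g H)
    then obtain f where f: "f \<in> coord_funs V" "\<forall>h\<in>H. fun_act V h f \<noteq> f"
      by blast
    obtain a where a: "a \<in> coord_funs V" "fun_act V g a \<noteq> a"
      using fun_act_faithful insert.prems by blast
    let ?f = "\<lambda>c. \<lambda>x\<in>V. f x + c * a x"
    have mem: "?f c \<in> coord_funs V" for c
    proof -
      have "(\<lambda>x\<in>V. f x + (\<lambda>x\<in>V. c * a x) x) \<in> coord_funs V"
        by (rule coord_funs_closed(1)[OF f(1) coord_funs_closed(3)[OF a(1) a(1)]])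
      then show ?thesis
        by (simp add: restrict_def cong: if_cong)
    qed
    have "finite {c. fun_act V h (?f c) = ?f c}" if h: "h \<in> insert g H" for h
    proof -
      have hG: "h \<in> G"
        using h insert.prems by blast
      \<comment> \<open>Two bad constants would make \<open>h\<close> fix both \<open>a\<close> and
        \<open>f\<close>, against the choice of one of them. So each \<open>h\<close> excludes at
        most one constant.\<close>
      have "c = c'" if c: "fun_act V h (?f c) = ?f c" and c': "fun_act V h (?f c') = ?f c'" for c c'
      proof (rule ccontr)
        assume "c \<noteq> c'"
        have eq: "f (inverse_map h x) + t * a (inverse_map h x) = f x + t * a x"
          if t: "fun_act V h (?f t) = ?f t" and x: "x \<in> V" for t x
          using fun_cong[OF t, of x] x inverse_map_V[OF hG x] by (simp add: fun_act_eq)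
        have ax: "a (inverse_map h x) = a x" if x: "x \<in> V" for x
        proof -
          have "(c - c') * (a (inverse_map h x) - a x) =
              (f (inverse_map h x) + c * a (inverse_map h x) - (f x + c * a x)) -
              (f (inverse_map h x) + c' * a (inverse_map h x) - (f x + c' * a x))"
            by (simp add: algebra_simps)
          also have "\<dots> = 0"
            using eq[OF c x] eq[OF c' x] by simp
          finally show ?thesis
            using \<open>c \<noteq> c'\<close> by simp
        qed
        then have "fun_act V h a = a"
          using coord_funs_extensional[OF a(1)]
          by (intro extensionalityI[OF fun_act_extensional]) (auto simp: fun_act_eq)
        moreover have "fun_act V h f = f"
          using coord_funs_extensional[OF f(1)] ax eq[OF c]
          by (intro extensionalityI[OF fun_act_extensional]) (auto simp: fun_act_eq)
        ultimately show False
          using a(2) f(2) h by blast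
      qed
      then have "\<exists>t. {c. fun_act V h (?f c) = ?f c} \<subseteq> {t}"
        by blast
      then show ?thesis
        using finite_subset by blast
    qed
    then have "finite (\<Union>h\<in>insert g H. {c. fun_act V h (?f c) = ?f c})"
      using insert.hyps(1) by blast
    then have "\<exists>c. c \<notin> (\<Union>h\<in>insert g H. {c. fun_act V h (?f c) = ?f c})"
      using infinite_UNIV_char_0[where 'a = complex] ex_new_if_finite by blast
    then show ?case
      using mem by blast
  qed
  then show ?thesis
    using finite_G by simp
qed

interpretation E: embedded_algebra "coord_alg V" "ev_at \<xi>" const_upow
  by (rule embedded_algebra_coord)

definition act_upow :: "(complex ^ 'n \<Rightarrow> complex ^ 'n) \<Rightarrow> 'b upow \<Rightarrow> 'b upow" where
  "act_upow g x = ev_at \<xi> (fun_act V g (inv_into (coord_funs V) (ev_at \<xi>) x))"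

lemma act_upow_ev: "f \<in> coord_funs V \<Longrightarrow> act_upow g (ev_at \<xi> f) = ev_at \<xi> (fun_act V g f)"
  using E.ev_inv_into[of f] by (simp add: act_upow_def)

definition free_function :: "complex ^ 'n \<Rightarrow> complex" where
  "free_function = (SOME f. f \<in> coord_funs V \<and> (\<forall>g\<in>G - {\<one>\<^bsub>BijGroup V\<^esub>}. fun_act V g f \<noteq> f))"

lemma free_function:
  "free_function \<in> coord_funs V" "g \<in> G \<Longrightarrow> g \<noteq> \<one>\<^bsub>BijGroup V\<^esub> \<Longrightarrow> fun_act V g free_function \<noteq> free_function"
  using someI_ex[of "\<lambda>f. f \<in> coord_funs V \<and> (\<forall>g\<in>G - {\<one>\<^bsub>BijGroup V\<^esub>}. fun_act V g f \<noteq> f)"]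
    free_function_exists unfolding free_function_def by blast+

lemma translate_bij:
  assumes h: "h \<in> G"
  shows "bij_betw (\<lambda>g. h \<otimes>\<^bsub>BijGroup V\<^esub> g) G G"
proof (rule bij_betw_byWitness[where f' = "\<lambda>g. inverse_map h \<otimes>\<^bsub>BijGroup V\<^esub> g"])
  have c: "g \<in> carrier (BijGroup V)" if "g \<in> G" for g
    using subgroup.mem_carrier[OF subgroup_G that] .
  show "\<forall>g\<in>G. inverse_map h \<otimes>\<^bsub>BijGroup V\<^esub> (h \<otimes>\<^bsub>BijGroup V\<^esub> g) = g"
    using c h by (simp add: Bij.m_assoc[symmetric])
  show "\<forall>g\<in>G. h \<otimes>\<^bsub>BijGroup V\<^esub> (inverse_map h \<otimes>\<^bsub>BijGroup V\<^esub> g) = g"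
    using c h by (simp add: Bij.m_assoc[symmetric])
  show "(\<lambda>g. h \<otimes>\<^bsub>BijGroup V\<^esub> g) ` G \<subseteq> G" "(\<lambda>g. inverse_map h \<otimes>\<^bsub>BijGroup V\<^esub> g) ` G \<subseteq> G"
    using subgroup.m_closed[OF subgroup_G] h inverse_map_G by blast+
qed

lemma galois_action_coord:
  "galois_action (ev_at \<xi> ` carrier (coord_alg V)) G act_upow \<one>\<^bsub>BijGroup V\<^esub> (ev_at \<xi> free_function)"
proof (intro galois_action.intro E.subring_set_image, unfold_locales)
  let ?A = "ev_at \<xi> ` carrier (coord_alg V)"
  show "finite G"
    by (rule finite_G)
  show "\<one>\<^bsub>BijGroup V\<^esub> \<in> G"
    by (rule subgroup.one_closed[OF subgroup_G])
  show "act_upow \<one>\<^bsub>BijGroup V\<^esub> x = x" if "x \<in> ?A" for x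
    using that by (auto simp: act_upow_ev fun_act_one coord_funs_extensional)
  show "act_upow g x \<in> ?A" if "g \<in> G" "x \<in> ?A" for g x
    using that by (auto simp: act_upow_ev fun_act_coord)
  show "act_upow g (x + y) = act_upow g x + act_upow g y" if g: "g \<in> G" and xy: "x \<in> ?A" "y \<in> ?A" for g x y
  proof -
    obtain a b where ab: "a \<in> coord_funs V" "b \<in> coord_funs V" "x = ev_at \<xi> a" "y = ev_at \<xi> b"
      using xy by auto
    have "fun_act V g (\<lambda>x\<in>V. a x + b x) = (\<lambda>x\<in>V. fun_act V g a x + fun_act V g b x)"
      using inverse_map_V[OF g] by (auto simp: fun_eq_iff fun_act_def compose_def)
    then show ?thesis
      using ab E.ev_add[of a b] E.ev_add[of "fun_act V g a" "fun_act V g b"] fun_act_coord[OF g]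
        act_upow_ev[of "\<lambda>x\<in>V. a x + b x" g] coord_funs_closed(1)[of a V b]
      by (simp add: act_upow_ev)
  qed
  show "act_upow g (x * y) = act_upow g x * act_upow g y" if g: "g \<in> G" and xy: "x \<in> ?A" "y \<in> ?A" for g x y
  proof -
    obtain a b where ab: "a \<in> coord_funs V" "b \<in> coord_funs V" "x = ev_at \<xi> a" "y = ev_at \<xi> b"
      using xy by auto
    have "fun_act V g (\<lambda>x\<in>V. a x * b x) = (\<lambda>x\<in>V. fun_act V g a x * fun_act V g b x)"
      using inverse_map_V[OF g] by (auto simp: fun_eq_iff fun_act_def compose_def)
    then show ?thesis
      using ab E.ev_mult[of a b] E.ev_mult[of "fun_act V g a" "fun_act V g b"] fun_act_coord[OF g]
        act_upow_ev[of "\<lambda>x\<in>V. a x * b x" g] coord_funs_closed(2)[of a V b]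
      by (simp add: act_upow_ev)
  qed
  show "act_upow g 1 = 1" if g: "g \<in> G" for g
  proof -
    have "fun_act V g (\<lambda>x\<in>V. 1) = (\<lambda>x\<in>V. 1)"
      using inverse_map_V[OF g] by (auto simp: fun_eq_iff fun_act_def compose_def)
    then show ?thesis
      using act_upow_ev[OF const_coord_funs, of g 1] E.ev_one by simp
  qed
  show "\<exists>\<pi>. bij_betw \<pi> G G \<and> (\<forall>g\<in>G. \<forall>x\<in>?A. act_upow h (act_upow g x) = act_upow (\<pi> g) x)"
    if h: "h \<in> G" for h
  proof (intro exI conjI ballI)
    show "bij_betw (\<lambda>g. h \<otimes>\<^bsub>BijGroup V\<^esub> g) G G"
      by (rule translate_bij[OF h])
    show "act_upow h (act_upow g x) = act_upow (h \<otimes>\<^bsub>BijGroup V\<^esub> g) x" if "g \<in> G" "x \<in> ?A" for g x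
      using that h by (auto simp: act_upow_ev fun_act_coord fun_act_fun_act)
  qed
  show "ev_at \<xi> free_function \<in> ?A"
    using free_function(1) by simp
  show "act_upow g (ev_at \<xi> free_function) \<noteq> ev_at \<xi> free_function"
    if g: "g \<in> G" "g \<noteq> \<one>\<^bsub>BijGroup V\<^esub>" for g
    using ev_at_inj[OF fun_act_coord[OF g(1) free_function(1)] free_function(1)] free_function(2)[OF g]
    by (auto simp: act_upow_ev free_function(1))
qed

interpretation A: galois_action "ev_at \<xi> ` carrier (coord_alg V)" G act_upow "\<one>\<^bsub>BijGroup V\<^esub>"
    "ev_at \<xi> free_function"
  by (rule galois_action_coord)

lemma ev_at_invariants:
  assumes "f \<in> coord_funs V"
  shows "ev_at \<xi> f \<in> A.invariants \<longleftrightarrow> f \<in> inv_funs V G"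
  unfolding A.invariants_def inv_funs_def using assms ev_at_inj[OF fun_act_coord assms]
  by (auto simp: act_upow_ev)

lemma invariants_eq: "A.invariants = ev_at \<xi> ` inv_funs V G"
proof -
  have "A.invariants \<subseteq> ev_at \<xi> ` coord_funs V" "inv_funs V G \<subseteq> coord_funs V"
    using A.invariants_subset by (auto simp: inv_funs_def)
  then show ?thesis
    using ev_at_invariants by blast
qed

lemma embedded_action_coord:
  "embedded_action (coord_alg V) (ev_at \<xi>) const_upow G act_upow \<one>\<^bsub>BijGroup V\<^esub> (ev_at \<xi> free_function)
     (range (\<lambda>i. ev_at \<xi> (\<lambda>x\<in>V. x $ i)))"
proof (intro embedded_action.intro embedded_algebra_coord galois_action_coord, unfold_locales)
  show "const_upow c \<in> A.invariants" for c
  proof -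
    have "fun_act V g (\<lambda>x\<in>V. c) = (\<lambda>x\<in>V. c)" if "g \<in> G" for g
      using inverse_map_V[OF that] by (auto simp: fun_eq_iff fun_act_def compose_def)
    then have "(\<lambda>x\<in>V. c) \<in> inv_funs V G"
      unfolding inv_funs_def using const_coord_funs by blast
    then show ?thesis
      unfolding invariants_eq using ev_at_const[of c] by (metis image_eqI)
  qed
  show "finite (range (\<lambda>i. ev_at \<xi> (\<lambda>x\<in>V. x $ i)))"
    by simp
  show "range (\<lambda>i. ev_at \<xi> (\<lambda>x\<in>V. x $ i)) \<subseteq> ev_at \<xi> ` carrier (coord_alg V)"
    using poly_funs.coord unfolding coord_alg_simps coord_funs_def by blast
  show "ev_at \<xi> ` carrier (coord_alg V) \<subseteq> C"
    if "range const_upow \<subseteq> C" "range (\<lambda>i. ev_at \<xi> (\<lambda>x\<in>V. x $ i)) \<subseteq> C"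
      "\<And>x y. x \<in> C \<Longrightarrow> y \<in> C \<Longrightarrow> x + y \<in> C" "\<And>x y. x \<in> C \<Longrightarrow> y \<in> C \<Longrightarrow> x * y \<in> C" for C
    unfolding coord_alg_simps using that by (intro coord_funs_generated) auto
qed

interpretation EA: embedded_action "coord_alg V" "ev_at \<xi>" const_upow G act_upow "\<one>\<^bsub>BijGroup V\<^esub>"
    "ev_at \<xi> free_function" "range (\<lambda>i. ev_at \<xi> (\<lambda>x\<in>V. x $ i))"
  by (rule embedded_action_coord)

lemma op_act_mem:
  assumes g: "g \<in> G" and d: "d \<in> carrier (D_alg V)"
  shows "op_act V g d \<in> carrier (D_alg V)"
proof -
  let ?A = "ev_at \<xi> ` carrier (coord_alg V)"
  interpret AA: operator_domain ?A ?A
    by (rule A.operator_domain_self)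
  have l: "d \<in> lin_endos (coord_alg V)"
    using d E.carrier_diff_op_alg by blast
  note D = E.transport_lin[OF l]
  have g': "inverse_map g \<in> G"
    by (rule inverse_map_G[OF g])
  have inv: "act_upow g (act_upow (inverse_map g) x) = x" if "x \<in> ?A" for x
    using that fun_act_inverse(1)[OF g] by (auto simp: act_upow_ev fun_act_coord[OF g'] coord_funs_extensional)
  have const: "act_upow h (const_upow c) = const_upow c" if "h \<in> G" for h c
    using A.invariants_fixed[OF EA.\<iota>_invariant that] .
  have cA: "const_upow c \<in> ?A" for c
    using EA.\<iota>_invariant A.invariants_subset by blast
  obtain n where n: "diff_ord ?A ?A n (E.transport d)"
    using d E.carrier_diff_op_alg by blast
  obtain d' where d': "d' \<in> carrier (D_alg V)"
    "\<forall>f\<in>carrier (coord_alg V).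
       ev_at \<xi> (d' f) = act_upow g (E.transport d (act_upow (inverse_map g) (ev_at \<xi> f)))"
  proof (rule E.diff_op_of_field_op)
    show "additive_on ?A (\<lambda>x. act_upow g (E.transport d (act_upow (inverse_map g) x)))"
      unfolding additive_on_def
    proof (intro ballI)
      fix x y assume "x \<in> ?A" "y \<in> ?A"
      then have "act_upow (inverse_map g) (x + y) = act_upow (inverse_map g) x + act_upow (inverse_map g) y"
        and xy: "act_upow (inverse_map g) x \<in> ?A" "act_upow (inverse_map g) y \<in> ?A"
        using A.act_add[OF g'] A.act_mem[OF g'] by auto
      moreover have "E.transport d (act_upow (inverse_map g) x + act_upow (inverse_map g) y) =
          E.transport d (act_upow (inverse_map g) x) + E.transport d (act_upow (inverse_map g) y)"
        using D(1) xy unfolding additive_on_def by blast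
      ultimately show "act_upow g (E.transport d (act_upow (inverse_map g) (x + y))) =
          act_upow g (E.transport d (act_upow (inverse_map g) x)) +
          act_upow g (E.transport d (act_upow (inverse_map g) y))"
        using A.act_add[OF g D(2)[OF xy(1)] D(2)[OF xy(2)]] by simp
    qed
    show "diff_ord ?A ?A n (\<lambda>x. act_upow g (E.transport d (act_upow (inverse_map g) x)))"
      by (rule A.diff_ord_conjugate[OF g g' inv n D(2)])
    show "act_upow g (E.transport d (act_upow (inverse_map g) x)) \<in> ?A" if "x \<in> ?A" for x
      by (rule A.act_mem[OF g D(2)[OF A.act_mem[OF g' that]]])
    show "act_upow g (E.transport d (act_upow (inverse_map g) (const_upow c * x))) =
        const_upow c * act_upow g (E.transport d (act_upow (inverse_map g) x))" if x: "x \<in> ?A" for x c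
      using A.act_mult[OF g' cA x] A.act_mult[OF g cA D(2)[OF A.act_mem[OF g' x]]]
        D(3)[OF A.act_mem[OF g' x]] const[OF g] const[OF g'] by simp
  qed
  have "op_act V g d = d'"
  proof (rule extensionalityI[of _ "coord_funs V"])
    show "op_act V g d \<in> extensional (coord_funs V)"
      by (simp add: op_act_def)
    have l': "d' \<in> lin_endos (coord_alg V)"
      using d'(1) E.carrier_diff_op_alg by blast
    then show "d' \<in> extensional (coord_funs V)"
      using E.lin_endosD(4) by simp
    fix f assume f: "f \<in> coord_funs V"
    have f': "fun_act V (inverse_map g) f \<in> coord_funs V"
      by (rule fun_act_coord[OF g' f])
    then have df': "d (fun_act V (inverse_map g) f) \<in> coord_funs V"
      using E.lin_endosD(1)[OF l] by simp
    have "ev_at \<xi> (d' f) = ev_at \<xi> (fun_act V g (d (fun_act V (inverse_map g) f)))"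
      using d'(2) f f' df' E.transport_ev[of "fun_act V (inverse_map g) f" d] by (simp add: act_upow_ev)
    then have "d' f = fun_act V g (d (fun_act V (inverse_map g) f))"
      using ev_at_inj fun_act_coord[OF g df'] E.lin_endosD(1)[OF l', of f] f by simp
    then show "op_act V g d f = d' f"
      using f by (simp add: op_act_def)
  qed
  then show ?thesis
    using d'(1) by simp
qed

text \<open>On an invariant b the conjugate of d by g takes the value g (d b). So d maps invariants
  to invariants exactly when all its conjugates agree with d on the invariants, and there a
  differential operator is determined.\<close>

lemma D_inv_alg_eq: "D_inv_alg V G = EA.preserving_alg"
proof -
  have "(\<forall>g\<in>G. op_act V g d = d) \<longleftrightarrow>
      (\<forall>b\<in>carrier (coord_alg V). ev_at \<xi> b \<in> A.invariants \<longrightarrow> ev_at \<xi> (d b) \<in> A.invariants)"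
    if d: "d \<in> carrier (D_alg V)" for d
  proof -
    have dV: "d f \<in> coord_funs V" if "f \<in> coord_funs V" for f
      using d E.carrier_diff_op_alg E.lin_endosD(1)[of d f] that by simp
    have op: "op_act V g d b = fun_act V g (d b)" if "g \<in> G" "b \<in> inv_funs V G" for g b
      using that inverse_map_G[OF that(1)] by (auto simp: op_act_def inv_funs_def)
    show ?thesis
    proof
      assume inv: "\<forall>g\<in>G. op_act V g d = d"
      show "\<forall>b\<in>carrier (coord_alg V). ev_at \<xi> b \<in> A.invariants \<longrightarrow> ev_at \<xi> (d b) \<in> A.invariants"
      proof (intro ballI impI)
        fix b assume "b \<in> carrier (coord_alg V)" "ev_at \<xi> b \<in> A.invariants"
        then have b: "b \<in> coord_funs V" "b \<in> inv_funs V G"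
          using ev_at_invariants by auto
        have "fun_act V g (d b) = d b" if g: "g \<in> G" for g
          using op[OF g b(2)] inv g by simp
        then have "d b \<in> inv_funs V G"
          using dV[OF b(1)] unfolding inv_funs_def by blast
        then show "ev_at \<xi> (d b) \<in> A.invariants"
          using ev_at_invariants[OF dV[OF b(1)]] by blast
      qed
    next
      assume pres: "\<forall>b\<in>carrier (coord_alg V). ev_at \<xi> b \<in> A.invariants \<longrightarrow> ev_at \<xi> (d b) \<in> A.invariants"
      show "\<forall>g\<in>G. op_act V g d = d"
      proof
        fix g assume g: "g \<in> G"
        show "op_act V g d = d"
        proof (rule EA.diff_op_eqI[OF op_act_mem[OF g d] d])
          fix b assume b: "b \<in> carrier (coord_alg V)" "ev_at \<xi> b \<in> A.invariants"
          then have "d b \<in> inv_funs V G" "b \<in> inv_funs V G"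
            using pres ev_at_invariants dV by auto
          then show "op_act V g d b = d b"
            using op[OF g] g by (simp add: inv_funs_def)
        qed
      qed
    qed
  qed
  then have "{d \<in> carrier (D_alg V). \<forall>g\<in>G. op_act V g d = d} =
      {d \<in> carrier (D_alg V). \<forall>b\<in>carrier (coord_alg V). ev_at \<xi> b \<in> A.invariants \<longrightarrow> ev_at \<xi> (d b) \<in> A.invariants}"
    by blast
  then show ?thesis
    unfolding D_inv_alg_def EA.preserving_alg_def by simp
qed

theorem frac_embedding_D_inv_alg:
  "\<exists>\<eta>. frac_embedding (D_inv_alg V G) (field_ops (fracs (ev_at \<xi> ` inv_funs V G)) const_upow) \<eta>"
  using EA.frac_embedding_preserving unfolding D_inv_alg_eq invariants_eq by blast

lemma subring_set_inv_funs: "subring_set (ev_at \<xi> ` inv_funs V G)"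
  using A.subring_set_invariants unfolding invariants_eq .

end

text \<open>With the trivial group, the embedding obtained for invariant operators also serves the
  full ring of operators on \<open>W\<close>.\<close>

lemma D_inv_alg_trivial:
  fixes W :: "(complex ^ 'm) set"
  shows "D_inv_alg W {\<one>\<^bsub>BijGroup W\<^esub>} = D_alg W" "inv_funs W {\<one>\<^bsub>BijGroup W\<^esub>} = coord_funs W"
proof -
  interpret Bij: group "BijGroup W"
    by (rule group_BijGroup)
  have act: "fun_act W \<one>\<^bsub>BijGroup W\<^esub> f = f" if "f \<in> coord_funs W" for f
  proof -
    have one: "\<one>\<^bsub>BijGroup W\<^esub> = (\<lambda>x\<in>W. x)"
      by (simp add: BijGroup_def)
    show ?thesis
      using coord_funs_extensional[OF that] unfolding fun_act_def Bij.inv_one unfolding one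
      by (auto simp: compose_def fun_eq_iff extensional_def)
  qed
  then show "inv_funs W {\<one>\<^bsub>BijGroup W\<^esub>} = coord_funs W"
    by (auto simp: inv_funs_def)
  have "op_act W \<one>\<^bsub>BijGroup W\<^esub> d = d" if d: "d \<in> carrier (D_alg W)" for d
  proof -
    have "d \<in> diff_ops_upto (coord_alg W) n \<Longrightarrow> d \<in> coord_funs W \<rightarrow>\<^sub>E coord_funs W" for n
      by (cases n) (auto simp: lin_endos_def coord_funs_closed)
    then have d: "d \<in> coord_funs W \<rightarrow>\<^sub>E coord_funs W"
      using d by (auto simp: diff_op_alg_def)
    show ?thesis
    proof (rule extensionalityI[of _ "coord_funs W"])
      show "op_act W \<one>\<^bsub>BijGroup W\<^esub> d f = d f" if "f \<in> coord_funs W" for f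
        using that PiE_mem[OF d that] by (simp add: op_act_def act)
    qed (use d in \<open>auto simp: op_act_def PiE_def\<close>)
  qed
  then have eq: "{d \<in> carrier (D_alg W). \<forall>g\<in>{\<one>\<^bsub>BijGroup W\<^esub>}. op_act W g d = d} = carrier (D_alg W)"
    by auto
  show "D_inv_alg W {\<one>\<^bsub>BijGroup W\<^esub>} = D_alg W"
    unfolding D_inv_alg_def eq by (simp add: diff_op_alg_def)
qed

section \<open>Birational equivalence and function fields\<close>

lemma fracs_eqI:
  assumes "subring_set S" "subring_set S'" "S \<subseteq> fracs S'" "S' \<subseteq> fracs S"
  shows "fracs S = fracs S'"
proof -
  have "fracs S \<subseteq> fracs S'" if "subring_set S'" "S \<subseteq> fracs S'" for S S' :: "'a set"
    using subring_set.fracs_divide[OF that(1)] that(2) by (auto simp: fracs_def[of S])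
  then show ?thesis
    using assms by blast
qed

lemma ev_at_quotient:
  fixes \<xi> :: "'b set \<Rightarrow> 'p" and \<zeta> :: "'b set \<Rightarrow> 'q"
  assumes "eventually (\<lambda>F. b (\<zeta> F) \<noteq> 0 \<and> h (\<xi> F) = a (\<zeta> F) / b (\<zeta> F)) fin_ultra"
  shows "ev_at \<xi> h = ev_at \<zeta> a / ev_at \<zeta> b" "ev_at \<zeta> b \<noteq> 0"
proof -
  show "ev_at \<xi> h = ev_at \<zeta> a / ev_at \<zeta> b"
    unfolding ev_at_def divide_upow.abs_eq upow.abs_eq_iff using assms by eventually_elim simp
  have "\<not> eventually (\<lambda>F. b (\<zeta> F) = 0) fin_ultra"
  proof
    assume "eventually (\<lambda>F. b (\<zeta> F) = 0) fin_ultra"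
    with assms have "eventually (\<lambda>F. False) (fin_ultra :: 'b set filter)"
      by eventually_elim simp
    then show False
      by (simp add: eventually_False fin_ultra_proper)
  qed
  then show "ev_at \<zeta> b \<noteq> 0"
    by (simp add: ev_at_def zero_upow_def upow.abs_eq_iff)
qed

text \<open>Regular functions are local quotients by definition, so a global function needs a
  denominator equal to 1, which is \<open>u\<close>.\<close>

lemma regular_on_Funs:
  assumes "zariski_open S Z" "f \<in> Funs S" "u \<in> Funs S" "\<And>x. x \<in> Z \<Longrightarrow> u x = 1"
  shows "regular_on S Z f"
  unfolding regular_on_def
proof
  fix x assume "x \<in> Z"
  have "\<forall>y\<in>Z. u y \<noteq> 0 \<and> f y = f y / u y"
    using assms(4) by simp
  then show "\<exists>W. zariski_open S W \<and> x \<in> W \<and> W \<subseteq> Z \<and>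
      (\<exists>a\<in>Funs S. \<exists>b\<in>Funs S. \<forall>y\<in>W. b y \<noteq> 0 \<and> f y = a y / b y)"
    using assms(1-3) \<open>x \<in> Z\<close> by blast
qed

context generic_action
begin

section \<open>Generic points of the quotient\<close>

lemma quotient_pullback:
  assumes "f \<in> Funs (quotient_space V G)"
  shows "compose V f (proj_orbit V G) \<in> inv_funs V G" "compose V f (proj_orbit V G) \<in> coord_funs V"
  using assms by (auto simp: quotient_space_def inv_funs_def)

lemma ev_at_pullback: "ev_at \<xi> (compose V f (proj_orbit V G)) = ev_at (\<lambda>F. proj_orbit V G (\<xi> F)) f"
  using ev_at_eqI[of "compose V f (proj_orbit V G)" "\<lambda>x. f (proj_orbit V G x)"]
  by (simp add: compose_eq ev_at_def)

text \<open>A nonempty open set contains the nonvanishing set of some function whose pullback to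
  \<open>V\<close> is not identically zero, and the generic point avoids the zeros of that
  pullback.\<close>

lemma generic_in_open:
  assumes "zariski_open (quotient_space V G) Z" "Z \<noteq> {}"
  shows "eventually (\<lambda>F. proj_orbit V G (\<xi> F) \<in> Z) fin_ultra"
proof -
  obtain H where H: "H \<subseteq> Funs (quotient_space V G)" "Z = {x \<in> proj_orbit V G ` V. \<exists>f\<in>H. f x \<noteq> 0}"
    using assms(1) by (auto simp: zariski_open_def quotient_space_def)
  obtain f x where fx: "f \<in> H" "x \<in> V" "f (proj_orbit V G x) \<noteq> 0"
    using assms(2) H(2) by blast
  have "\<exists>x\<in>V. compose V f (proj_orbit V G) x \<noteq> 0"
    using fx by (intro bexI[of _ x]) (simp_all add: compose_eq)
  then have "eventually (\<lambda>F. compose V f (proj_orbit V G) (\<xi> F) \<noteq> 0) fin_ultra"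
    using generic_nonzero quotient_pullback(2) H(1) fx(1) by blast
  with generic_mem show ?thesis
    by eventually_elim (use H(2) fx(1) in \<open>auto simp: compose_eq\<close>)
qed

lemma quotient_space_one:
  obtains u where "u \<in> Funs (quotient_space V G)" "\<forall>z\<in>proj_orbit V G ` V. u z = 1"
proof -
  have "fun_act V g (\<lambda>x\<in>V. 1) = (\<lambda>x\<in>V. 1)" if "g \<in> G" for g
    using inverse_map_V[OF that] by (auto simp: fun_eq_iff fun_act_def compose_def)
  then have "(\<lambda>x\<in>V. 1) \<in> inv_funs V G"
    unfolding inv_funs_def using const_coord_funs by blast
  then obtain u where u: "u \<in> Funs (quotient_space V G)" "compose V u (proj_orbit V G) = (\<lambda>x\<in>V. 1)"
    using bij_betw_imp_surj_on[OF quotient_space_funs_bij[OF subgroup_G]] by (metis (no_types, lifting) imageE)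
  have "u (proj_orbit V G x) = 1" if "x \<in> V" for x
    using fun_cong[OF u(2), of x] that by (simp add: compose_eq)
  then show thesis
    using that[OF u(1)] by blast
qed

theorem birational_generic_point:
  fixes W :: "(complex ^ 'm) set"
  assumes W: "irreducible_affine_variety W"
    and birational: "birationally_equivalent (quotient_space V G) (variety_space W)"
  shows "\<exists>\<zeta> :: 'b set \<Rightarrow> complex ^ 'm. generic_point W \<zeta> \<and>
    fracs (ev_at \<xi> ` inv_funs V G) = fracs (ev_at \<zeta> ` coord_funs W)"
proof -
  let ?S = "quotient_space V G" and ?T = "variety_space W" and ?\<pi> = "proj_orbit V G"
  obtain U U' \<phi> where U: "zariski_open ?S U" "U \<noteq> {}" and U': "zariski_open ?T U'" "U' \<noteq> {}"
    and bij: "bij_betw \<phi> U U'" and mor: "open_morphism ?S U ?T U' \<phi>"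
    and mor': "open_morphism ?T U' ?S U (inv_into U \<phi>)"
    using birational unfolding birationally_equivalent_def by blast
  have Funs_T: "Funs ?T = coord_funs W" and Points_T: "Points ?T = W"
    by (simp_all add: variety_space_def)
  have U'W: "U' \<subseteq> W"
    using U'(1) Points_T unfolding zariski_open_def by blast
  \<comment> \<open>The generic point of \<open>W\<close> is the image of that of \<open>V\<close>:
    evaluation at \<open>\<zeta>\<close> is then evaluation at \<open>\<xi>\<close> after pullback,
    which lets the two function fields be literally equal.\<close>
  define \<zeta> where "\<zeta> F = \<phi> (?\<pi> (\<xi> F))" for F
  have gen: "eventually (\<lambda>F. ?\<pi> (\<xi> F) \<in> U \<and> \<zeta> F \<in> Z) fin_ultra"
    if Z: "zariski_open ?T Z" "Z \<subseteq> U'" "Z \<noteq> {}" for Z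
  proof -
    have "zariski_open ?S {x \<in> U. \<phi> x \<in> Z}"
      using mor Z(1,2) unfolding open_morphism_def by blast
    moreover have "{x \<in> U. \<phi> x \<in> Z} \<noteq> {}"
      using bij Z(2,3) unfolding bij_betw_def by blast
    ultimately have "eventually (\<lambda>F. ?\<pi> (\<xi> F) \<in> {x \<in> U. \<phi> x \<in> Z}) fin_ultra"
      by (rule generic_in_open)
    then show ?thesis
      by eventually_elim (simp add: \<zeta>_def)
  qed
  have generic: "generic_point W \<zeta>"
  proof
    show "eventually (\<lambda>F. \<zeta> F \<in> W) fin_ultra"
      using gen[OF U'(1) order_refl U'(2)] by eventually_elim (use U'W in blast)
    show "eventually (\<lambda>F. c (\<zeta> F) \<noteq> 0) fin_ultra" if c: "c \<in> coord_funs W" "\<exists>y\<in>W. c y \<noteq> 0" for c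
    proof -
      \<comment> \<open>\<open>\<phi>\<close> reaches only \<open>U'\<close>. Multiplying
        \<open>c\<close> by one of the functions that define \<open>U'\<close> gives a nonempty open
        set inside \<open>U'\<close> on which \<open>c\<close> has no zero.\<close>
      obtain H where H: "H \<subseteq> coord_funs W" "U' = {y \<in> W. \<exists>f\<in>H. f y \<noteq> 0}"
        using U'(1) unfolding zariski_open_def Funs_T Points_T by blast
      obtain f where f: "f \<in> H" "\<exists>y\<in>W. f y \<noteq> 0"
        using U'(2) H(2) by blast
      have fW: "f \<in> coord_funs W"
        using f H by blast
      define Z where "Z = {y \<in> W. \<exists>g\<in>{\<lambda>y\<in>W. c y * f y}. g y \<noteq> 0}"
      have Z: "y \<in> Z \<longleftrightarrow> y \<in> W \<and> c y \<noteq> 0 \<and> f y \<noteq> 0" for y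
        by (auto simp: Z_def)
      have "zariski_open ?T Z"
        unfolding zariski_open_def Funs_T Points_T Z_def
        using coord_funs_closed(2)[OF c(1) fW] by blast
      moreover have "Z \<subseteq> U'"
        using H(2) f(1) Z by blast
      moreover have "Z \<noteq> {}"
        using irreducible_coord_funs[OF W c(1) fW c(2) f(2)] Z by blast
      ultimately have "eventually (\<lambda>F. ?\<pi> (\<xi> F) \<in> U \<and> \<zeta> F \<in> Z) fin_ultra"
        by (rule gen)
      then show ?thesis
        by eventually_elim (use Z in blast)
    qed
  qed
  interpret W: generic_point W \<zeta>
    by (rule generic)
  interpret EW: embedded_algebra "coord_alg W" "ev_at \<zeta>" const_upow
    by (rule W.embedded_algebra_coord)
  have sub1: "ev_at \<zeta> c \<in> fracs (ev_at \<xi> ` inv_funs V G)" if c: "c \<in> coord_funs W" for c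
  proof -
    have "regular_on ?T U' c"
      using U' c const_coord_funs[of 1 W] U'W by (intro regular_on_Funs[of _ _ _ "\<lambda>y\<in>W. 1"]) (auto simp: Funs_T)
    then have "regular_on ?S {x \<in> U. \<phi> x \<in> U'} (\<lambda>x. c (\<phi> x))"
      using mor U'(1) unfolding open_morphism_def by blast
    moreover obtain x where "x \<in> {x \<in> U. \<phi> x \<in> U'}"
      using U(2) bij unfolding bij_betw_def by blast
    \<comment> \<open>One local expression as a quotient suffices, since the generic point lies in
      every nonempty open set.\<close>
    ultimately obtain Z a b where Z: "zariski_open ?S Z" "x \<in> Z" and ab: "a \<in> Funs ?S" "b \<in> Funs ?S"
      and eq: "\<forall>y\<in>Z. b y \<noteq> 0 \<and> c (\<phi> y) = a y / b y"
      unfolding regular_on_def by blast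
    have "eventually (\<lambda>F. ?\<pi> (\<xi> F) \<in> Z) fin_ultra"
      using generic_in_open[OF Z(1)] Z(2) by blast
    then have ev: "eventually (\<lambda>F. b (?\<pi> (\<xi> F)) \<noteq> 0 \<and> c (\<zeta> F) = a (?\<pi> (\<xi> F)) / b (?\<pi> (\<xi> F))) fin_ultra"
      by eventually_elim (use eq in \<open>simp add: \<zeta>_def\<close>)
    note q = ev_at_quotient[where \<zeta> = "\<lambda>F. ?\<pi> (\<xi> F)" and \<xi> = \<zeta>, OF ev]
    show ?thesis
      using q quotient_pullback(1)[OF ab(1)] quotient_pullback(1)[OF ab(2)]
      unfolding ev_at_pullback[symmetric] by (simp add: fracsI)
  qed
  have sub2: "ev_at \<xi> h \<in> fracs (ev_at \<zeta> ` coord_funs W)" if h: "h \<in> inv_funs V G" for h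
  proof -
    obtain f where f: "f \<in> Funs ?S" "compose V f ?\<pi> = h"
      using h bij_betw_imp_surj_on[OF quotient_space_funs_bij[OF subgroup_G]] by (metis (no_types, lifting) imageE)
    obtain u where u: "u \<in> Funs ?S" "\<forall>z\<in>?\<pi> ` V. u z = 1"
      by (rule quotient_space_one)
    have "U \<subseteq> ?\<pi> ` V"
      using U(1) by (auto simp: zariski_open_def quotient_space_def)
    then have "regular_on ?S U f"
      using U(1) f(1) u by (intro regular_on_Funs[of _ _ _ u]) auto
    then have "regular_on ?T {y \<in> U'. inv_into U \<phi> y \<in> U} (\<lambda>y. f (inv_into U \<phi> y))"
      using mor' U(1) unfolding open_morphism_def by blast
    moreover obtain y where "y \<in> {y \<in> U'. inv_into U \<phi> y \<in> U}"
      using U'(2) bij inv_into_into[of _ \<phi> U] unfolding bij_betw_def by blast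
    ultimately obtain Z a b where Z: "zariski_open ?T Z" "y \<in> Z" "Z \<subseteq> {y \<in> U'. inv_into U \<phi> y \<in> U}"
      and ab: "a \<in> coord_funs W" "b \<in> coord_funs W"
      and eq: "\<forall>y\<in>Z. b y \<noteq> 0 \<and> f (inv_into U \<phi> y) = a y / b y"
      unfolding regular_on_def Funs_T by blast
    have "eventually (\<lambda>F. ?\<pi> (\<xi> F) \<in> U \<and> \<zeta> F \<in> Z) fin_ultra"
      using Z by (intro gen) auto
    then have ev: "eventually (\<lambda>F. b (\<zeta> F) \<noteq> 0 \<and> f (?\<pi> (\<xi> F)) = a (\<zeta> F) / b (\<zeta> F)) fin_ultra"
    proof eventually_elim
      case (elim F)
      \<comment> \<open>The generic orbit lies in \<open>U\<close>, where \<open>inv_into\<close>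
        undoes \<open>\<phi>\<close>.\<close>
      have "inv_into U \<phi> (\<zeta> F) = ?\<pi> (\<xi> F)"
        unfolding \<zeta>_def using elim bij_betw_inv_into_left[OF bij] by blast
      then show ?case
        using eq elim by auto
    qed
    note q = ev_at_quotient[where \<xi> = "\<lambda>F. ?\<pi> (\<xi> F)" and \<zeta> = \<zeta>, OF ev]
    show ?thesis
      using q ab unfolding ev_at_pullback[symmetric] f(2) by (simp add: fracsI)
  qed
  have "subring_set (ev_at \<zeta> ` coord_funs W)"
    using EW.subring_set_image by simp
  then have "fracs (ev_at \<xi> ` inv_funs V G) = fracs (ev_at \<zeta> ` coord_funs W)"
    using sub1 sub2 by (intro fracs_eqI subring_set_inv_funs) auto
  then show ?thesis
    using generic by blast
qed

end

theorem theorem1p2: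
  fixes V :: "(complex ^ 'n) set" and W :: "(complex ^ 'm) set"
    and G :: "(complex ^ 'n \<Rightarrow> complex ^ 'n) set"
  assumes "irreducible_affine_variety V"
    and "subgroup G (BijGroup V)" and "G \<subseteq> variety_auts V" and "finite G"
    and "irreducible_affine_variety W"
    and "birationally_equivalent (quotient_space V G) (variety_space W)"
  shows "alg_isomorphic (Frac (D_inv_alg V G)) (Frac (D_alg W))"
proof -
  obtain \<xi> :: "(complex ^ 'n \<Rightarrow> complex) set \<Rightarrow> complex ^ 'n" where "generic_point V \<xi>"
    using generic_point_exists[OF assms(1)] by blast
  then interpret V: generic_action V \<xi> G
    using assms by (simp add: generic_action_def generic_action_axioms_def)
  \<comment> \<open>Both points use the index type built from functions on the space of
    \<open>V\<close>, so both function fields lie in the same ultrapower.\<close>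
  obtain \<zeta> :: "(complex ^ 'n \<Rightarrow> complex) set \<Rightarrow> complex ^ 'm" where \<zeta>: "generic_point W \<zeta>"
    and fracs: "fracs (ev_at \<xi> ` inv_funs V G) = fracs (ev_at \<zeta> ` coord_funs W)"
    using V.birational_generic_point[OF assms(5,6)] by blast
  interpret Bij: group "BijGroup W"
    by (rule group_BijGroup)
  have one: "\<one>\<^bsub>BijGroup W\<^esub> = (\<lambda>x\<in>W. x)"
    by (simp add: BijGroup_def)
  have "polynomial_map_on W (\<lambda>x\<in>W. x)"
    unfolding polynomial_map_on_def
    by (intro exI[of _ "\<lambda>i x. x $ i"]) (auto simp: vec_eq_iff intro: poly_funs.coord)
  then have "polynomial_map_on W \<one>\<^bsub>BijGroup W\<^esub>"
    unfolding one .
  moreover have "\<one>\<^bsub>BijGroup W\<^esub> \<in> Bij W"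
    using Bij.one_closed by (simp add: BijGroup_def)
  ultimately have "\<one>\<^bsub>BijGroup W\<^esub> \<in> variety_auts W"
    by (simp add: variety_auts_def)
  then interpret W: generic_action W \<zeta> "{\<one>\<^bsub>BijGroup W\<^esub>}"
    using \<zeta> Bij.triv_subgroup by (simp add: generic_action_def generic_action_axioms_def)
  obtain \<eta> where \<eta>: "frac_embedding (D_inv_alg V G) (field_ops (fracs (ev_at \<xi> ` inv_funs V G)) const_upow) \<eta>"
    using V.frac_embedding_D_inv_alg by blast
  obtain \<eta>' where \<eta>': "frac_embedding (D_alg W) (field_ops (fracs (ev_at \<zeta> ` coord_funs W)) const_upow) \<eta>'"
    using W.frac_embedding_D_inv_alg unfolding D_inv_alg_trivial by blast
  show ?thesis
    using Frac_isomorphic_of_embeddings[OF \<eta> \<eta>'[folded fracs]] .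
qed

end
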